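(* Assume (A). Let $\kappa_0\in C^1_b([0,\infty))$ with $J(\cdot,\boldsymbol\pi_0)\ge0$, where $\boldsymbol\pi_0(w,x)=G(w,\kappa_0(x))$, and define recursively $\boldsymbol\pi_n(w,x)=G\big(w,1-J'(x,\boldsymbol\pi_{n-1})\big)$, $n\ge1$, and $v_n=J(\cdot,\boldsymbol\pi_n)$. Then $(v_n)$ is nondecreasing in $n$ and converges, together with $(v_n')$, uniformly on compact subsets of $[0,\infty)$ to $(V,V')$, where $V$ is the value function; and $\boldsymbol\pi_n$ converges uniformly on compacts to $\boldsymbol\pi^*(w,x)=G(w,1-V'(x))$, which is an optimal (strongly admissible) feedback relaxed control.
   Context: Fix constants $\mu\in\mathbb R$, $\sigma>0$, $c>0$, $a>0$, $\lambda>0$ with standing assumption (A): $a>\max\{1,2\mu\}$ and $\mu>\max\{c,\sigma^2/2\}$; a filtered probability space with standard Brownian motion $W$ and its augmented filtration. Open-loop relaxed controls $\pi_t(w,\omega)$: progressively measurable densities on $[0,a]$; state $dX_t=(\mu-\int_0^aw\pi_t(w)dw)dt+\sigma dW_t$, $X_0=x$; ruin time $\tau^\pi_x=\inf\{t>0:X_t<0\}$; $\mathcal H^\pi_\lambda(t)=\int_0^a(w-\lambda\ln\pi_t(w))\pi_t(w)dw$; admissible if $\mathbb E\int_0^{\tau^\pi_x}e^{-ct}|\mathcal H^\pi_\lambda|dt<\infty$; $J(x,\pi)=\mathbb E\int_0^{\tau^\pi_x}e^{-ct}\mathcal H^\pi_\lambda(t)dt$; value function $V(x)=\sup_\pi J(x,\pi)$.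 A closed-loop relaxed control $\boldsymbol\pi(w,x)$ induces $\pi_t(w)=\boldsymbol\pi(w,X_t)$ where $X$ solves $dX_t=(\mu-\int_0^aw\boldsymbol\pi(w,X_t)dw)dt+\sigma dW_t$; $J(x,\boldsymbol\pi)$ is the cost of the induced control, and $J'$ its $x$-derivative. Strongly admissible: $l\le\boldsymbol\pi\le u$ for constants $0<l\le u$ and $\boldsymbol\pi(w,\cdot)$ Lipschitz uniformly in $w$. The Gibbs function is $G(w,y)=\dfrac{y\,e^{wy/\lambda}}{\lambda(e^{ay/\lambda}-1)}$ for $y\ne0$ and $G(w,0)=1/a$. *)

theory Defs
  imports "HOL-Probability.Probability"
begin

definition std_brownian :: "'a measure \<Rightarrow> (real \<Rightarrow> 'a \<Rightarrow> real) \<Rightarrow> bool" where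
  "std_brownian M W \<longleftrightarrow>
     prob_space M \<and>
     (\<forall>t. W t \<in> borel_measurable M) \<and>
     (\<forall>\<omega>\<in>space M. W 0 \<omega> = 0 \<and> continuous_on {0..} (\<lambda>t. W t \<omega>)) \<and>
     (\<forall>s t. 0 \<le> s \<and> s < t \<longrightarrow>
        distributed M lborel (\<lambda>\<omega>. W t \<omega> - W s \<omega>) (\<lambda>x. ennreal (normal_density 0 (sqrt (t - s)) x))) \<and>
     (\<forall>(n::nat) (ts::nat \<Rightarrow> real). 0 \<le> ts 0 \<and> (\<forall>i<n. ts i < ts (Suc i)) \<longrightarrow>
        prob_space.indep_vars M (\<lambda>_. borel) (\<lambda>i \<omega>. W (ts (Suc i)) \<omega> - W (ts i) \<omega>) {..<n})"

definition aug_filtration :: "'a measure \<Rightarrow> (real \<Rightarrow> 'a \<Rightarrow> real) \<Rightarrow> real \<Rightarrow> 'a measure" where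
  "aug_filtration M W t = sigma (space M)
     ({W s -` B \<inter> space M | s B. 0 \<le> s \<and> s \<le> t \<and> B \<in> sets borel} \<union> null_sets M)"

definition open_loop_control ::
  "'a measure \<Rightarrow> (real \<Rightarrow> 'a \<Rightarrow> real) \<Rightarrow> real \<Rightarrow> (real \<Rightarrow> 'a \<Rightarrow> real \<Rightarrow> real) \<Rightarrow> bool" where
  "open_loop_control M W a \<pi> \<longleftrightarrow>
     (\<forall>t\<ge>0. \<forall>\<omega>\<in>space M.
        (\<forall>w\<in>{0..a}. 0 \<le> \<pi> t \<omega> w) \<and>
        set_integrable lborel {0..a} (\<pi> t \<omega>) \<and>
        (LINT w:{0..a}|lborel. \<pi> t \<omega> w) = 1) \<and>
     (\<forall>t\<ge>0. (\<lambda>(s, \<omega>, w). \<pi> s \<omega> w) \<in> borel_measurable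
        (restrict_space lborel {0..t} \<Otimes>\<^sub>M (aug_filtration M W t \<Otimes>\<^sub>M restrict_space lborel {0..a})))"

definition ol_state ::
  "(real \<Rightarrow> 'a \<Rightarrow> real) \<Rightarrow> real \<Rightarrow> real \<Rightarrow> real \<Rightarrow> real \<Rightarrow> (real \<Rightarrow> 'a \<Rightarrow> real \<Rightarrow> real) \<Rightarrow> real \<Rightarrow> 'a \<Rightarrow> real" where
  "ol_state W \<mu> \<sigma> a x \<pi> t \<omega> =
     x + (LINT s:{0..t}|lborel. \<mu> - (LINT w:{0..a}|lborel. w * \<pi> s \<omega> w)) + \<sigma> * W t \<omega>"

definition ruin_time :: "(real \<Rightarrow> 'a \<Rightarrow> real) \<Rightarrow> 'a \<Rightarrow> ereal" where
  "ruin_time X \<omega> = Inf {ereal t | t. 0 < t \<and> X t \<omega> < 0}"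

definition Hrew :: "real \<Rightarrow> real \<Rightarrow> (real \<Rightarrow> 'a \<Rightarrow> real \<Rightarrow> real) \<Rightarrow> real \<Rightarrow> 'a \<Rightarrow> real" where
  "Hrew lam a \<pi> t \<omega> = (LINT w:{0..a}|lborel. (w - lam * ln (\<pi> t \<omega> w)) * \<pi> t \<omega> w)"

definition admissible ::
  "'a measure \<Rightarrow> (real \<Rightarrow> 'a \<Rightarrow> real) \<Rightarrow> real \<Rightarrow> real \<Rightarrow> real \<Rightarrow> real \<Rightarrow> real \<Rightarrow> real
     \<Rightarrow> (real \<Rightarrow> 'a \<Rightarrow> real \<Rightarrow> real) \<Rightarrow> bool" where
  "admissible M W \<mu> \<sigma> c a lam x \<pi> \<longleftrightarrow>
     open_loop_control M W a \<pi> \<and>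
     (\<forall>t\<ge>0. \<forall>\<omega>\<in>space M.
        set_integrable lborel {0..a} (\<lambda>w. (w - lam * ln (\<pi> t \<omega> w)) * \<pi> t \<omega> w)) \<and>
     (\<integral>\<^sup>+ \<omega>. (\<integral>\<^sup>+ t. indicator {t. 0 \<le> t \<and> ereal t < ruin_time (ol_state W \<mu> \<sigma> a x \<pi>) \<omega>} t
                     * ennreal (exp (- c * t) * \<bar>Hrew lam a \<pi> t \<omega>\<bar>) \<partial>lborel) \<partial>M) < \<infinity>"

definition Jol ::
  "'a measure \<Rightarrow> (real \<Rightarrow> 'a \<Rightarrow> real) \<Rightarrow> real \<Rightarrow> real \<Rightarrow> real \<Rightarrow> real \<Rightarrow> real \<Rightarrow> real
     \<Rightarrow> (real \<Rightarrow> 'a \<Rightarrow> real \<Rightarrow> real) \<Rightarrow> real" where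
  "Jol M W \<mu> \<sigma> c a lam x \<pi> =
     (\<integral>\<omega>. (LINT t:{t. 0 \<le> t \<and> ereal t < ruin_time (ol_state W \<mu> \<sigma> a x \<pi>) \<omega>}|lborel.
              exp (- c * t) * Hrew lam a \<pi> t \<omega>) \<partial>M)"

definition value_fn ::
  "'a measure \<Rightarrow> (real \<Rightarrow> 'a \<Rightarrow> real) \<Rightarrow> real \<Rightarrow> real \<Rightarrow> real \<Rightarrow> real \<Rightarrow> real \<Rightarrow> real \<Rightarrow> ereal" where
  "value_fn M W \<mu> \<sigma> c a lam x =
     (SUP \<pi>\<in>{\<pi>. admissible M W \<mu> \<sigma> c a lam x \<pi>}. ereal (Jol M W \<mu> \<sigma> c a lam x \<pi>))"

definition closed_loop_control :: "real \<Rightarrow> (real \<Rightarrow> real \<Rightarrow> real) \<Rightarrow> bool" where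
  "closed_loop_control a \<pi> \<longleftrightarrow>
     (\<lambda>(w, x). \<pi> w x) \<in> borel_measurable borel \<and>
     (\<forall>x\<ge>0. (\<forall>w\<in>{0..a}. 0 \<le> \<pi> w x) \<and> set_integrable lborel {0..a} (\<lambda>w. \<pi> w x) \<and>
             (LINT w:{0..a}|lborel. \<pi> w x) = 1)"

definition strongly_admissible :: "real \<Rightarrow> (real \<Rightarrow> real \<Rightarrow> real) \<Rightarrow> bool" where
  "strongly_admissible a \<pi> \<longleftrightarrow>
     closed_loop_control a \<pi> \<and>
     (\<exists>l u. 0 < l \<and> l \<le> u \<and> (\<forall>w\<in>{0..a}. \<forall>x\<ge>0. l \<le> \<pi> w x \<and> \<pi> w x \<le> u)) \<and>
     (\<exists>L. \<forall>w\<in>{0..a}. \<forall>x\<ge>0. \<forall>y\<ge>0. \<bar>\<pi> w x - \<pi> w y\<bar> \<le> L * \<bar>x - y\<bar>)"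

text \<open>Pathwise solution of dX = (mu - int_0^a w bpi(w, X) dw) dt + sigma dW, X_0 = x.
  The feedback is evaluated at max 0 X; this only affects the path after ruin
  (before ruin X >= 0), hence does not affect the cost.\<close>
definition cl_path ::
  "(real \<Rightarrow> 'a \<Rightarrow> real) \<Rightarrow> real \<Rightarrow> real \<Rightarrow> real \<Rightarrow> real \<Rightarrow> (real \<Rightarrow> real \<Rightarrow> real) \<Rightarrow> 'a \<Rightarrow> real \<Rightarrow> real" where
  "cl_path W \<mu> \<sigma> a x \<pi> \<omega> = (THE f. \<forall>t.
     f t = x + (LINT s:{0..t}|lborel. \<mu> - (LINT w:{0..a}|lborel. w * \<pi> w (max 0 (f s)))) + \<sigma> * W t \<omega>)"

definition induced_control ::
  "(real \<Rightarrow> 'a \<Rightarrow> real) \<Rightarrow> real \<Rightarrow> real \<Rightarrow> real \<Rightarrow> real \<Rightarrow> (real \<Rightarrow> real \<Rightarrow> real) \<Rightarrow> real \<Rightarrow> 'a \<Rightarrow> real \<Rightarrow> real" where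
  "induced_control W \<mu> \<sigma> a x \<pi> t \<omega> w = \<pi> w (max 0 (cl_path W \<mu> \<sigma> a x \<pi> \<omega> t))"

definition Jcl ::
  "'a measure \<Rightarrow> (real \<Rightarrow> 'a \<Rightarrow> real) \<Rightarrow> real \<Rightarrow> real \<Rightarrow> real \<Rightarrow> real \<Rightarrow> real \<Rightarrow> real
     \<Rightarrow> (real \<Rightarrow> real \<Rightarrow> real) \<Rightarrow> real" where
  "Jcl M W \<mu> \<sigma> c a lam x \<pi> = Jol M W \<mu> \<sigma> c a lam x (induced_control W \<mu> \<sigma> a x \<pi>)"

definition Jcl_deriv ::
  "'a measure \<Rightarrow> (real \<Rightarrow> 'a \<Rightarrow> real) \<Rightarrow> real \<Rightarrow> real \<Rightarrow> real \<Rightarrow> real \<Rightarrow> real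
     \<Rightarrow> (real \<Rightarrow> real \<Rightarrow> real) \<Rightarrow> real \<Rightarrow> real" where
  "Jcl_deriv M W \<mu> \<sigma> c a lam \<pi> x =
     vector_derivative (\<lambda>y. Jcl M W \<mu> \<sigma> c a lam y \<pi>) (at x within {0..})"

definition Gibbs :: "real \<Rightarrow> real \<Rightarrow> real \<Rightarrow> real \<Rightarrow> real" where
  "Gibbs lam a w y = (if y = 0 then 1 / a
     else y * exp (w * y / lam) / (lam * (exp (a * y / lam) - 1)))"

end

theory Submission
  imports Defs
begin

text \<open>For a fixed Gibbs policy the cost solves a linear second-order boundary value problem on the half-line; a
  bounded solution is found by shooting. Newton-type monotonicity of policy iteration comes from the convexity of
  the log-partition function \<open>\<Phi>\<close>: a tangent at the old parameter lies below \<open>\<Phi>\<close>, so the old value is a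
  subsolution for the new policy. The reward of a Gibbs policy is bounded above and grows only logarithmically in its
  parameter, which makes the gradient bounds uniform in \<open>n\<close>; the monotone limit then inherits two derivatives and solves
  the HJB equation.

  Costs and classical solutions are linked by Dynkin's formula up to the ruin time. It is obtained without stochastic
  integrals, from second-order Taylor expansions over a time grid and the independence of Brownian increments from the
  augmented filtration. Existence, uniqueness and adaptedness of the closed-loop state follow from pathwise
  Picard iteration, since the noise is additive.\<close>

section \<open>Gibbs densities and the log-partition function\<close>

text \<open>The entropy closes the iteration. \<open>\<Phi> y - y * m y\<close> is
  \<open>lam\<close> times the differential entropy of the Gibbs density with parameter
  \<open>y\<close>: at most the value for the uniform density, and at least
  \<open>- lam * ln\<close> of the largest density value, which is only linear in
  \<open>\<bar>y\<bar>\<close>. The gradient estimate for the linear equation is linear in the size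
  of the reward, so a bound \<open>D\<close> on one gradient yields a bound of order
  \<open>ln D\<close> on the next, and some \<open>D\<close> is invariant.

  Ruin enters through the condition \<open>v 0 = 0\<close>: the state equals 0 at the ruin time, so
  the boundary term of Dynkin's formula vanishes there. A time grid overshoots the ruin time, where
  the state may be negative; for this reason solutions are extended to the whole line with two
  bounded derivatives.

  The event that ruin occurs before \<open>t\<close> depends on the path before \<open>t\<close>,
  which makes stopping at a grid point independent of the next increment. In the limit of the
  iterates, differentiability is recovered from quadratic Taylor remainders whose constants do not
  depend on \<open>n\<close>.\<close>

definition partition_fn :: "real \<Rightarrow> real \<Rightarrow> real \<Rightarrow> real" where
  "partition_fn lam a y = (if y = 0 then a else lam * (exp (a * y / lam) - 1) / y)"

text \<open>The free energy: the maximum, over densities \<open>p\<close> on \<open>{0..a}\<close>,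
  of the integral of \<open>(w * y - lam * ln (p w)) * p w\<close>, attained at the Gibbs
  density.\<close>

definition log_partition :: "real \<Rightarrow> real \<Rightarrow> real \<Rightarrow> real" where
  "log_partition lam a y = lam * ln (partition_fn lam a y)"

definition gibbs_mean :: "real \<Rightarrow> real \<Rightarrow> real \<Rightarrow> real" where
  "gibbs_mean lam a y = (LINT w:{0..a}|lborel. w * Gibbs lam a w y)"

text \<open>The running reward of the Gibbs density with parameter \<open>y\<close>, after inserting
  \<open>lam * ln (G w y) = w * y - \<Phi> y\<close>; see
  \<open>integral_gibbs_reward\<close>.\<close>

definition gibbs_reward :: "real \<Rightarrow> real \<Rightarrow> real \<Rightarrow> real" where
  "gibbs_reward lam a y = log_partition lam a y + (1 - y) * gibbs_mean lam a y"

lemma set_integrable_continuous: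
  fixes f :: "real \<Rightarrow> real"
  assumes "continuous_on {p..q} f" shows "set_integrable lborel {p..q} f"
  using assms unfolding set_integrable_def
  by (intro borel_integrable_compact) auto

lemma exp_diff_le: "\<bar>exp p - exp q\<bar> \<le> exp E * \<bar>p - q\<bar>" if "p \<le> E" "q \<le> E" for p q E :: real
proof -
  have *: "exp p - exp q \<le> exp E * \<bar>p - q\<bar>" if "p \<le> E" for p q
  proof -
    have "exp p * (1 - exp (q - p)) \<le> exp p * \<bar>p - q\<bar>"
    proof (rule mult_left_mono)
      show "1 - exp (q - p) \<le> \<bar>p - q\<bar>" using exp_ge_add_one_self[of "q - p"] by linarith
    qed simp
    also have "\<dots> \<le> exp E * \<bar>p - q\<bar>" using that by (intro mult_right_mono) auto
    finally show ?thesis by (simp add: algebra_simps exp_diff)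
  qed
  show ?thesis using *[of p q] *[of q p] that by (auto simp: abs_minus_commute abs_le_iff)
qed

locale gibbs_params =
  fixes lam a :: real
  assumes lam_pos: "lam > 0" and a_pos: "a > 0"
begin

abbreviation "G \<equiv> Gibbs lam a"
abbreviation "\<Phi> \<equiv> log_partition lam a"
abbreviation "m \<equiv> gibbs_mean lam a"

lemma partition_fn_pos: "partition_fn lam a y > 0"
proof -
  consider "y = 0" | "y > 0" | "y < 0" by linarith
  then show ?thesis
  proof cases
    case 2
    then have "exp (a * y / lam) > 1" using lam_pos a_pos by simp
    with 2 lam_pos show ?thesis by (simp add: partition_fn_def)
  next
    case 3
    then have "exp (a * y / lam) < 1" using lam_pos a_pos by (simp add: mult_less_0_iff divide_less_0_iff)
    with 3 lam_pos have "lam * (exp (a * y / lam) - 1) < 0" by (simp add: mult_less_0_iff)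
    with 3 show ?thesis by (simp add: partition_fn_def divide_neg_neg)
  qed (simp add: partition_fn_def a_pos)
qed

lemma Gibbs_eq_exp_div: "G w y = exp (w * y / lam) / partition_fn lam a y"
  by (simp add: Gibbs_def partition_fn_def)

lemma Gibbs_eq_exp: "G w y = exp ((w * y - \<Phi> y) / lam)"
proof -
  have "(w * y - \<Phi> y) / lam = w * y / lam - ln (partition_fn lam a y)"
    using lam_pos by (simp add: log_partition_def field_simps)
  then show ?thesis
    using partition_fn_pos[of y] by (simp add: Gibbs_eq_exp_div exp_diff)
qed

lemma Gibbs_pos: "G w y > 0"
  by (simp add: Gibbs_eq_exp)

lemma ln_Gibbs: "lam * ln (G w y) = w * y - \<Phi> y"
  using lam_pos by (simp add: Gibbs_eq_exp)

lemma set_integrable_Gibbs: "set_integrable lborel {0..a} (\<lambda>w. f w * G w y)"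
  if "continuous_on {0..a} f" for f
  using that unfolding Gibbs_eq_exp
  by (intro set_integrable_continuous continuous_intros) (use lam_pos in auto)

lemma integral_Gibbs: "(LINT w:{0..a}|lborel. G w y) = 1"
proof -
  \<comment> \<open>This integral is the origin of \<open>partition_fn\<close>; \<open>y = 0\<close>
    is separate because the antiderivative \<open>?F\<close> divides by \<open>y\<close>.\<close>
  have "(LINT w:{0..a}|lborel. exp (w * y / lam)) = partition_fn lam a y"
  proof (cases "y = 0")
    case True
    then show ?thesis using a_pos
      by (simp add: partition_fn_def set_lebesgue_integral_def)
  next
    case False
    let ?F = "\<lambda>w. lam * exp (w * y / lam) / y"
    have "(LINT w:{0..a}|lborel. exp (w * y / lam)) = ?F a - ?F 0"
      unfolding set_lebesgue_integral_def real_scaleR_def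
    proof (subst mult.commute, rule integral_FTC_Icc_real)
      show "DERIV ?F x :> exp (x * y / lam)" for x
        using False lam_pos by (auto intro!: derivative_eq_intros)
    qed (use a_pos lam_pos in \<open>auto intro!: continuous_intros\<close>)
    then show ?thesis using False by (simp add: partition_fn_def field_simps)
  qed
  then show ?thesis
    using partition_fn_pos[of y] by (simp add: Gibbs_eq_exp_div)
qed

lemma mean_bounds:
  assumes "\<forall>w\<in>{0..a}. 0 \<le> p w" "set_integrable lborel {0..a} p" "(LINT w:{0..a}|lborel. p w) = 1"
  shows "set_integrable lborel {0..a} (\<lambda>w. w * p w)"
    "0 \<le> (LINT w:{0..a}|lborel. w * p w)" "(LINT w:{0..a}|lborel. w * p w) \<le> a"
proof -
  have meas: "set_borel_measurable lborel {0..a} p"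
    using assms(2) by (auto simp: set_integrable_def set_borel_measurable_def)
  have "(\<lambda>w. indicator {0..a} w *\<^sub>R p w) \<in> borel_measurable lborel"
    using meas by (simp add: set_borel_measurable_def)
  from borel_measurable_times[OF _ this, of "\<lambda>w. w"] have m1: "set_borel_measurable lborel {0..a} (\<lambda>w. w * p w)"
    by (simp add: set_borel_measurable_def algebra_simps)
  show int: "set_integrable lborel {0..a} (\<lambda>w. w * p w)"
  proof (rule set_integrable_bound[OF _ m1])
    show "set_integrable lborel {0..a} (\<lambda>w. a * p w)" using assms(2) by simp
    show "AE x in lborel. x \<in> {0..a} \<longrightarrow> norm (x * p x) \<le> norm (a * p x)"
      using assms(1) a_pos by (auto simp: abs_mult intro!: AE_I2 mult_right_mono)
  qed
  show "0 \<le> (LINT w:{0..a}|lborel. w * p w)"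
    using assms(1) unfolding set_lebesgue_integral_def
    by (intro integral_nonneg_AE AE_I2) (auto simp: indicator_def)
  have "(LINT w:{0..a}|lborel. w * p w) \<le> (LINT w:{0..a}|lborel. a * p w)"
    using assms(1) by (intro set_integral_mono int) (auto intro!: mult_right_mono set_integrable_mult_right assms(2))
  then show "(LINT w:{0..a}|lborel. w * p w) \<le> a" by (simp add: assms(3))
qed

lemma Gibbs_density:
  "\<forall>w\<in>{0..a}. 0 \<le> G w y" "set_integrable lborel {0..a} (\<lambda>w. G w y)"
  using set_integrable_Gibbs[of "\<lambda>_. 1" y] Gibbs_pos by (auto simp: less_imp_le)

lemma gibbs_mean_bounds: "0 \<le> m y" "m y \<le> a"
  using mean_bounds[OF Gibbs_density(1) Gibbs_density(2) integral_Gibbs]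
  by (auto simp: gibbs_mean_def)

text \<open>Nonnegativity of the relative entropy of \<open>p\<close> with respect to the Gibbs
  density: \<open>ln r \<le> r - 1\<close> is applied pointwise to \<open>r = G w y / p w\<close>
  and integrated against \<open>p\<close>. The parameter \<open>y\<close> is free, which allows the
  choice \<open>y = 1 - v'\<close> in the HJB inequality.\<close>

lemma gibbs_variational:
  assumes "\<forall>w\<in>{0..a}. 0 \<le> p w" "set_integrable lborel {0..a} p" "(LINT w:{0..a}|lborel. p w) = 1"
    "set_integrable lborel {0..a} (\<lambda>w. (w - lam * ln (p w)) * p w)"
  shows "(LINT w:{0..a}|lborel. (w - lam * ln (p w)) * p w)
    \<le> \<Phi> y + (1 - y) * (LINT w:{0..a}|lborel. w * p w)"
proof -
  note mean = mean_bounds[OF assms(1-3)]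
  \<comment> \<open>The terms \<open>- lam * p w + lam * G w y\<close> come from
    \<open>r - 1\<close> and cancel after integration, since both densities have mass 1.\<close>
  let ?R = "\<lambda>w. (\<Phi> y - lam) * p w + lam * G w y + (1 - y) * (w * p w)"
  have intR: "set_integrable lborel {0..a} ?R"
    by (intro set_integral_add set_integrable_mult_right assms mean Gibbs_density)
  have pt: "(w - lam * ln (p w)) * p w \<le> ?R w" if "w \<in> {0..a}" for w
  \<comment> \<open>Where \<open>p\<close> vanishes the left side is 0 whatever the value of
    \<open>ln 0\<close>, and the right side reduces to \<open>lam * G w y\<close>.\<close>
  proof (cases "p w = 0")
    case True
    then show ?thesis using lam_pos Gibbs_pos[of w y] by (simp add: less_imp_le)
  next
    case False
    with assms(1) that have pos: "p w > 0" by force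
    have "ln (G w y / p w) \<le> G w y / p w - 1"
      using pos Gibbs_pos by (intro ln_le_minus_one) auto
    then have "p w * (ln (G w y) - ln (p w)) \<le> p w * (G w y / p w - 1)"
      using pos Gibbs_pos[of w y] by (intro mult_left_mono) (auto simp: ln_div)
    also have "p w * (G w y / p w - 1) = G w y - p w"
      using pos by (simp add: right_diff_distrib)
    finally have "lam * (p w * (ln (G w y) - ln (p w))) \<le> lam * (G w y - p w)"
      using lam_pos by (intro mult_left_mono) auto
    then have "p w * (lam * ln (G w y)) - lam * ln (p w) * p w \<le> lam * (G w y - p w)"
      by (simp add: algebra_simps)
    then show ?thesis unfolding ln_Gibbs by (simp add: algebra_simps)
  qed
  have "(LINT w:{0..a}|lborel. (w - lam * ln (p w)) * p w) \<le> (LINT w:{0..a}|lborel. ?R w)"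
    using pt by (intro set_integral_mono assms intR) auto
  also have "\<dots> = (\<Phi> y - lam) + lam + (1 - y) * (LINT w:{0..a}|lborel. w * p w)"
    by (subst set_integral_add set_integral_add; (intro set_integral_add set_integrable_mult_right assms mean Gibbs_density)?)+
       (simp add: assms(3) integral_Gibbs)
  finally show ?thesis by simp
qed

lemma set_integrable_gibbs_reward:
  "set_integrable lborel {0..a} (\<lambda>w. (w - lam * ln (G w y)) * G w y)"
  unfolding ln_Gibbs by (intro set_integrable_Gibbs continuous_intros)

text \<open>Used at two values of \<open>z\<close>: \<open>z = 1\<close> gives the running reward,
  \<open>z = 0\<close> the pure entropy term.\<close>

lemma integral_gibbs_affine:
  "(LINT w:{0..a}|lborel. (w * z - lam * ln (G w y)) * G w y) = \<Phi> y + (z - y) * m y"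
proof -
  have eq: "(w * z - lam * ln (G w y)) * G w y = (z - y) * (w * G w y) + \<Phi> y * G w y" for w
    unfolding ln_Gibbs by (simp add: algebra_simps)
  show ?thesis unfolding eq
    by (subst set_integral_add; (intro set_integrable_mult_right set_integrable_Gibbs Gibbs_density continuous_intros)?)
       (simp add: integral_Gibbs gibbs_mean_def)
qed

lemma integral_gibbs_reward:
  "(LINT w:{0..a}|lborel. (w - lam * ln (G w y)) * G w y) = gibbs_reward lam a y"
  using integral_gibbs_affine[of 1 y] by (simp add: gibbs_reward_def)

text \<open>The density with parameter \<open>y\<close> is a competitor in the variational
  inequality at \<open>z\<close>. Hence \<open>m y\<close> is a subgradient of \<open>\<Phi>\<close>
  at \<open>y\<close>, which is the convexity behind policy improvement.\<close>

lemma log_partition_convex: "\<Phi> y + m y * (z - y) \<le> \<Phi> z"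
proof -
  have "gibbs_reward lam a y \<le> \<Phi> z + (1 - z) * m y"
    using gibbs_variational[OF Gibbs_density(1) Gibbs_density(2) integral_Gibbs set_integrable_gibbs_reward, of y z]
    unfolding integral_gibbs_reward gibbs_mean_def .
  then show ?thesis by (simp add: gibbs_reward_def algebra_simps)
qed

lemma log_partition_lipschitz: "\<bar>\<Phi> y - \<Phi> z\<bar> \<le> a * \<bar>y - z\<bar>"
proof -
  have "\<bar>m y * (y - z)\<bar> \<le> a * \<bar>y - z\<bar>" "\<bar>m z * (y - z)\<bar> \<le> a * \<bar>y - z\<bar>"
    using gibbs_mean_bounds by (auto simp: abs_mult intro!: mult_right_mono)
  moreover have "\<Phi> y - \<Phi> z \<le> m y * (y - z)" "m z * (y - z) \<le> \<Phi> y - \<Phi> z"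
    using log_partition_convex[of y z] log_partition_convex[of z y] by (auto simp: algebra_simps)
  ultimately show ?thesis by linarith
qed

lemma log_partition_0: "\<Phi> 0 = lam * ln a"
  by (simp add: log_partition_def partition_fn_def)

lemma Gibbs_exponent_bound:
  assumes "w \<in> {0..a}" "\<bar>y\<bar> \<le> K"
  shows "\<bar>(w * y - \<Phi> y) / lam\<bar> \<le> (2 * a * K + lam * \<bar>ln a\<bar>) / lam"
proof -
  have "\<bar>\<Phi> y\<bar> \<le> a * \<bar>y\<bar> + lam * \<bar>ln a\<bar>"
    using log_partition_lipschitz[of y 0] log_partition_0 lam_pos abs_triangle_ineq2[of "\<Phi> y" "\<Phi> 0"]
    by (simp add: abs_mult)
  moreover have "\<bar>w * y\<bar> \<le> a * \<bar>y\<bar>" using assms by (auto simp: abs_mult intro!: mult_right_mono)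
  moreover have "a * \<bar>y\<bar> \<le> a * K" using assms a_pos by simp
  ultimately have "\<bar>w * y - \<Phi> y\<bar> \<le> 2 * a * K + lam * \<bar>ln a\<bar>" by linarith
  then show ?thesis using lam_pos by (simp add: divide_right_mono)
qed

lemma Gibbs_bounds:
  fixes K :: real
  obtains l u where "0 < l" "l \<le> u" "\<And>w y. w \<in> {0..a} \<Longrightarrow> \<bar>y\<bar> \<le> K \<Longrightarrow> l \<le> G w y \<and> G w y \<le> u"
proof
  let ?E = "\<bar>(2 * a * K + lam * \<bar>ln a\<bar>) / lam\<bar>"
  show "0 < exp (- ?E)" "exp (- ?E) \<le> exp ?E" by auto
  show "exp (- ?E) \<le> G w y \<and> G w y \<le> exp ?E" if "w \<in> {0..a}" "\<bar>y\<bar> \<le> K" for w y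
    using Gibbs_exponent_bound[OF that] unfolding Gibbs_eq_exp exp_le_cancel_iff by linarith
qed

lemma Gibbs_locally_lipschitz:
  fixes K :: real
  obtains L where "L \<ge> 0"
    "\<And>w y z. w \<in> {0..a} \<Longrightarrow> \<bar>y\<bar> \<le> K \<Longrightarrow> \<bar>z\<bar> \<le> K \<Longrightarrow> \<bar>G w y - G w z\<bar> \<le> L * \<bar>y - z\<bar>"
proof
  let ?E = "(2 * a * K + lam * \<bar>ln a\<bar>) / lam"
  let ?L = "exp ?E * (2 * a / lam)"
  show "?L \<ge> 0" using a_pos lam_pos by auto
  show "\<bar>G w y - G w z\<bar> \<le> ?L * \<bar>y - z\<bar>" if "w \<in> {0..a}" "\<bar>y\<bar> \<le> K" "\<bar>z\<bar> \<le> K" for w y z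
  proof -
    have "\<bar>G w y - G w z\<bar> \<le> exp ?E * \<bar>(w * y - \<Phi> y) / lam - (w * z - \<Phi> z) / lam\<bar>"
      unfolding Gibbs_eq_exp
      using Gibbs_exponent_bound[OF that(1,2)] Gibbs_exponent_bound[OF that(1,3)]
      by (intro exp_diff_le) linarith+
    also have "\<bar>(w * y - \<Phi> y) / lam - (w * z - \<Phi> z) / lam\<bar> \<le> 2 * a / lam * \<bar>y - z\<bar>"
    proof -
      have "\<bar>w * (y - z)\<bar> \<le> a * \<bar>y - z\<bar>" using that by (auto simp: abs_mult intro!: mult_right_mono)
      then have "\<bar>(w * y - \<Phi> y) - (w * z - \<Phi> z)\<bar> \<le> 2 * a * \<bar>y - z\<bar>"
        using log_partition_lipschitz[of y z] by (simp add: algebra_simps)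
      then have "\<bar>(w * y - \<Phi> y) - (w * z - \<Phi> z)\<bar> / lam \<le> 2 * a * \<bar>y - z\<bar> / lam"
        using lam_pos by (intro divide_right_mono) auto
      then show ?thesis using lam_pos by (simp add: diff_divide_distrib[symmetric] abs_divide)
    qed
    finally show ?thesis by (simp add: mult_left_mono mult.assoc)
  qed
qed

lemma gibbs_mean_locally_lipschitz:
  fixes K :: real
  obtains L where "L \<ge> 0"
    "\<And>y z. \<bar>y\<bar> \<le> K \<Longrightarrow> \<bar>z\<bar> \<le> K \<Longrightarrow> \<bar>m y - m z\<bar> \<le> L * \<bar>y - z\<bar>"
proof -
  obtain L where L: "L \<ge> 0"
    "\<And>w y z. w \<in> {0..a} \<Longrightarrow> \<bar>y\<bar> \<le> K \<Longrightarrow> \<bar>z\<bar> \<le> K \<Longrightarrow> \<bar>G w y - G w z\<bar> \<le> L * \<bar>y - z\<bar>"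
    using Gibbs_locally_lipschitz by blast
  have *: "m y - m z \<le> a * a * L * \<bar>y - z\<bar>" if "\<bar>y\<bar> \<le> K" "\<bar>z\<bar> \<le> K" for y z
  proof -
    have "m y - m z = (LINT w:{0..a}|lborel. w * G w y - w * G w z)"
      unfolding gibbs_mean_def
      by (subst set_integral_diff) (auto intro!: set_integrable_Gibbs continuous_intros)
    also have "\<dots> \<le> (LINT w:{0..a}|lborel. a * (L * \<bar>y - z\<bar>))"
    proof (rule set_integral_mono)
      show "w * G w y - w * G w z \<le> a * (L * \<bar>y - z\<bar>)" if w: "w \<in> {0..a}" for w
      proof -
        have "w * (G w y - G w z) \<le> w * (L * \<bar>y - z\<bar>)"
          using L(2)[OF w \<open>\<bar>y\<bar> \<le> K\<close> \<open>\<bar>z\<bar> \<le> K\<close>] w by (intro mult_left_mono) auto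
        also have "\<dots> \<le> a * (L * \<bar>y - z\<bar>)" using w L(1) by (intro mult_right_mono) auto
        finally show ?thesis by (simp add: algebra_simps)
      qed
      show "set_integrable lborel {0..a} (\<lambda>w. w * G w y - w * G w z)"
        by (intro set_integral_diff set_integrable_Gibbs continuous_intros)
    qed (auto intro!: set_integrable_continuous)
    also have "\<dots> = a * a * L * \<bar>y - z\<bar>" using a_pos by (simp add: set_lebesgue_integral_def)
    finally show ?thesis .
  qed
  show thesis
  proof (rule that[of "a * a * L"])
    show "\<bar>m y - m z\<bar> \<le> a * a * L * \<bar>y - z\<bar>" if "\<bar>y\<bar> \<le> K" "\<bar>z\<bar> \<le> K" for y z
      using *[OF that] *[OF that(2,1)] by (auto simp: abs_le_iff abs_minus_commute)
  qed (use L a_pos in auto)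
qed

text \<open>The density is monotone in \<open>w\<close>: its maximum sits at \<open>w = a\<close>
  for \<open>y > 0\<close> and at \<open>w = 0\<close> for \<open>y < 0\<close>. Both equal
  \<open>t / (1 - exp (- t)) / a\<close> with \<open>t = a * \<bar>y\<bar> / lam\<close>, and
  \<open>t / (1 - exp (- t)) \<le> 1 + t\<close>.\<close>

lemma Gibbs_le: "w \<in> {0..a} \<Longrightarrow> G w y \<le> 1 / a + \<bar>y\<bar> / lam"
proof -
  assume w: "w \<in> {0..a}"
  have t: "t / (1 - exp (- t)) \<le> 1 + t" if "t > 0" for t :: real
  proof -
    have "exp (- t) \<le> 1 / (1 + t)"
      using exp_ge_add_one_self[of t] that by (simp add: exp_minus field_simps)
    moreover have "1 - exp (- t) > 0" using that by simp
    ultimately show ?thesis using that by (simp add: field_simps)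
  qed
  consider "y = 0" | "y > 0" | "y < 0" by linarith
  then show ?thesis
  proof cases
    case 2
    let ?t = "a * y / lam"
    have tpos: "?t > 0" using 2 a_pos lam_pos by simp
    have "G w y \<le> y * exp ?t / (lam * (exp ?t - 1))"
      using 2 w lam_pos tpos unfolding Gibbs_def
      by (auto intro!: divide_right_mono mult_left_mono simp: divide_right_mono)
    also have "\<dots> = y / lam / (1 - exp (- ?t))"
      using 2 lam_pos tpos by (simp add: exp_minus field_simps)
    also have "\<dots> = ?t / (1 - exp (- ?t)) / a" using a_pos by simp
    also have "\<dots> \<le> (1 + ?t) / a" using t[OF tpos] a_pos by (intro divide_right_mono) auto
    finally show ?thesis using 2 a_pos by (simp add: field_simps)
  next
    case 3
    let ?t = "- (a * y / lam)"
    have tpos: "?t > 0" using 3 a_pos lam_pos by (simp add: mult_pos_neg divide_neg_pos)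
    have e: "exp (w * y / lam) \<le> 1" using 3 w lam_pos by (simp add: mult_nonneg_nonpos divide_nonpos_pos)
    have "G w y = - (y * exp (w * y / lam)) / - (lam * (exp (a * y / lam) - 1))"
      using 3 unfolding minus_divide_divide by (simp add: Gibbs_def)
    also have "\<dots> = (- y) * exp (w * y / lam) / (lam * (1 - exp (- ?t)))"
      by (simp add: algebra_simps)
    also have "\<dots> \<le> (- y) * 1 / (lam * (1 - exp (- ?t)))"
      using 3 e lam_pos tpos by (intro divide_right_mono mult_left_mono) auto
    also have "\<dots> = ?t / (1 - exp (- ?t)) / a" using a_pos lam_pos by simp
    also have "\<dots> \<le> (1 + ?t) / a" using t[OF tpos] a_pos by (intro divide_right_mono) auto
    finally show ?thesis using 3 a_pos by (simp add: field_simps)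
  qed (use a_pos in \<open>simp add: Gibbs_def\<close>)
qed

text \<open>A density bounded by \<open>u\<close> has entropy at least \<open>- ln u\<close>; with
  the linear bound \<open>Gibbs_le\<close> this is the source of the logarithmic growth.\<close>

lemma entropy_lower_bound: "\<Phi> y - y * m y \<ge> - lam * ln (1 / a + \<bar>y\<bar> / lam)"
proof -
  let ?q = "- lam * ln (1 / a + \<bar>y\<bar> / lam)"
  have "?q = (LINT w:{0..a}|lborel. ?q * G w y)"
    by (simp only: set_integral_mult_right integral_Gibbs mult_1_right)
  also have "\<dots> \<le> (LINT w:{0..a}|lborel. (w * 0 - lam * ln (G w y)) * G w y)"
  proof (rule set_integral_mono)
    show "set_integrable lborel {0..a} (\<lambda>w. ?q * G w y)"
      by (intro set_integrable_mult_right Gibbs_density)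
    show "set_integrable lborel {0..a} (\<lambda>w. (w * 0 - lam * ln (G w y)) * G w y)"
      unfolding ln_Gibbs by (intro set_integrable_Gibbs continuous_intros)
    show "?q * G w y \<le> (w * 0 - lam * ln (G w y)) * G w y" if "w \<in> {0..a}" for w
    proof -
      have "ln (G w y) \<le> ln (1 / a + \<bar>y\<bar> / lam)"
        using Gibbs_le[OF that, of y] Gibbs_pos[of w y] by (simp add: less_le_trans)
      then have "?q \<le> w * 0 - lam * ln (G w y)" using lam_pos by simp
      then show ?thesis using Gibbs_pos[of w y] by (intro mult_right_mono) auto
    qed
  qed
  also have "\<dots> = \<Phi> y - y * m y" by (subst integral_gibbs_affine) simp
  finally show ?thesis .
qed

text \<open>The tangent at \<open>y\<close> evaluated at 0 bounds the entropy part by that of the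
  uniform density, and the mean action is at most \<open>a\<close>. The bound does not involve
  \<open>y\<close>, so it serves all policies at once.\<close>

lemma gibbs_reward_upper: "gibbs_reward lam a y \<le> a + lam * \<bar>ln a\<bar>"
proof -
  have "\<Phi> y - y * m y \<le> lam * ln a"
    using log_partition_convex[of y 0] by (simp add: log_partition_0 algebra_simps)
  moreover have "lam * ln a \<le> lam * \<bar>ln a\<bar>" using lam_pos by simp
  ultimately show ?thesis using gibbs_mean_bounds(2)[of y] unfolding gibbs_reward_def by (simp add: algebra_simps)
qed

lemma gibbs_reward_lower: "gibbs_reward lam a y \<ge> - lam * ln (1 / a + \<bar>y\<bar> / lam)"
  using entropy_lower_bound[of y] gibbs_mean_bounds(1)[of y] unfolding gibbs_reward_def
  by (simp add: algebra_simps)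

end

section \<open>Volterra equations with Lipschitz right-hand side\<close>

lemma at_within_atLeast_eq_Icc: "at x within {0..} = at x within {0..x + 1}" for x :: real
  by (rule at_within_nhd[of _ "{..<x + 1}"]) auto

lemma continuous_on_atLeastI:
  fixes f :: "real \<Rightarrow> 'a::topological_space"
  assumes "\<And>T. T \<ge> 0 \<Longrightarrow> continuous_on {0..T} f"
  shows "continuous_on {0..} f"
  unfolding continuous_on_def
proof
  fix x :: real assume "x \<in> {0..}"
  then show "(f \<longlongrightarrow> f x) (at x within {0..})"
    using assms[of "x + 1"] unfolding at_within_atLeast_eq_Icc by (auto simp: continuous_on_def)
qed

lemma continuous_on_indefinite_integral:
  fixes f :: "real \<Rightarrow> 'a::euclidean_space"
  assumes "continuous_on {0..} f"
  shows "continuous_on {0..} (\<lambda>t. integral {0..t} f)"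
proof (rule continuous_on_atLeastI)
  fix T :: real
  have "f integrable_on {0..T}"
    by (rule integrable_continuous_real) (rule continuous_on_subset[OF assms], auto)
  then show "continuous_on {0..T} (\<lambda>t. integral {0..t} f)"
    by (rule indefinite_integral_continuous_1)
qed

lemma integral_power_Icc: "integral {0..t} (\<lambda>s. s ^ n) = t ^ Suc n / Suc n" if "t \<ge> 0" for t :: real
proof (rule integral_unique)
  have "((\<lambda>s. s ^ n) has_integral t ^ Suc n / Suc n - 0 ^ Suc n / Suc n) {0..t}"
    using that by (intro fundamental_theorem_of_calculus)
      (auto intro!: derivative_eq_intros simp flip: has_real_derivative_iff_has_vector_derivative simp del: power_Suc)
  then show "((\<lambda>s. s ^ n) has_integral t ^ Suc n / Suc n) {0..t}" by simp
qed

text \<open>Each integration gains a factor \<open>L * t / Suc n\<close>. A sequence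
  \<open>u\<close> constant in \<open>n\<close> gives uniqueness of solutions; the successive Picard
  differences give convergence.\<close>

lemma iterated_volterra_bound:
  fixes u :: "nat \<Rightarrow> real \<Rightarrow> real"
  assumes cont: "\<And>n. continuous_on {0..} (u n)"
    and step: "\<And>n t. t \<in> {0..T} \<Longrightarrow> u (Suc n) t \<le> L * integral {0..t} (u n)"
    and init: "\<And>t. t \<in> {0..T} \<Longrightarrow> u 0 t \<le> C" and L: "L \<ge> 0"
  shows "t \<in> {0..T} \<Longrightarrow> u n t \<le> C * (L * t) ^ n / fact n"
proof (induction n arbitrary: t)
  case (Suc n)
  have "integral {0..t} (u n) \<le> integral {0..t} (\<lambda>s. C * L ^ n / fact n * s ^ n)"
  proof (rule integral_le)
    show "u n integrable_on {0..t}"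
      by (intro integrable_continuous_real continuous_on_subset[OF cont]) auto
    show "(\<lambda>s. C * L ^ n / fact n * s ^ n) integrable_on {0..t}"
      by (intro integrable_continuous_real continuous_intros)
    show "u n s \<le> C * L ^ n / fact n * s ^ n" if "s \<in> {0..t}" for s
      using Suc.IH[of s] Suc.prems that by (simp add: power_mult_distrib)
  qed
  also have "\<dots> = C * L ^ n / fact n * (t ^ Suc n / Suc n)"
    using Suc.prems by (simp only: integral_mult_right integral_power_Icc atLeastAtMost_iff)
  finally have "L * integral {0..t} (u n) \<le> L * (C * L ^ n / fact n * (t ^ Suc n / Suc n))"
    using L by (rule mult_left_mono)
  also have "\<dots> = C * (L * t) ^ Suc n / fact (Suc n)"
    by (simp add: power_mult_distrib field_simps)
  finally show ?case using step[OF Suc.prems, of n] by linarith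
qed (use init in auto)

lemma bounded_on_Icc:
  fixes f :: "real \<Rightarrow> 'a::real_normed_vector"
  assumes "continuous_on {0..} f"
  obtains C where "C \<ge> 0" "\<And>t. t \<in> {0..T} \<Longrightarrow> norm (f t) \<le> C"
proof -
  have "compact (f ` {0..T})"
    by (intro compact_continuous_image continuous_on_subset[OF assms]) auto
  then obtain C where "\<forall>x\<in>f ` {0..T}. norm x \<le> C"
    using compact_imp_bounded bounded_iff by blast
  then show thesis using that[of "max C 0"] by (auto simp: le_max_iff_disj)
qed

primrec picard :: "(real \<Rightarrow> 'a \<Rightarrow> 'a) \<Rightarrow> (real \<Rightarrow> 'a) \<Rightarrow> nat \<Rightarrow> real \<Rightarrow> 'a::euclidean_space" where
  "picard F g 0 = g"
| "picard F g (Suc n) = (\<lambda>t. g t + integral {0..t} (\<lambda>s. F s (picard F g n s)))"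

text \<open>Values lie in a Euclidean space because two equations are served: the second-order
  linear equation as a system on \<open>real \<times> real\<close>, and the scalar closed-loop
  state. The inhomogeneity of \<open>picard\<close> is the initial value in the first and the noise
  path in the second.\<close>

locale lipschitz_field =
  fixes F :: "real \<Rightarrow> 'a \<Rightarrow> 'a::euclidean_space" and L :: real
  assumes L_nonneg: "L \<ge> 0"
    and lipschitz: "\<And>s u v. s \<ge> 0 \<Longrightarrow> norm (F s u - F s v) \<le> L * norm (u - v)"
    and cont_comp: "\<And>y. continuous_on {0..} y \<Longrightarrow> continuous_on {0..} (\<lambda>s. F s (y s))"
begin

lemma field_integrable: "continuous_on {0..} y \<Longrightarrow> (\<lambda>s. F s (y s)) integrable_on {0..t}"
  by (intro integrable_continuous_real continuous_on_subset[OF cont_comp]) auto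

lemma integral_field_diff:
  assumes "continuous_on {0..} y" "continuous_on {0..} z" "t \<ge> 0"
  shows "norm (integral {0..t} (\<lambda>s. F s (y s)) - integral {0..t} (\<lambda>s. F s (z s)))
    \<le> L * integral {0..t} (\<lambda>s. norm (y s - z s))"
proof -
  have int: "(\<lambda>s. L * norm (y s - z s)) integrable_on {0..t}"
    by (intro integrable_continuous_real continuous_intros continuous_on_subset[OF assms(1)] continuous_on_subset[OF assms(2)]) auto
  have "norm (integral {0..t} (\<lambda>s. F s (y s) - F s (z s))) \<le> integral {0..t} (\<lambda>s. L * norm (y s - z s))"
    using lipschitz assms by (intro integral_norm_bound_integral int integrable_diff field_integrable) auto
  then show ?thesis using field_integrable assms by (simp add: Henstock_Kurzweil_Integration.integral_diff)
qed

lemma volterra_unique: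
  assumes "continuous_on {0..} y" "continuous_on {0..} z"
    and "\<And>t. t \<ge> 0 \<Longrightarrow> y t = g t + integral {0..t} (\<lambda>s. F s (y s))"
    and "\<And>t. t \<ge> 0 \<Longrightarrow> z t = g t + integral {0..t} (\<lambda>s. F s (z s))"
    and "t \<ge> 0"
  shows "y t = z t"
proof -
  obtain C where C: "\<And>s. s \<in> {0..t} \<Longrightarrow> norm (y s - z s) \<le> C"
    using bounded_on_Icc[OF continuous_on_diff[OF assms(1,2)], of t] by metis
  have bd: "norm (y t - z t) \<le> C * (L * t) ^ n / fact n" for n
  \<comment> \<open>The same difference is used at every index, so it lies below a null
    sequence.\<close>
  proof (rule iterated_volterra_bound[where u = "\<lambda>_ s. norm (y s - z s)" and T = t])
    show "continuous_on {0..} (\<lambda>s. norm (y s - z s))" by (intro continuous_intros assms)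
    show "norm (y s - z s) \<le> L * integral {0..s} (\<lambda>r. norm (y r - z r))" if "s \<in> {0..t}" for s
      using integral_field_diff[OF assms(1,2), of s] assms(3,4)[of s] that by simp
  qed (use C L_nonneg assms in auto)
  have "(\<lambda>n. C * ((L * t) ^ n / fact n)) \<longlonglongrightarrow> C * 0"
    using summable_LIMSEQ_zero[OF summable_exp[of "L * t"]]
    by (intro tendsto_intros) (simp add: divide_inverse mult.commute)
  then have "norm (y t - z t) \<le> 0"
    using bd by (intro LIMSEQ_le_const) auto
  then show ?thesis by simp
qed

lemma picard_continuous: "continuous_on {0..} g \<Longrightarrow> continuous_on {0..} (picard F g n)"
  by (induction n) (auto intro!: continuous_intros continuous_on_indefinite_integral cont_comp)

text \<open>The convergence of the iterates is kept in the conclusion because adaptedness of the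
  closed-loop state is inherited from them.\<close>

lemma picard_limit:
  assumes g: "continuous_on {0..} g"
  obtains y where "continuous_on {0..} y" "\<And>t. t \<ge> 0 \<Longrightarrow> (\<lambda>n. picard F g n t) \<longlonglongrightarrow> y t"
    "\<And>t. t \<ge> 0 \<Longrightarrow> y t = g t + integral {0..t} (\<lambda>s. F s (y s))"
proof
  let ?P = "picard F g"
  let ?d = "\<lambda>n t. ?P (Suc n) t - ?P n t"
  define y where "y = (\<lambda>t. g t + (\<Sum>i. ?d i t))"
  note Pc = picard_continuous[OF g]
  have unif: "uniform_limit {0..T} ?P y sequentially" if "T \<ge> 0" for T
  proof -
    obtain C where C: "C \<ge> 0" "\<And>t. t \<in> {0..T} \<Longrightarrow> norm (?d 0 t) \<le> C"
      using bounded_on_Icc[OF continuous_on_diff[OF Pc[of 1] Pc[of 0]], of T] by auto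
    have bd: "norm (?d n t) \<le> C * (L * t) ^ n / fact n" if t: "t \<in> {0..T}" for n t
    proof (rule iterated_volterra_bound[where u = "\<lambda>n t. norm (?d n t)", OF _ _ _ L_nonneg t])
      show "continuous_on {0..} (\<lambda>t. norm (?d n t))" for n by (intro continuous_intros Pc)
      show "norm (?d (Suc n) t) \<le> L * integral {0..t} (\<lambda>s. norm (?d n s))" if "t \<in> {0..T}" for n t
        using integral_field_diff[OF Pc Pc, of t "Suc n" n] that by simp
    qed (use C in auto)
    have "uniform_limit {0..T} (\<lambda>n t. \<Sum>i<n. ?d i t) (\<lambda>t. \<Sum>i. ?d i t) sequentially"
    proof (rule Weierstrass_m_test)
      show "norm (?d n t) \<le> C * ((L * T) ^ n / fact n)" if "t \<in> {0..T}" for n t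
      proof -
        have "C * ((L * t) ^ n / fact n) \<le> C * ((L * T) ^ n / fact n)"
          using C L_nonneg that by (intro mult_left_mono divide_right_mono power_mono) auto
        then show ?thesis using bd[OF that, of n] by simp
      qed
      show "summable (\<lambda>n. C * ((L * T) ^ n / fact n))"
        using summable_exp[of "L * T"] by (intro summable_mult) (simp add: divide_inverse mult.commute)
    qed
    then have "uniform_limit {0..T} (\<lambda>n t. g t + (\<Sum>i<n. ?d i t)) y sequentially"
      unfolding y_def by (intro uniform_limit_add uniform_limit_const)
    moreover have "(\<lambda>n t. g t + (\<Sum>i<n. ?d i t)) = ?P"
    proof (intro ext)
      show "g t + (\<Sum>i<n. ?d i t) = ?P n t" for n t
        using sum_lessThan_telescope[of "\<lambda>i. ?P i t" n] by (simp del: picard.simps(2))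
    qed
    ultimately show ?thesis by simp
  qed
  show yc: "continuous_on {0..} y"
  proof (rule continuous_on_atLeastI)
    fix T :: real assume "T \<ge> 0"
    then show "continuous_on {0..T} y"
      using unif by (intro uniform_limit_theorem[OF _ unif]) (auto intro!: always_eventually continuous_on_subset[OF Pc])
  qed
  show lim: "(\<lambda>n. ?P n t) \<longlonglongrightarrow> y t" if "t \<ge> 0" for t
    using tendsto_uniform_limitI[OF unif[OF that], of t] that by simp
  show "y t = g t + integral {0..t} (\<lambda>s. F s (y s))" if t: "t \<ge> 0" for t
  proof -
    have "(\<lambda>n. integral {0..t} (\<lambda>s. F s (?P n s))) \<longlonglongrightarrow> integral {0..t} (\<lambda>s. F s (y s))"
    proof (rule LIMSEQ_I)
      fix r :: real assume r: "r > 0"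
      \<comment> \<open>The summand 1 keeps the denominator positive when
        \<open>L * t = 0\<close>.\<close>
      define e where "e = r / (2 * (L * t + 1))"
      have e: "e > 0" "L * (t * e) < r"
      proof -
        have p: "L * t + 1 > 0" using L_nonneg t by (simp add: add_nonneg_pos)
        then show "e > 0" using r by (simp add: e_def)
        have "L * t * r \<le> (L * t + 1) * r" using r by simp
        also have "\<dots> < 2 * (L * t + 1) * r" using p r by simp
        finally show "L * (t * e) < r" unfolding e_def using p by (simp add: field_simps)
      qed
      obtain N where N: "\<And>n s. n \<ge> N \<Longrightarrow> s \<in> {0..t} \<Longrightarrow> dist (?P n s) (y s) < e"
        using uniform_limitD[OF unif[OF t] e(1)] unfolding eventually_sequentially by blast
      show "\<exists>no. \<forall>n\<ge>no. norm (integral {0..t} (\<lambda>s. F s (?P n s)) - integral {0..t} (\<lambda>s. F s (y s))) < r"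
      proof (intro exI allI impI)
        fix n assume n: "n \<ge> N"
        have "integral {0..t} (\<lambda>s. norm (?P n s - y s)) \<le> integral {0..t} (\<lambda>s. e)"
          using N[OF n] by (intro integral_le integrable_continuous_real continuous_intros
              continuous_on_subset[OF Pc] continuous_on_subset[OF yc]) (auto simp: dist_norm less_imp_le)
        then have "L * integral {0..t} (\<lambda>s. norm (?P n s - y s)) \<le> L * (t * e)"
          using L_nonneg t by (intro mult_left_mono) auto
        then show "norm (integral {0..t} (\<lambda>s. F s (?P n s)) - integral {0..t} (\<lambda>s. F s (y s))) < r"
          using integral_field_diff[OF Pc yc t, of n] e by linarith
      qed
    qed
    then have "(\<lambda>n. ?P (Suc n) t) \<longlonglongrightarrow> g t + integral {0..t} (\<lambda>s. F s (y s))"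
      unfolding picard.simps by (intro tendsto_intros)
    then show ?thesis using LIMSEQ_unique LIMSEQ_Suc[OF lim[OF t]] by blast
  qed
qed

end

section \<open>Bounded solutions of linear second-order equations on the half-line\<close>

lemma mvt_half_line:
  assumes "\<And>t. t \<ge> 0 \<Longrightarrow> (f has_real_derivative f' t) (at t within {0..})" "0 \<le> x" "x < y"
  obtains z where "x < z" "z < y" "f y - f x = f' z * (y - x)"
proof -
  have "\<exists>z\<in>{x<..<y}. f y - f x = f' z * (y - x)"
  proof (rule mvt_simple[where f' = "\<lambda>t. (*) (f' t)", OF assms(3)])
    show "(f has_derivative (*) (f' t)) (at t within {x..y})" if "x \<le> t" "t \<le> y" for t
      using assms(1)[of t] assms(2) that unfolding has_field_derivative_def
      by (auto intro: has_derivative_subset)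
  qed
  then show thesis using that by auto
qed

lemma DERIV_from_half_line:
  "(f has_real_derivative D) (at t within {0..}) \<Longrightarrow> t > 0 \<Longrightarrow> DERIV f t :> D" for t :: real
  using at_within_interior[of t "{0..}"] by simp

text \<open>If the second derivative were positive at the maximum, the first derivative would be
  positive just to the right of it and the function would rise above its maximum. Continuity of
  \<open>v2\<close> does not enter, since only the derivative of \<open>v1\<close> at the point is
  read.\<close>

lemma interior_max_second_derivative:
  assumes v: "\<And>t. t \<ge> 0 \<Longrightarrow> (v has_real_derivative v1 t) (at t within {0..})"
    and v1: "\<And>t. t \<ge> 0 \<Longrightarrow> (v1 has_real_derivative v2 t) (at t within {0..})"
    and \<xi>: "0 < \<xi>" "\<xi> < b" and max: "\<And>t. t \<in> {0..b} \<Longrightarrow> v t \<le> v \<xi>"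
  shows "v1 \<xi> = 0" "v2 \<xi> \<le> 0"
proof -
  show z: "v1 \<xi> = 0"
  proof (rule DERIV_local_max)
    show "DERIV v \<xi> :> v1 \<xi>" using DERIV_from_half_line[OF v \<xi>(1)] \<xi> by simp
    show "0 < min \<xi> (b - \<xi>)" using \<xi> by simp
    show "\<forall>y. \<bar>\<xi> - y\<bar> < min \<xi> (b - \<xi>) \<longrightarrow> v y \<le> v \<xi>"
      using max by (auto simp: abs_less_iff)
  qed
  show "v2 \<xi> \<le> 0"
  proof (rule ccontr)
    assume "\<not> v2 \<xi> \<le> 0"
    then obtain d where d: "d > 0" "\<And>h. 0 < h \<Longrightarrow> h < d \<Longrightarrow> v1 \<xi> < v1 (\<xi> + h)"
      using has_real_derivative_pos_inc_right[OF v1, of \<xi>] \<xi> by auto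
    define y where "y = \<xi> + min (d / 2) (b - \<xi>)"
    have y: "\<xi> < y" "y \<le> b" "y < \<xi> + d" using d \<xi> by (auto simp: y_def)
    obtain t where t: "\<xi> < t" "t < y" "v y - v \<xi> = v1 t * (y - \<xi>)"
      using mvt_half_line[OF v, of \<xi> y] \<xi> y by auto
    have "v1 t > 0" using d(2)[of "t - \<xi>"] t y z by simp
    then have "v y > v \<xi>" using t by (metis diff_gt_0_iff_gt less_trans mult_pos_pos)
    then show False using max[of y] y \<xi> by simp
  qed
qed

text \<open>On a short window the mean value theorem produces a point with slope at most
  \<open>2 * N / \<delta>\<close>. From there \<open>v1\<close> changes by at most
  \<open>(A * ?S + E) * \<delta>\<close>, with \<open>?S\<close> its maximum on the window; for
  small \<open>\<delta>\<close> the term in \<open>?S\<close> is absorbed on the left.\<close>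

lemma gradient_bound:
  assumes v: "\<And>t. t \<ge> 0 \<Longrightarrow> (v has_real_derivative v1 t) (at t within {0..})"
    and v1: "\<And>t. t \<ge> 0 \<Longrightarrow> (v1 has_real_derivative v2 t) (at t within {0..})"
    and N: "\<And>t. t \<ge> 0 \<Longrightarrow> \<bar>v t\<bar> \<le> N"
    and v2: "\<And>t. t \<ge> 0 \<Longrightarrow> \<bar>v2 t\<bar> \<le> A * \<bar>v1 t\<bar> + E" and A: "A > 0" and x: "x \<ge> 0"
  shows "\<bar>v1 x\<bar> \<le> 8 * A * N + E / A"
proof -
  \<comment> \<open>This length makes \<open>A * \<delta> = 1/2\<close>, so exactly half of the
    maximal slope is absorbed; it produces the constants \<open>8 * A * N\<close> and
    \<open>E / A\<close>.\<close>
  define \<delta> where "\<delta> = 1 / (2 * A)"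
  have \<delta>: "\<delta> > 0" "A * \<delta> = 1/2" using A by (auto simp: \<delta>_def)
  have cont: "continuous_on {x..x+\<delta>} (\<lambda>t. \<bar>v1 t\<bar>)"
    using x by (intro continuous_intros continuous_on_subset[OF DERIV_continuous_on[of "{0..}"]]) (auto intro: v1)
  obtain y where y: "y \<in> {x..x+\<delta>}" "\<And>t. t \<in> {x..x+\<delta>} \<Longrightarrow> \<bar>v1 t\<bar> \<le> \<bar>v1 y\<bar>"
    using continuous_attains_sup[OF _ _ cont] \<delta> by (auto simp: less_imp_le)
  let ?S = "\<bar>v1 y\<bar>"
  obtain z where z: "x < z" "z < x + \<delta>" "v (x + \<delta>) - v x = v1 z * (x + \<delta> - x)"
    using mvt_half_line[OF v x, of "x + \<delta>"] \<delta> by auto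
  have "\<bar>v1 z\<bar> * \<delta> = \<bar>v (x + \<delta>) - v x\<bar>" using z \<delta> by (simp add: abs_mult)
  also have "\<dots> \<le> 2 * N" using N[of x] N[of "x + \<delta>"] x \<delta> by linarith
  finally have z1: "\<bar>v1 z\<bar> \<le> 4 * A * N"
    using A unfolding \<delta>_def by (simp add: field_simps)
  have "\<bar>v1 y - v1 z\<bar> \<le> (A * ?S + E) * \<delta>"
  proof -
    have *: "\<bar>v1 q - v1 p\<bar> \<le> (A * ?S + E) * \<delta>" if pq: "p < q" "p \<in> {x..x+\<delta>}" "q \<in> {x..x+\<delta>}" for p q
    proof -
      obtain t where t: "p < t" "t < q" "v1 q - v1 p = v2 t * (q - p)"
        using mvt_half_line[OF v1, of p q] x pq by auto
      have "\<bar>v2 t\<bar> \<le> A * ?S + E"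
        using v2[of t] y(2)[of t] t pq x A by (smt (verit) atLeastAtMost_iff mult_left_mono)
      then have "\<bar>v2 t\<bar> * \<bar>q - p\<bar> \<le> (A * ?S + E) * \<delta>"
        using pq by (intro mult_mono) auto
      then show ?thesis using t by (simp add: abs_mult)
    qed
    have zz: "z \<in> {x..x+\<delta>}" using z by simp
    have nn: "0 \<le> (A * ?S + E) * \<delta>"
      using v2[of y] y x \<delta> by (intro mult_nonneg_nonneg) auto
    consider "z < y" | "y < z" | "y = z" by linarith
    then show ?thesis using *[of z y] *[of y z] y(1) zz nn by cases (auto simp: abs_minus_commute)
  qed
  also have "\<dots> = 1/2 * ?S + 1/2 * (E / A)" using A by (simp add: \<delta>_def field_simps)
  finally have "?S \<le> 8 * (A * N) + E / A" using z1 unfolding mult.assoc by linarith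
  then have "?S \<le> 8 * A * N + E / A" by simp
  moreover have "\<bar>v1 x\<bar> \<le> ?S" using y(2)[of x] \<delta> by simp
  ultimately show ?thesis by linarith
qed

text \<open>Applied to the difference of two iterates: small values and bounded second derivatives
  force small first derivatives, after a suitable choice of \<open>d\<close>.\<close>

lemma derivative_interpolation:
  assumes v: "\<And>t. t \<ge> 0 \<Longrightarrow> (v has_real_derivative v1 t) (at t within {0..})"
    and v1: "\<And>t. t \<ge> 0 \<Longrightarrow> (v1 has_real_derivative v2 t) (at t within {0..})"
    and v2: "\<And>t. t \<ge> 0 \<Longrightarrow> \<bar>v2 t\<bar> \<le> A" and x: "x \<ge> 0" and d: "d > 0"
  shows "\<bar>v1 x\<bar> \<le> \<bar>v (x + d) - v x\<bar> / d + A * d"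
proof -
  obtain z where z: "x < z" "z < x + d" "v (x + d) - v x = v1 z * (x + d - x)"
    using mvt_half_line[OF v x, of "x + d"] d by auto
  obtain t where t: "x < t" "t < z" "v1 z - v1 x = v2 t * (z - x)"
    using mvt_half_line[OF v1 x, of z] z by auto
  have "\<bar>v2 t\<bar> * \<bar>z - x\<bar> \<le> A * d" using v2[of t] t z x by (intro mult_mono) auto
  then have "\<bar>v1 z - v1 x\<bar> \<le> A * d" using t by (simp add: abs_mult)
  moreover have "\<bar>v1 z\<bar> = \<bar>v (x + d) - v x\<bar> / d" using z d by (simp add: abs_mult)
  ultimately show ?thesis by linarith
qed

section \<open>Linear boundary value problem on the half-line\<close>

locale linear_ode =
  fixes k c :: real and B :: "real \<Rightarrow> real" and \<beta> :: real
  assumes k: "k > 0" and c: "c > 0" and B_cont: "continuous_on {0..} B"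
    and B_bound: "\<And>x. x \<ge> 0 \<Longrightarrow> \<bar>B x\<bar> \<le> \<beta>"
begin

text \<open>With \<open>k = 2 / \<sigma>\<^sup>2\<close> this is the policy equation
  \<open>\<sigma>\<^sup>2 / 2 * v'' + B * v' - c * v + h = 0\<close>, solved for the second
  derivative.\<close>

definition solves :: "(real \<Rightarrow> real) \<Rightarrow> (real \<Rightarrow> real) \<Rightarrow> (real \<Rightarrow> real) \<Rightarrow> bool" where
  "solves h v v1 \<longleftrightarrow> (\<forall>x\<ge>0. (v has_real_derivative v1 x) (at x within {0..}) \<and>
     (v1 has_real_derivative k * (c * v x - h x - B x * v1 x)) (at x within {0..}))"

lemma solvesD:
  assumes "solves h v v1" "x \<ge> 0"
  shows "(v has_real_derivative v1 x) (at x within {0..})"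
    "(v1 has_real_derivative k * (c * v x - h x - B x * v1 x)) (at x within {0..})"
  using assms by (auto simp: solves_def)

lemma ivp_solution:
  assumes h: "continuous_on {0..} h"
  obtains v v1 where "solves h v v1" "v 0 = 0" "v1 0 = s"
proof -
  let ?F = "\<lambda>x p. (snd p, k * (c * fst p - h x - B x * snd p))"
  interpret lipschitz_field ?F "1 + k * c + k * \<beta>"
  proof
    have "\<beta> \<ge> 0" using B_bound[of 0] by linarith
    then show "0 \<le> 1 + k * c + k * \<beta>" using k c by (intro add_nonneg_nonneg mult_nonneg_nonneg) auto
    show "norm (?F x p - ?F x q) \<le> (1 + k * c + k * \<beta>) * norm (p - q)" if "x \<ge> 0" for x and p q :: "real \<times> real"
    proof -
      have 1: "\<bar>fst p - fst q\<bar> \<le> norm (p - q)" "\<bar>snd p - snd q\<bar> \<le> norm (p - q)"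
        using norm_fst_le[of "fst (p - q)" "snd (p - q)"] norm_snd_le[of "snd (p - q)" "fst (p - q)"]
        unfolding prod.collapse by simp_all
      have "norm (?F x p - ?F x q) \<le> \<bar>snd p - snd q\<bar> + \<bar>k * (c * (fst p - fst q) - B x * (snd p - snd q))\<bar>"
        by (rule order_trans[OF norm_Pair_le[of "fst (?F x p - ?F x q)" "snd (?F x p - ?F x q)", unfolded prod.collapse]])
           (simp add: algebra_simps)
      also have "\<bar>k * (c * (fst p - fst q) - B x * (snd p - snd q))\<bar> \<le> k * (c * norm (p - q) + \<beta> * norm (p - q))"
      proof -
        have "\<bar>c * (fst p - fst q)\<bar> \<le> c * norm (p - q)" "\<bar>B x * (snd p - snd q)\<bar> \<le> \<beta> * norm (p - q)"
          using 1 c B_bound[OF that] by (auto simp: abs_mult intro!: mult_mono)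
        then have "\<bar>c * (fst p - fst q) - B x * (snd p - snd q)\<bar> \<le> c * norm (p - q) + \<beta> * norm (p - q)"
          by linarith
        then show ?thesis using k by (simp add: abs_mult)
      qed
      finally show ?thesis using 1 by (simp add: algebra_simps)
    qed
    show "continuous_on {0..} (\<lambda>x. ?F x (y x))" if "continuous_on {0..} y" for y
      by (intro continuous_intros that h B_cont)
  qed
  obtain y where y: "continuous_on {0..} y"
    "\<And>t. t \<ge> 0 \<Longrightarrow> y t = (0, s) + integral {0..t} (\<lambda>x. ?F x (y x))"
    by (rule picard_limit[OF continuous_on_const[of "{0..}" "(0, s)"]]) (rule that)
  have der: "(y has_vector_derivative ?F x (y x)) (at x within {0..})" if "x \<ge> 0" for x
  proof -
    have "((\<lambda>t. (0, s) + integral {0..t} (\<lambda>x. ?F x (y x))) has_vector_derivative 0 + ?F x (y x)) (at x within {0..x+1})"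
      using that by (intro has_vector_derivative_add has_vector_derivative_const integral_has_vector_derivative
          continuous_on_subset[OF cont_comp[OF y(1)]]) auto
    then have "((\<lambda>t. (0, s) + integral {0..t} (\<lambda>x. ?F x (y x))) has_vector_derivative ?F x (y x)) (at x within {0..})"
      unfolding at_within_atLeast_eq_Icc[of x] by simp
    then show ?thesis
      by (rule has_vector_derivative_transform[rotated 2]) (use that y in auto)
  qed
  show thesis
  proof
    show "solves h (\<lambda>x. fst (y x)) (\<lambda>x. snd (y x))"
      unfolding solves_def has_real_derivative_iff_has_vector_derivative
      using bounded_linear.has_vector_derivative[OF bounded_linear_fst der]
        bounded_linear.has_vector_derivative[OF bounded_linear_snd der] by auto
  qed (use y(2)[of 0] in auto)
qed

text \<open>Maximum principle. Rising above \<open>M2\<close> before falling below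
  \<open>- M1\<close> forces an interior maximum above \<open>M2\<close>; there the slope is 0 and
  the second derivative nonpositive, so the equation gives
  \<open>c * v \<le> h \<le> c * M2\<close>, a contradiction.\<close>

lemma not_exceed_both:
  assumes "solves h v v1" "v 0 = 0" "M1 \<ge> 0" "M2 \<ge> 0"
    and "\<And>x. x \<ge> 0 \<Longrightarrow> h x \<le> c * M2" "0 \<le> x1" "x1 < x2" "v x1 > M2" "v x2 < - M1"
  shows False
proof -
  have cont: "continuous_on {0..x2} v"
    using assms(6,7) by (intro continuous_on_subset[OF DERIV_continuous_on[of "{0..}"]]) (auto intro: solvesD[OF assms(1)])
  obtain y where y: "y \<in> {0..x2}" "\<And>t. t \<in> {0..x2} \<Longrightarrow> v t \<le> v y"
    using continuous_attains_sup[OF _ _ cont] assms by auto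
  have big: "v y > M2" using y(2)[of x1] assms by auto
  then have "y \<noteq> 0" "y \<noteq> x2" using assms by auto
  with y(1) have yy: "0 < y" "y < x2" by auto
  have "v1 y = 0" "k * (c * v y - h y - B y * v1 y) \<le> 0"
    using interior_max_second_derivative[OF solvesD(1)[OF assms(1)] solvesD(2)[OF assms(1)] yy y(2)] by auto
  then have "c * v y \<le> h y" using k by (simp add: mult_le_0_iff)
  also have "\<dots> \<le> c * M2" using assms yy by auto
  finally show False using big c by simp
qed

lemma solves_uminus: "solves h v v1 \<Longrightarrow> solves (\<lambda>x. - h x) (\<lambda>x. - v x) (\<lambda>x. - v1 x)"
  unfolding solves_def
proof (intro allI impI conjI)
  fix x :: real
  assume H: "\<forall>x\<ge>0. (v has_real_derivative v1 x) (at x within {0..}) \<and>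
     (v1 has_real_derivative k * (c * v x - h x - B x * v1 x)) (at x within {0..})" "x \<ge> 0"
  show "((\<lambda>x. - v x) has_real_derivative - v1 x) (at x within {0..})"
    using H by (intro DERIV_minus) auto
  have "((\<lambda>x. - v1 x) has_real_derivative - (k * (c * v x - h x - B x * v1 x))) (at x within {0..})"
    using H by (intro DERIV_minus) auto
  then show "((\<lambda>x. - v1 x) has_real_derivative k * (c * - v x - - h x - B x * - v1 x)) (at x within {0..})"
    by (simp add: algebra_simps)
qed

text \<open>Shooting: the initial slopes whose solution leaves the strip through the top and through the
  bottom form two disjoint nonempty open sets, which cannot exhaust the real line.\<close>

lemma bounded_solution:
  assumes h: "continuous_on {0..} h" and M: "M1 \<ge> 0" "M2 \<ge> 0"
    and hM: "\<And>x. x \<ge> 0 \<Longrightarrow> - c * M1 \<le> h x" "\<And>x. x \<ge> 0 \<Longrightarrow> h x \<le> c * M2"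
  obtains v v1 where "solves h v v1" "v 0 = 0" "\<And>x. x \<ge> 0 \<Longrightarrow> - M1 \<le> v x" "\<And>x. x \<ge> 0 \<Longrightarrow> v x \<le> M2"
proof -
  obtain p p1 where p: "solves h p p1" "p 0 = 0" using ivp_solution[OF h, of 0] by metis
  obtain q q1 where q: "solves (\<lambda>_. 0) q q1" "q 0 = 0" "q1 0 = 1"
    using ivp_solution[OF continuous_on_const, of 0 1] by metis
  \<comment> \<open>Linearity of the equation: a particular solution plus a multiple of the
    homogeneous solution of slope 1, so that \<open>s\<close> shifts the initial slope.\<close>
  let ?v = "\<lambda>s x. p x + s * q x" and ?v1 = "\<lambda>s x. p1 x + s * q1 x"
  have sol: "solves h (?v s) (?v1 s)" for s
    unfolding solves_def
  proof (intro allI impI conjI)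
    fix x :: real assume x: "x \<ge> 0"
    show "(?v s has_real_derivative ?v1 s x) (at x within {0..})"
      by (intro DERIV_add DERIV_cmult solvesD[OF p(1) x] solvesD[OF q(1) x])
    have "(?v1 s has_real_derivative k * (c * p x - h x - B x * p1 x) + s * (k * (c * q x - 0 - B x * q1 x))) (at x within {0..})"
      by (intro DERIV_add DERIV_cmult solvesD[OF p(1) x] solvesD[OF q(1) x])
    then show "(?v1 s has_real_derivative k * (c * ?v s x - h x - B x * ?v1 s x)) (at x within {0..})"
      by (simp add: algebra_simps)
  qed
  define U where "U = {s. \<exists>x\<ge>0. ?v s x > M2}"
  define D where "D = {s. \<exists>x\<ge>0. ?v s x < - M1}"
  \<comment> \<open>For a fixed \<open>x\<close> the value is affine in \<open>s\<close>, so every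
    member of these unions is open.\<close>
  have "U = (\<Union>x\<in>{0..}. {s. ?v s x > M2})" "D = (\<Union>x\<in>{0..}. {s. ?v s x < - M1})"
    by (auto simp: U_def D_def)
  then have op: "open U" "open D"
    by (auto intro!: open_UN open_Collect_less continuous_intros)
  have disj: "U \<inter> D = {}"
  proof (rule ccontr)
    assume "U \<inter> D \<noteq> {}"
    then obtain s x1 x2 where s: "x1 \<ge> 0" "?v s x1 > M2" "x2 \<ge> 0" "?v s x2 < - M1"
      by (auto simp: U_def D_def)
    then have "x1 \<noteq> x2" using M by auto
    then consider "x1 < x2" | "x2 < x1" by linarith
    then show False
    proof cases
      case 1
      then show False using not_exceed_both[OF sol[of s] _ M hM(2)] s p q by auto
    next
      \<comment> \<open>The mirrored solution rises through the top first, which exchanges the roles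
        of the two barriers.\<close>
      case 2
      then show False
        using not_exceed_both[OF solves_uminus[OF sol[of s]] _ M(2,1) _ s(3)] s p q hM(1) by fastforce
    qed
  qed
  \<comment> \<open>Where \<open>q\<close> is positive, the value at \<open>x0\<close> runs through
    all reals as \<open>s\<close> varies, so both exits occur.\<close>
  obtain x0 where x0: "x0 > 0" "q x0 > 0"
  proof -
    obtain d where "d > 0" "\<And>h. 0 < h \<Longrightarrow> h < d \<Longrightarrow> q 0 < q (0 + h)"
      using has_real_derivative_pos_inc_right[OF solvesD(1)[OF q(1), of 0]] q by auto
    then show thesis using that[of "d / 2"] q by auto
  qed
  have "(M2 + 1 - p x0) / q x0 \<in> U" "(- M1 - 1 - p x0) / q x0 \<in> D"
    unfolding U_def D_def using x0 by (auto intro!: exI[of _ x0])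
  then have "U \<union> D \<noteq> UNIV"
    using connectedD[OF connected_UNIV op] disj by auto
  then obtain s where "s \<notin> U" "s \<notin> D" by auto
  then show thesis
    using that[OF sol[of s]] p q by (force simp: U_def D_def not_less)
qed

end

section \<open>Independence of Brownian increments from the augmented filtration\<close>

lemma borel_measurable_in_set_Collect:
  assumes "f \<in> N \<rightarrow>\<^sub>M borel" "B \<in> sets borel" shows "{x\<in>space N. f x \<in> B} \<in> sets N"
proof -
  have "{x\<in>space N. f x \<in> B} = f -` B \<inter> space N" by blast
  then show ?thesis using measurable_sets[OF assms] by simp
qed

locale brownian =
  fixes M :: "'a measure" and W :: "real \<Rightarrow> 'a \<Rightarrow> real"
  assumes BM: "std_brownian M W"

sublocale brownian \<subseteq> prob_space M
  using BM by (simp add: std_brownian_def)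

context brownian
begin

abbreviation "Fil \<equiv> aug_filtration M W"

lemma W_measurable [measurable]: "W t \<in> borel_measurable M"
  using BM by (simp add: std_brownian_def)

lemma W_zero: "\<omega> \<in> space M \<Longrightarrow> W 0 \<omega> = 0"
  and W_continuous: "\<omega> \<in> space M \<Longrightarrow> continuous_on {0..} (\<lambda>t. W t \<omega>)"
  using BM by (auto simp: std_brownian_def)

lemma W_increment_distributed:
  "0 \<le> s \<Longrightarrow> s < t \<Longrightarrow>
    distributed M lborel (\<lambda>\<omega>. W t \<omega> - W s \<omega>) (\<lambda>x. ennreal (normal_density 0 (sqrt (t - s)) x))"
  using BM by (simp add: std_brownian_def)

lemma W_increments_indep:
  "0 \<le> ts 0 \<Longrightarrow> (\<And>i. i < n \<Longrightarrow> ts i < ts (Suc i)) \<Longrightarrow>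
    indep_vars (\<lambda>_. borel) (\<lambda>i \<omega>. W (ts (Suc i)) \<omega> - W (ts i) \<omega>) {..<n}"
  using BM by (simp add: std_brownian_def)

definition fil_gen :: "real \<Rightarrow> 'a set set" where
  "fil_gen t = {W s -` B \<inter> space M | s B. 0 \<le> s \<and> s \<le> t \<and> B \<in> sets borel} \<union> null_sets M"

lemma fil_gen_events: "fil_gen t \<subseteq> events"
  by (auto simp: fil_gen_def)

lemma fil_gen_Pow: "fil_gen t \<subseteq> Pow (space M)"
  using fil_gen_events sets.space_closed by (rule subset_trans)

lemma Fil_eq: "Fil t = sigma (space M) (fil_gen t)"
  unfolding aug_filtration_def fil_gen_def ..

lemma space_Fil [simp]: "space (Fil t) = space M"
  unfolding Fil_eq using fil_gen_Pow by (rule space_measure_of)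

lemma sets_Fil: "sets (Fil t) = sigma_sets (space M) (fil_gen t)"
  unfolding Fil_eq using fil_gen_Pow by (rule sets_measure_of)

lemma sets_Fil_subset: "sets (Fil t) \<subseteq> events"
  unfolding sets_Fil using fil_gen_events by (rule sets.sigma_sets_subset)

lemma sets_Fil_mono: "s \<le> t \<Longrightarrow> sets (Fil s) \<subseteq> sets (Fil t)"
  unfolding sets_Fil
proof (rule sigma_sets_mono')
  assume st: "s \<le> t"
  show "fil_gen s \<subseteq> fil_gen t"
    unfolding fil_gen_def using order_trans[OF _ st] by blast
qed

lemma measurable_Fil: "f \<in> Fil t \<rightarrow>\<^sub>M N \<Longrightarrow> f \<in> M \<rightarrow>\<^sub>M N"
  using subsetD[OF sets_Fil_subset] by (intro measurableI) (metis measurable_space space_Fil, metis measurable_sets space_Fil)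

lemma measurable_Fil_mono: "f \<in> Fil s \<rightarrow>\<^sub>M N \<Longrightarrow> s \<le> t \<Longrightarrow> f \<in> Fil t \<rightarrow>\<^sub>M N"
  using subsetD[OF sets_Fil_mono[of s t]] by (intro measurableI) (metis measurable_space space_Fil, metis measurable_sets space_Fil)

lemma W_adapted: "0 \<le> s \<Longrightarrow> s \<le> t \<Longrightarrow> W s \<in> borel_measurable (Fil t)"
proof (rule measurableI)
  fix A :: "real set" assume "0 \<le> s" "s \<le> t" "A \<in> sets borel"
  then have "W s -` A \<inter> space M \<in> fil_gen t" unfolding fil_gen_def by blast
  then show "W s -` A \<inter> space (Fil t) \<in> sets (Fil t)"
    unfolding sets_Fil space_Fil by (rule sigma_sets.Basic)
qed simp

definition cylinder :: "real set \<Rightarrow> (real \<Rightarrow> real set) \<Rightarrow> 'a set" where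
  "cylinder R B = {\<omega>\<in>space M. \<forall>r\<in>R. W r \<omega> \<in> B r}"

lemma cylinder_event: "finite R \<Longrightarrow> (\<And>r. B r \<in> sets borel) \<Longrightarrow> cylinder R B \<in> events"
  unfolding cylinder_def
  by (rule sets.sets_Collect_finite_All) (rule borel_measurable_in_set_Collect[OF W_measurable])

text \<open>Positions at the times in \<open>R\<close> are partial sums of increments over a finite
  grid ending at \<open>s\<close>. Adding the increment from \<open>s\<close> to \<open>t\<close>
  keeps the family independent, and the cylinder event uses only the earlier members.\<close>

lemma cylinder_indep_increment:
  assumes R: "finite R" "R \<subseteq> {0..s}" and B: "\<And>r. B r \<in> sets borel" and C: "C \<in> sets borel"
    and st: "0 \<le> s" "s < t"
  shows "prob (cylinder R B \<inter> ((\<lambda>\<omega>. W t \<omega> - W s \<omega>) -` C \<inter> space M)) =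
    prob (cylinder R B) * prob ((\<lambda>\<omega>. W t \<omega> - W s \<omega>) -` C \<inter> space M)"
proof -
  \<comment> \<open>Inserting 0 makes positions equal to sums of increments; inserting
    \<open>s\<close> makes the last one start exactly at \<open>s\<close>.\<close>
  define S where "S = sorted_list_of_set (insert 0 (insert s R))"
  define N where "N = length S - 1"
  \<comment> \<open>Index \<open>Suc N\<close> is the time \<open>t\<close>, so increment number
    \<open>N\<close> is the one over \<open>{s..t}\<close> and those below \<open>N\<close> belong
    to the past.\<close>
  define ts where "ts = (\<lambda>i. if i \<le> N then S ! i else t)"
  have setS: "set S = insert 0 (insert s R)" and sortS: "sorted_wrt (<) S"
    using R set_sorted_list_of_set[of "insert 0 (insert s R)"] strict_sorted_list_of_set[of "insert 0 (insert s R)"]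
    unfolding S_def by blast+
  have lenS: "length S = Suc N" using setS by (cases S) (auto simp: N_def)
  have lt: "S ! i < S ! j" if "i < j" "j \<le> N" for i j
    using sorted_wrt_nth_less[OF sortS, of i j] that lenS by simp
  have mem: "S ! i \<in> insert 0 (insert s R)" if "i \<le> N" for i
    using that lenS setS nth_mem[of i S] by auto
  have idx: "\<exists>i\<le>N. S ! i = r" if "r \<in> insert 0 (insert s R)" for r
    using that unfolding setS[symmetric] in_set_conv_nth lenS less_Suc_eq_le by blast
  have range: "0 \<le> S ! i" "S ! i \<le> s" if "i \<le> N" for i
    using mem[OF that] R st by auto
  have S0: "S ! 0 = 0"
  proof -
    obtain i where "i \<le> N" "S ! i = 0" using idx by auto
    then show ?thesis using lt[of 0 i] range[of 0] by (cases "i = 0") auto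
  qed
  have SN: "S ! N = s"
  proof -
    obtain i where "i \<le> N" "S ! i = s" using idx by auto
    then show ?thesis using lt[of i N] range[of N] by (cases "i = N") auto
  qed
  let ?D = "\<lambda>i \<omega>. W (ts (Suc i)) \<omega> - W (ts i) \<omega>"
  have ind: "indep_vars (\<lambda>_. borel) ?D {..<Suc N}"
  proof (rule W_increments_indep)
    show "0 \<le> ts 0" by (simp add: ts_def S0)
    show "ts i < ts (Suc i)" if "i < Suc N" for i
      using that lt[of i "Suc i"] SN st by (cases "i = N") (auto simp: ts_def)
  qed
  have iv: "indep_var (PiM {..<N} (\<lambda>_. borel)) (\<lambda>\<omega>. restrict (\<lambda>i. ?D i \<omega>) {..<N})
     (PiM {N} (\<lambda>_. borel)) (\<lambda>\<omega>. restrict (\<lambda>i. ?D i \<omega>) {N})"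
    by (rule indep_var_restrict[OF ind]) auto
  have "\<forall>r\<in>R. \<exists>i. i \<le> N \<and> S ! i = r" using idx by blast
  from bchoice[OF this] obtain k where k: "\<And>r. r \<in> R \<Longrightarrow> k r \<le> N \<and> S ! (k r) = r"
    by blast
  define U where "U = {f\<in>space (PiM {..<N} (\<lambda>_. borel)). \<forall>r\<in>R. (\<Sum>i<k r. f i) \<in> B r}"
  define V where "V = {f\<in>space (PiM {N} (\<lambda>_. borel)). f N \<in> C}"
  have U: "U \<in> sets (PiM {..<N} (\<lambda>_. borel))"
  proof -
    have "(\<lambda>f. \<Sum>i<k r. f i) \<in> borel_measurable (PiM {..<N} (\<lambda>_. borel :: real measure))" if "r \<in> R" for r
      using k[OF that] by (intro borel_measurable_sum measurable_component_singleton) auto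
    then show ?thesis unfolding U_def using R B
      by (intro sets.sets_Collect_finite_All borel_measurable_in_set_Collect) auto
  qed
  have V: "V \<in> sets (PiM {N} (\<lambda>_. borel))"
    unfolding V_def using C
    by (intro borel_measurable_in_set_Collect measurable_component_singleton) auto
  have tele: "(\<Sum>i<j. ?D i \<omega>) = W (S ! j) \<omega>" if "j \<le> N" "\<omega> \<in> space M" for j \<omega>
    using that by (subst sum_lessThan_telescope) (simp add: ts_def S0 W_zero)
  have pU: "(\<lambda>\<omega>. restrict (\<lambda>i. ?D i \<omega>) {..<N}) -` U \<inter> space M = cylinder R B"
  proof -
    have "(\<Sum>i<k r. restrict (\<lambda>i. ?D i \<omega>) {..<N} i) = W r \<omega>" if "r \<in> R" "\<omega> \<in> space M" for r \<omega>
    proof -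
      have "(\<Sum>i<k r. restrict (\<lambda>i. ?D i \<omega>) {..<N} i) = (\<Sum>i<k r. ?D i \<omega>)"
        using k[OF that(1)] by (intro sum.cong) auto
      then show ?thesis using tele[of "k r" \<omega>] k[OF that(1)] that by simp
    qed
    then show ?thesis by (auto simp: U_def cylinder_def space_PiM)
  qed
  have pV: "(\<lambda>\<omega>. restrict (\<lambda>i. ?D i \<omega>) {N}) -` V \<inter> space M = (\<lambda>\<omega>. W t \<omega> - W s \<omega>) -` C \<inter> space M"
    by (auto simp: V_def space_PiM ts_def SN)
  show ?thesis
  proof -
    have "(\<lambda>\<omega>. (restrict (\<lambda>i. ?D i \<omega>) {..<N}, restrict (\<lambda>i. ?D i \<omega>) {N})) -` (U \<times> V) \<inter> space M =
      ((\<lambda>\<omega>. restrict (\<lambda>i. ?D i \<omega>) {..<N}) -` U \<inter> space M) \<inter> ((\<lambda>\<omega>. restrict (\<lambda>i. ?D i \<omega>) {N}) -` V \<inter> space M)"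
      by blast
    then show ?thesis using indep_varD[OF iv U V] unfolding pU pV by simp
  qed
qed

text \<open>The events that agree almost surely with a cylinder form a \<open>\<pi>\<close>-system that already contains the null sets
  of the augmentation.\<close>

lemma increment_indep_Fil:
  assumes Z: "Z \<in> borel_measurable (Fil s)" and st: "0 \<le> s" "s < t"
  shows "indep_var borel Z borel (\<lambda>\<omega>. W t \<omega> - W s \<omega>)"
proof -
  let ?\<Delta> = "\<lambda>\<omega>. W t \<omega> - W s \<omega>"
  define \<P> where "\<P> = {A\<in>events. \<exists>R B. finite R \<and> R \<subseteq> {0..s} \<and> (\<forall>r. B r \<in> sets borel) \<and>
     (AE \<omega> in M. \<omega> \<in> A \<longleftrightarrow> \<omega> \<in> cylinder R B)}"
  define \<E> where "\<E> = {?\<Delta> -` C \<inter> space M | C. C \<in> sets borel}"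
  have "indep_set \<P> \<E>"
  proof (rule indep_setI)
    show "\<P> \<subseteq> events" by (auto simp: \<P>_def)
    show "\<E> \<subseteq> events" by (auto simp: \<E>_def)
    fix a b assume "a \<in> \<P>" "b \<in> \<E>"
    then obtain R B C where RB: "finite R" "R \<subseteq> {0..s}" "\<And>r. B r \<in> sets borel" "a \<in> events"
      "AE \<omega> in M. \<omega> \<in> a \<longleftrightarrow> \<omega> \<in> cylinder R B" and C: "C \<in> sets borel" "b = ?\<Delta> -` C \<inter> space M"
      by (auto simp: \<P>_def \<E>_def)
    have b: "b \<in> events" using C by auto
    have cyl: "cylinder R B \<in> events" using RB by (intro cylinder_event)
    have "prob (a \<inter> b) = prob (cylinder R B \<inter> b)"
      using RB b cyl by (intro finite_measure_eq_AE) auto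
    moreover have "prob a = prob (cylinder R B)"
      using RB cyl by (intro finite_measure_eq_AE) auto
    ultimately show "prob (a \<inter> b) = prob a * prob b"
      using cylinder_indep_increment[OF RB(1-3) C(1) st] C(2) by simp
  qed
  moreover have "Int_stable \<P>"
  proof (rule Int_stableI)
    fix a b assume "a \<in> \<P>" "b \<in> \<P>"
    then obtain R1 B1 R2 B2 where
      1: "finite R1" "R1 \<subseteq> {0..s}" "\<And>r. B1 r \<in> sets borel" "a \<in> events"
        "AE \<omega> in M. \<omega> \<in> a \<longleftrightarrow> \<omega> \<in> cylinder R1 B1" and
      2: "finite R2" "R2 \<subseteq> {0..s}" "\<And>r. B2 r \<in> sets borel" "b \<in> events"
        "AE \<omega> in M. \<omega> \<in> b \<longleftrightarrow> \<omega> \<in> cylinder R2 B2"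
      by (auto simp: \<P>_def)
    \<comment> \<open>Padding with \<open>UNIV\<close> lets both cylinders be read over the common
      index set \<open>R1 \<union> R2\<close>.\<close>
    let ?B = "\<lambda>r. (if r \<in> R1 then B1 r else UNIV) \<inter> (if r \<in> R2 then B2 r else UNIV)"
    have "cylinder R1 B1 \<inter> cylinder R2 B2 = cylinder (R1 \<union> R2) ?B"
      by (auto simp: cylinder_def)
    moreover have "AE \<omega> in M. \<omega> \<in> a \<inter> b \<longleftrightarrow> \<omega> \<in> cylinder R1 B1 \<inter> cylinder R2 B2"
      using 1(5) 2(5) by eventually_elim auto
    moreover have "?B r \<in> sets borel" for r using 1 2 by auto
    ultimately show "a \<inter> b \<in> \<P>" unfolding \<P>_def using 1 2
      by (auto intro!: exI[of _ "R1 \<union> R2"] exI[of _ ?B])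
  qed
  moreover have "Int_stable \<E>"
  proof (rule Int_stableI)
    fix a b assume "a \<in> \<E>" "b \<in> \<E>"
    then obtain C D where "C \<in> sets borel" "D \<in> sets borel" "a = ?\<Delta> -` C \<inter> space M" "b = ?\<Delta> -` D \<inter> space M"
      by (auto simp: \<E>_def)
    then show "a \<inter> b \<in> \<E>" unfolding \<E>_def by (auto intro!: exI[of _ "C \<inter> D"])
  qed
  ultimately have ind: "indep_set (sigma_sets (space M) \<P>) (sigma_sets (space M) \<E>)"
    by (rule indep_set_sigma_sets)
  have "fil_gen s \<subseteq> \<P>"
  proof
    fix A assume A: "A \<in> fil_gen s"
    show "A \<in> \<P>"
    proof (cases "A \<in> null_sets M")
      case True
      \<comment> \<open>A null set agrees almost surely with the empty cylinder, here one with an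
        empty base over the time 0.\<close>
      have "cylinder {0} (\<lambda>_. {}) = {}" by (simp add: cylinder_def)
      then show ?thesis unfolding \<P>_def using True st AE_not_in[OF True]
        by (auto intro!: exI[of _ "{0::real}"] exI[of _ "\<lambda>_. {}"])
    next
      case False
      with A obtain r B where r: "0 \<le> r" "r \<le> s" "B \<in> sets borel" "A = W r -` B \<inter> space M"
        by (auto simp: fil_gen_def)
      then have "A = cylinder {r} (\<lambda>_. B)" by (auto simp: cylinder_def)
      moreover have "A \<in> events" using r(3,4) by auto
      ultimately show ?thesis unfolding \<P>_def using r(1-3)
        by (intro CollectI conjI exI[of _ "{r}"] exI[of _ "\<lambda>_. B"]) auto
    qed
  qed
  then have sub: "sets (Fil s) \<subseteq> sigma_sets (space M) \<P>"
    unfolding sets_Fil by (rule sigma_sets_mono')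
  have "{Z -` A \<inter> space M |A. A \<in> sets borel} \<subseteq> sets (Fil s)"
    using measurable_sets[OF Z] by auto
  then have "sigma_sets (space M) {Z -` A \<inter> space M |A. A \<in> sets borel} \<subseteq> sets (Fil s)"
    using sets.sigma_sets_subset[of _ "Fil s"] by simp
  with ind sub have "indep_set (sigma_sets (space M) {Z -` A \<inter> space M |A. A \<in> sets borel})
      (sigma_sets (space M) {?\<Delta> -` A \<inter> space M |A. A \<in> sets borel})"
    unfolding indep_sets2_eq \<E>_def by blast
  then show ?thesis
    unfolding indep_var_eq using measurable_Fil[OF Z] by auto
qed

section \<open>Moments of a single Brownian increment\<close>

context
  fixes s t :: real assumes st: "0 \<le> s" "s < t"
begin

lemma increment_integrable_power: "integrable M (\<lambda>\<omega>. (W t \<omega> - W s \<omega>) ^ k)"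
  "integrable M (\<lambda>\<omega>. \<bar>W t \<omega> - W s \<omega>\<bar> ^ k)"
proof -
  have "integrable lborel (\<lambda>x. normal_density 0 (sqrt (t - s)) x * x ^ k)"
    "integrable lborel (\<lambda>x. normal_density 0 (sqrt (t - s)) x * \<bar>x\<bar> ^ k)"
    using integrable_normal_moment[of "sqrt (t - s)" 0 k] integrable_normal_moment_abs[of "sqrt (t - s)" 0 k] st by auto
  then show "integrable M (\<lambda>\<omega>. (W t \<omega> - W s \<omega>) ^ k)" "integrable M (\<lambda>\<omega>. \<bar>W t \<omega> - W s \<omega>\<bar> ^ k)"
    using distributed_integrable[OF W_increment_distributed[OF st], of "\<lambda>x. x ^ k"]
      distributed_integrable[OF W_increment_distributed[OF st], of "\<lambda>x. \<bar>x\<bar> ^ k"] by auto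
qed

lemma increment_expectation:
  assumes g: "g \<in> borel_measurable borel"
  shows "expectation (\<lambda>\<omega>. g (W t \<omega> - W s \<omega>)) = (\<integral>x. normal_density 0 (sqrt (t - s)) x * g x \<partial>lborel)"
  using distributed_integral[OF W_increment_distributed[OF st], of g] g by simp

lemma increment_mean: "expectation (\<lambda>\<omega>. W t \<omega> - W s \<omega>) = 0"
  using increment_expectation[of "\<lambda>x. x"] integral_normal_moment_odd[of "sqrt (t - s)" 0 0] st by simp

lemma increment_square: "expectation (\<lambda>\<omega>. (W t \<omega> - W s \<omega>)\<^sup>2) = t - s"
proof -
  have "expectation (\<lambda>\<omega>. (W t \<omega> - W s \<omega>)\<^sup>2) = (\<integral>x. normal_density 0 (sqrt (t - s)) x * (x - 0) ^ (2 * 1) \<partial>lborel)"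
    using increment_expectation[of "\<lambda>x. x\<^sup>2"] by simp
  also have "\<dots> = t - s"
    using st by (subst integral_normal_moment_even) simp_all
  finally show ?thesis .
qed

lemma sqrt_2_div_pi_le: "sqrt (2 / pi) \<le> 1"
  using pi_ge_two by simp

lemma increment_abs: "expectation (\<lambda>\<omega>. \<bar>W t \<omega> - W s \<omega>\<bar>) \<le> sqrt (t - s)"
proof -
  have "expectation (\<lambda>\<omega>. \<bar>W t \<omega> - W s \<omega>\<bar>) = sqrt (t - s) * sqrt (2 / pi)"
    using increment_expectation[of "\<lambda>x. \<bar>x\<bar>"] integral_normal_moment_abs_odd[of "sqrt (t - s)" 0 0] st by simp
  then show ?thesis using mult_left_mono[OF sqrt_2_div_pi_le, of "sqrt (t - s)"] st by simp
qed

lemma increment_abs_cube: "expectation (\<lambda>\<omega>. \<bar>W t \<omega> - W s \<omega>\<bar> ^ 3) \<le> 2 * sqrt (t - s) ^ 3"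
proof -
  have "expectation (\<lambda>\<omega>. \<bar>W t \<omega> - W s \<omega>\<bar> ^ 3) = 2 * sqrt (t - s) ^ 3 * sqrt (2 / pi)"
    using increment_expectation[of "\<lambda>x. \<bar>x\<bar> ^ 3"] integral_normal_moment_abs_odd[of "sqrt (t - s)" 0 1] st
    by (simp add: numeral_3_eq_3)
  then show ?thesis using mult_left_mono[OF sqrt_2_div_pi_le, of "2 * sqrt (t - s) ^ 3"] st by simp
qed

end

end

section \<open>Taylor expansion over one time step and stopped Riemann sums\<close>

lemma mvt_abs:
  fixes F :: "real \<Rightarrow> real"
  assumes "\<And>r. (F has_real_derivative F' r) (at r)"
  obtains \<xi> where "\<bar>\<xi> - y\<bar> \<le> \<bar>u\<bar>" "F (y + u) - F y = F' \<xi> * u"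
proof -
  consider "u = 0" | "u > 0" | "u < 0" by linarith
  then show thesis
  proof cases
    case 1 then show ?thesis using that[of y] by simp
  next
    case 2
    obtain z where "y < z" "z < y + u" "F (y + u) - F y = (y + u - y) * F' z"
      using MVT2[of y "y + u" F F'] 2 assms by auto
    then show ?thesis using that[of z] by auto
  next
    case 3
    obtain z where "y + u < z" "z < y" "F y - F (y + u) = (y - (y + u)) * F' z"
      using MVT2[of "y + u" y F F'] 3 assms by auto
    then show ?thesis using that[of z] by (auto simp: algebra_simps)
  qed
qed

lemma exp_minus_second_order: "\<bar>exp (- z) - 1 + z\<bar> \<le> z\<^sup>2" if "z \<ge> 0" for z :: real
proof -
  have "exp (- z) \<le> 1 / (1 + z)"
    using exp_ge_add_one_self[of z] that by (simp add: exp_minus field_simps)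
  also have "\<dots> - 1 + z = z\<^sup>2 / (1 + z)" using that by (simp add: field_simps power2_eq_square)
  also have "z\<^sup>2 / (1 + z) \<le> z\<^sup>2" using that by (simp add: field_simps mult_left_mono)
  finally have "exp (- z) - 1 + z \<le> z\<^sup>2" by simp
  moreover have "exp (- z) - 1 + z \<ge> 0" using exp_ge_add_one_self[of "- z"] by linarith
  ultimately show ?thesis by simp
qed

text \<open>The Lipschitz condition on \<open>f2\<close> stands in for a third derivative: solutions
  of the policy equation inherit from a Lipschitz parameter exactly this regularity.\<close>

locale C2_bounded =
  fixes f f1 f2 :: "real \<Rightarrow> real" and K :: real
  assumes f: "\<And>y. (f has_real_derivative f1 y) (at y)"
    and f1: "\<And>y. (f1 has_real_derivative f2 y) (at y)"
    and bounds: "\<And>y. \<bar>f y\<bar> \<le> K" "\<And>y. \<bar>f1 y\<bar> \<le> K" "\<And>y. \<bar>f2 y\<bar> \<le> K"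
    and f2_lipschitz: "\<And>y z. \<bar>f2 y - f2 z\<bar> \<le> K * \<bar>y - z\<bar>"
begin

lemma K_nonneg: "K \<ge> 0" using bounds(1)[of 0] by linarith

lemma cont: "continuous_on S f" "continuous_on S f1" "continuous_on S f2"
proof -
  show "continuous_on S f" "continuous_on S f1"
    using f f1 by (auto intro!: DERIV_continuous_on intro: has_field_derivative_at_within)
  have "K-lipschitz_on UNIV f2" using f2_lipschitz K_nonneg by (intro lipschitz_onI) (auto simp: dist_real_def)
  then show "continuous_on S f2"
    by (intro continuous_on_subset[OF lipschitz_on_continuous_on]) auto
qed

lemma meas [measurable]: "f \<in> borel_measurable borel" "f1 \<in> borel_measurable borel" "f2 \<in> borel_measurable borel"
  using cont by (auto intro: borel_measurable_continuous_onI)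

text \<open>Two mean value steps, the first for the difference of \<open>f\<close> and its quadratic
  Taylor polynomial, the second for \<open>f1\<close>; they give \<open>K\<close> where the sharp
  constant would be \<open>K / 6\<close>.\<close>

lemma taylor: "\<bar>f (y + u) - f y - f1 y * u - f2 y * u\<^sup>2 / 2\<bar> \<le> K * \<bar>u\<bar> ^ 3"
proof -
  define g where "g = (\<lambda>r. f (y + r) - f1 y * r - f2 y * r\<^sup>2 / 2)"
  have sh: "((\<lambda>r. f (y + r)) has_real_derivative f1 (y + r) * 1) (at r)" for r
    by (rule DERIV_chain2[OF f]) (auto intro!: derivative_eq_intros)
  have "(g has_real_derivative f1 (y + r) - f1 y - f2 y * r) (at r)" for r
    unfolding g_def by (rule derivative_eq_intros sh refl | simp)+
  then obtain r where r: "\<bar>r - 0\<bar> \<le> \<bar>u\<bar>" "g (0 + u) - g 0 = (f1 (y + r) - f1 y - f2 y * r) * u"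
    by (rule mvt_abs)
  obtain z where z: "\<bar>z - y\<bar> \<le> \<bar>r\<bar>" "f1 (y + r) - f1 y = f2 z * r"
    using f1 by (rule mvt_abs)
  have "f (y + u) - f y - f1 y * u - f2 y * u\<^sup>2 / 2 = (f2 z - f2 y) * r * u"
    using r z by (simp add: g_def algebra_simps)
  moreover have "\<bar>(f2 z - f2 y) * r * u\<bar> \<le> K * \<bar>u\<bar> * \<bar>u\<bar> * \<bar>u\<bar>"
  proof -
    have "\<bar>f2 z - f2 y\<bar> \<le> K * \<bar>u\<bar>"
      using f2_lipschitz[of z y] z r K_nonneg by (smt (verit) mult_left_mono)
    then show ?thesis using r K_nonneg unfolding abs_mult by (intro mult_mono) auto
  qed
  ultimately show ?thesis by (simp add: power3_eq_cube mult.assoc)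
qed

lemma lip: "\<bar>f (y + u) - f y\<bar> \<le> K * \<bar>u\<bar>"
proof -
  obtain z where "f (y + u) - f y = f1 z * u" using f by (rule mvt_abs)
  then show ?thesis using bounds(2)[of z] by (simp add: abs_mult mult_right_mono)
qed

text \<open>A single constant dominating the coefficients of all three error monomials
  \<open>\<delta>\<^sup>2\<close>, \<open>\<delta> * \<bar>w\<bar>\<close> and
  \<open>\<bar>w\<bar> ^ 3\<close>; the summands are those that arise in
  \<open>one_step_expansion\<close>.\<close>

definition remainder_const :: "real \<Rightarrow> real \<Rightarrow> real \<Rightarrow> real" where
  "remainder_const \<sigma> C c = K * (4 * C ^ 3 + 4 * \<sigma> ^ 3 + C\<^sup>2 + \<sigma> * C + c\<^sup>2 + c * C + c * \<sigma>)"

text \<open>\<open>B\<close> plays the drift increment and \<open>w\<close> the Brownian increment.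
  The subtracted terms split into the generator part and a part that has mean zero for an
  independent centred \<open>w\<close> of variance \<open>\<delta>\<close>; in expectation the
  remainder is then of order \<open>\<delta>\<close> to the power 3/2.\<close>

lemma one_step_expansion:
  assumes \<delta>: "0 < \<delta>" "\<delta> \<le> 1" and B: "\<bar>B\<bar> \<le> C * \<delta>" and pos: "\<sigma> > 0" "c > 0" "C \<ge> 0" "s \<ge> 0"
  shows "\<bar>exp (- c * (s + \<delta>)) * f (y + B + \<sigma> * w) - exp (- c * s) * f y
    - exp (- c * s) * ((\<sigma>\<^sup>2 / 2 * f2 y - c * f y) * \<delta> + f1 y * B)
    - exp (- c * s) * (\<sigma> * f1 y * w + \<sigma>\<^sup>2 / 2 * f2 y * (w\<^sup>2 - \<delta>))\<bar>
    \<le> remainder_const \<sigma> C c * (\<delta>\<^sup>2 + \<delta> * \<bar>w\<bar> + \<bar>w\<bar> ^ 3)" (is "\<bar>?lhs\<bar> \<le> _")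
proof -
  define u where "u = B + \<sigma> * w"
  let ?Y = "f (y + u)"
  have u: "\<bar>u\<bar> \<le> C * \<delta> + \<sigma> * \<bar>w\<bar>"
    using B pos abs_triangle_ineq[of B "\<sigma> * w"] by (simp add: u_def abs_mult)
  \<comment> \<open>The four errors: \<open>T1\<close> of the first-order expansion of the discount
    factor, \<open>T2\<close> the product of discount and increment of \<open>f\<close>,
    \<open>T3\<close> the Taylor remainder, \<open>T4\<close> the replacement of
    \<open>u\<^sup>2\<close> by its noise part.\<close>
  define T1 where "T1 = (exp (- (c * \<delta>)) - 1 + c * \<delta>) * ?Y"
  define T2 where "T2 = c * \<delta> * (?Y - f y)"
  define T3 where "T3 = ?Y - f y - f1 y * u - f2 y * u\<^sup>2 / 2"
  define T4 where "T4 = f2 y / 2 * (u\<^sup>2 - \<sigma>\<^sup>2 * w\<^sup>2)"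
  have lhs: "?lhs = exp (- c * s) * (T1 - T2 + T3 + T4)"
  proof -
    have e: "exp (- c * (s + \<delta>)) = exp (- c * s) * exp (- (c * \<delta>))"
      by (simp add: exp_add[symmetric] algebra_simps)
    have yu: "y + B + \<sigma> * w = y + u" by (simp add: u_def)
    show ?thesis unfolding e yu T1_def T2_def T3_def T4_def
      by (simp add: u_def algebra_simps power2_eq_square add_divide_distrib diff_divide_distrib)
  qed
  have w3: "0 \<le> \<bar>w\<bar> ^ 3" "0 \<le> \<delta> * \<bar>w\<bar>" "0 \<le> \<delta>\<^sup>2" using \<delta> by auto
  have d3: "\<delta> ^ 3 \<le> \<delta>\<^sup>2" using \<delta> by (simp add: power_decreasing)
  have "\<bar>T1\<bar> \<le> (c * \<delta>)\<^sup>2 * K"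
    unfolding T1_def abs_mult using \<delta> pos K_nonneg bounds(1)
    by (intro mult_mono exp_minus_second_order) auto
  then have T1: "\<bar>T1\<bar> \<le> K * c\<^sup>2 * \<delta>\<^sup>2" by (simp add: power_mult_distrib algebra_simps)
  have "\<bar>T2\<bar> \<le> c * \<delta> * (K * (C * \<delta> + \<sigma> * \<bar>w\<bar>))"
  proof -
    have "\<bar>?Y - f y\<bar> \<le> K * (C * \<delta> + \<sigma> * \<bar>w\<bar>)"
      using lip[of y u] mult_left_mono[OF u K_nonneg] by linarith
    then show ?thesis unfolding T2_def abs_mult using pos \<delta> by (auto intro!: mult_left_mono)
  qed
  then have T2: "\<bar>T2\<bar> \<le> K * (c * C) * \<delta>\<^sup>2 + K * (c * \<sigma>) * (\<delta> * \<bar>w\<bar>)"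
    by (simp add: algebra_simps power2_eq_square)
  have cube: "(p + q) ^ 3 \<le> 4 * (p ^ 3 + q ^ 3)" if "p \<ge> 0" "q \<ge> 0" for p q :: real
  proof -
    have "4 * (p ^ 3 + q ^ 3) - (p + q) ^ 3 = 3 * ((p + q) * (p - q)\<^sup>2)"
      by (simp add: power3_eq_cube power2_eq_square algebra_simps)
    then show ?thesis using that by (smt (verit) mult_nonneg_nonneg zero_le_power2)
  qed
  have "\<bar>T3\<bar> \<le> K * (C * \<delta> + \<sigma> * \<bar>w\<bar>) ^ 3"
    using taylor[of y u] mult_left_mono[OF power_mono[OF u, of 3] K_nonneg] unfolding T3_def by simp
  also have "\<dots> \<le> K * (4 * ((C * \<delta>) ^ 3 + (\<sigma> * \<bar>w\<bar>) ^ 3))"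
    using pos \<delta> K_nonneg by (intro mult_left_mono cube) auto
  also have "\<dots> = 4 * (K * C ^ 3) * \<delta> ^ 3 + K * (4 * \<sigma> ^ 3) * \<bar>w\<bar> ^ 3"
    by (simp add: power_mult_distrib algebra_simps)
  also have "\<dots> \<le> 4 * (K * C ^ 3) * \<delta>\<^sup>2 + K * (4 * \<sigma> ^ 3) * \<bar>w\<bar> ^ 3"
    using d3 K_nonneg pos by (intro add_right_mono mult_left_mono) auto
  finally have T3: "\<bar>T3\<bar> \<le> K * (4 * C ^ 3) * \<delta>\<^sup>2 + K * (4 * \<sigma> ^ 3) * \<bar>w\<bar> ^ 3" by simp
  have T4: "\<bar>T4\<bar> \<le> K * C\<^sup>2 * \<delta>\<^sup>2 + K * (\<sigma> * C) * (\<delta> * \<bar>w\<bar>)"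
  proof -
    have "u\<^sup>2 - \<sigma>\<^sup>2 * w\<^sup>2 = B * B + 2 * \<sigma> * B * w"
      by (simp add: u_def power2_eq_square algebra_simps)
    moreover have "\<bar>B * B\<bar> \<le> (C * \<delta>) * (C * \<delta>)" unfolding abs_mult using B by (intro mult_mono) auto
    moreover have "\<bar>2 * \<sigma> * B * w\<bar> \<le> 2 * \<sigma> * (C * \<delta>) * \<bar>w\<bar>"
      unfolding abs_mult using B pos by (intro mult_mono) auto
    ultimately have "\<bar>u\<^sup>2 - \<sigma>\<^sup>2 * w\<^sup>2\<bar> \<le> (C * \<delta>) * (C * \<delta>) + 2 * \<sigma> * (C * \<delta>) * \<bar>w\<bar>" by linarith
    moreover have "\<bar>f2 y / 2\<bar> \<le> K / 2" using bounds(3)[of y] by simp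
    ultimately have "\<bar>T4\<bar> \<le> K / 2 * ((C * \<delta>) * (C * \<delta>) + 2 * \<sigma> * (C * \<delta>) * \<bar>w\<bar>)"
      unfolding T4_def abs_mult[of "f2 y / 2"] using K_nonneg by (intro mult_mono) auto
    also have "\<dots> = K * C\<^sup>2 * \<delta>\<^sup>2 / 2 + K * (\<sigma> * C) * (\<delta> * \<bar>w\<bar>)"
      by (simp add: power2_eq_square algebra_simps)
    also have "\<dots> \<le> K * C\<^sup>2 * \<delta>\<^sup>2 + K * (\<sigma> * C) * (\<delta> * \<bar>w\<bar>)" using K_nonneg by simp
    finally show ?thesis .
  qed
  have "\<bar>?lhs\<bar> \<le> 1 * (\<bar>T1\<bar> + \<bar>T2\<bar> + \<bar>T3\<bar> + \<bar>T4\<bar>)"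
    unfolding lhs abs_mult using pos by (intro mult_mono) auto
  also have "\<dots> \<le> (K * (4 * C ^ 3 + C\<^sup>2 + c\<^sup>2 + c * C)) * \<delta>\<^sup>2 + (K * (c * \<sigma> + \<sigma> * C)) * (\<delta> * \<bar>w\<bar>) + (K * (4 * \<sigma> ^ 3)) * \<bar>w\<bar> ^ 3"
    using T1 T2 T3 T4 by (simp add: distrib_left distrib_right)
  also have "\<dots> \<le> remainder_const \<sigma> C c * \<delta>\<^sup>2 + remainder_const \<sigma> C c * (\<delta> * \<bar>w\<bar>) + remainder_const \<sigma> C c * \<bar>w\<bar> ^ 3"
  proof -
    have nn: "0 \<le> \<sigma> * C" "0 \<le> c * C" "0 \<le> c * \<sigma>" "0 \<le> C ^ 3" "0 \<le> \<sigma> ^ 3" "0 \<le> C\<^sup>2" "0 \<le> c\<^sup>2" using pos by auto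
    have *: "4 * C ^ 3 + C\<^sup>2 + c\<^sup>2 + c * C \<le> 4 * C ^ 3 + 4 * \<sigma> ^ 3 + C\<^sup>2 + \<sigma> * C + c\<^sup>2 + c * C + c * \<sigma>"
      "c * \<sigma> + \<sigma> * C \<le> 4 * C ^ 3 + 4 * \<sigma> ^ 3 + C\<^sup>2 + \<sigma> * C + c\<^sup>2 + c * C + c * \<sigma>"
      "4 * \<sigma> ^ 3 \<le> 4 * C ^ 3 + 4 * \<sigma> ^ 3 + C\<^sup>2 + \<sigma> * C + c\<^sup>2 + c * C + c * \<sigma>"
      using nn by linarith+
    show ?thesis unfolding remainder_const_def
      by (rule add_mono[OF add_mono]; rule mult_right_mono[OF mult_left_mono[OF _ K_nonneg]]) (fact * w3)+
  qed
  finally show ?thesis by (simp add: distrib_left)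
qed

end

section \<open>Riemann and telescoping sums stopped at a random time\<close>

lemma set_borel_measurable_subset:
  "set_borel_measurable lborel A f \<Longrightarrow> B \<in> sets borel \<Longrightarrow> B \<subseteq> A \<Longrightarrow> set_borel_measurable lborel B f"
  for f :: "real \<Rightarrow> real"
proof -
  assume f: "set_borel_measurable lborel A f" and B: "B \<in> sets borel" "B \<subseteq> A"
  have "(\<lambda>x. indicator B x * (indicator A x * f x)) \<in> borel_measurable lborel"
    using f B(1) by (auto simp: set_borel_measurable_def)
  moreover have "indicator B x * (indicator A x * f x) = indicator B x *\<^sub>R f x" for x
    using B(2) by (auto simp: indicator_def)
  ultimately show ?thesis by (simp add: set_borel_measurable_def)
qed

lemma set_integrable_bounded_Icc:
  fixes \<beta> :: "real \<Rightarrow> real"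
  assumes "set_borel_measurable lborel {0..T} \<beta>" "\<And>s. s \<in> {0..T} \<Longrightarrow> \<bar>\<beta> s\<bar> \<le> C" "0 \<le> u" "v \<le> T"
  shows "set_integrable lborel {u..v} \<beta>"
proof (rule set_integrable_bound)
  show "set_integrable lborel {u..v} (\<lambda>_. C)"
    unfolding set_integrable_def by (intro borel_integrable_compact) auto
  show "set_borel_measurable lborel {u..v} \<beta>"
    using assms by (intro set_borel_measurable_subset[OF assms(1)]) auto
  show "AE s in lborel. s \<in> {u..v} \<longrightarrow> norm (\<beta> s) \<le> norm C"
    using assms by (intro AE_I2) (auto intro!: order_trans[OF assms(2)])
qed

lemma set_borel_measurable_affine:
  fixes g p \<beta> :: "real \<Rightarrow> real"
  assumes g: "continuous_on {0..T} g" and p: "continuous_on {0..T} p"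
    and \<beta>: "set_borel_measurable lborel {0..T} \<beta>"
  shows "set_borel_measurable lborel {0..T} (\<lambda>s. g s + p s * \<beta> s)" (is "set_borel_measurable _ _ ?q")
proof -
  have "set_borel_measurable borel {0..T} g" "set_borel_measurable borel {0..T} p"
    using g p unfolding set_borel_measurable_def
    by (intro borel_measurable_continuous_on_indicator; simp)+
  from this \<beta> have m: "(\<lambda>s. indicator {0..T} s * g s) \<in> borel_measurable borel"
    "(\<lambda>s. indicator {0..T} s * p s) \<in> borel_measurable borel" "(\<lambda>s. indicator {0..T} s * \<beta> s) \<in> borel_measurable borel"
    unfolding set_borel_measurable_def real_scaleR_def measurable_lborel2 .
  from borel_measurable_add[OF m(1) borel_measurable_times[OF m(2,3)]]
  have "(\<lambda>s. indicator {0..T} s * g s + (indicator {0..T} s * p s) * (indicator {0..T} s * \<beta> s)) \<in> borel_measurable borel" .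
  moreover have "indicator {0..T} s * g s + (indicator {0..T} s * p s) * (indicator {0..T} s * \<beta> s) = indicator {0..T} s *\<^sub>R ?q s" for s
    by (auto simp: indicator_def)
  ultimately show ?thesis by (simp add: set_borel_measurable_def)
qed

text \<open>The grid points up to \<open>\<rho>\<close> form an initial segment of indices, and the
  endpoint of the last active cell overshoots \<open>\<rho>\<close> by at most one mesh. Capping at
  \<open>N\<close> matters for \<open>\<rho> = T\<close>, since index \<open>N\<close> does not
  start a cell.\<close>

lemma grid_stop_index:
  fixes T \<rho> :: real and N :: nat
  assumes T: "T > 0" and \<rho>: "0 \<le> \<rho>" "\<rho> \<le> T" and N: "N > 0"
  obtains k :: nat where "k \<le> N" "\<And>i. i < N \<Longrightarrow> T * i / N \<le> \<rho> \<longleftrightarrow> i < k" "\<bar>T * k / N - \<rho>\<bar> \<le> T / N"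
proof -
  define j where "j = nat \<lfloor>\<rho> * N / T\<rfloor>"
  have pos: "\<rho> * N / T \<ge> 0" using assms by simp
  have j: "real j \<le> \<rho> * N / T" "\<rho> * N / T < real j + 1"
    using pos by (auto simp: j_def)
  have jr: "T * real j / N \<le> \<rho>" "\<rho> < T * (real j + 1) / N"
    using j assms by (simp_all add: field_simps)
  show thesis
  proof (rule that[of "min N (Suc j)"])
    fix i assume i: "i < N"
    show "T * i / N \<le> \<rho> \<longleftrightarrow> i < min N (Suc j)"
    proof
      assume "T * i / N \<le> \<rho>"
      then have "T * i / N < T * (real j + 1) / N" using jr by linarith
      then have "real i < real j + 1" using T N by (simp add: divide_less_cancel)
      then show "i < min N (Suc j)" using i by simp
    next
      assume "i < min N (Suc j)"
      then have "T * i / N \<le> T * real j / N" using T N by (intro divide_right_mono mult_left_mono) auto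
      then show "T * i / N \<le> \<rho>" using jr by linarith
    qed
  next
    have s: "T * (real j + 1) / N = T * real j / N + T / N"
      by (simp add: distrib_left add_divide_distrib)
    show "\<bar>T * real (min N (Suc j)) / N - \<rho>\<bar> \<le> T / N"
    proof (cases "Suc j \<le> N")
      case True
      then have "real (min N (Suc j)) = real j + 1" by simp
      then show ?thesis using jr s by (simp only:)
    next
      case False
      then have "real N \<le> real j" by simp
      then have "T * real N / N \<le> T * real j / N" using T N by (intro divide_right_mono mult_left_mono) auto
      then have "\<rho> = T" using jr \<rho> N by simp
      then show ?thesis using False N T by (simp add: min_def)
    qed
  qed simp
qed

text \<open>The active cells are consecutive, so the sum collapses to a value of \<open>Y\<close>
  within one mesh of \<open>\<rho>\<close>. The second claim supplies the domination for passing to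
  expectations.\<close>

lemma stopped_telescope:
  fixes T \<rho> :: real and Y :: "real \<Rightarrow> real"
  assumes T: "T > 0" and \<rho>: "0 \<le> \<rho>" "\<rho> \<le> T" and Y: "continuous_on {0..T} Y"
  shows "(\<lambda>N. \<Sum>i<N. indicator {..\<rho>} (T * i / N) * (Y (T * Suc i / N) - Y (T * i / N))) \<longlonglongrightarrow> Y \<rho> - Y 0"
    and "(\<And>t. t \<in> {0..T} \<Longrightarrow> \<bar>Y t\<bar> \<le> L) \<Longrightarrow>
      \<bar>\<Sum>i<N. indicator {..\<rho>} (T * i / N) * (Y (T * Suc i / N) - Y (T * i / N))\<bar> \<le> 2 * L"
proof -
  let ?S = "\<lambda>N. \<Sum>i<N. indicator {..\<rho>} (T * i / N) * (Y (T * Suc i / N) - Y (T * i / N))"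
  have ex: "\<exists>t\<in>{0..T}. \<bar>t - \<rho>\<bar> \<le> T / N \<and> ?S N = Y t - Y 0" if N: "N > 0" for N
  proof -
    obtain k where k: "k \<le> N" "\<And>i. i < N \<Longrightarrow> T * i / N \<le> \<rho> \<longleftrightarrow> i < k" "\<bar>T * k / N - \<rho>\<bar> \<le> T / N"
      using grid_stop_index[OF T \<rho> N] by blast
    have "?S N = (\<Sum>i<N. if i < k then Y (T * Suc i / N) - Y (T * i / N) else 0)"
      using k(2) by (intro sum.cong) (auto simp: indicator_def)
    also have "\<dots> = (\<Sum>i<k. Y (T * Suc i / N) - Y (T * i / N))"
      using k(1) by (intro sum.mono_neutral_cong_right) auto
    also have "\<dots> = Y (T * k / N) - Y 0"
      by (subst sum_lessThan_telescope[of "\<lambda>i. Y (T * real i / N)"]) simp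
    finally have "?S N = Y (T * k / N) - Y 0" .
    moreover have "T * k / N \<in> {0..T}" using k(1) T N by (auto simp: field_simps)
    ultimately show ?thesis using k(3) by blast
  qed
  show "?S \<longlonglongrightarrow> Y \<rho> - Y 0"
  proof (rule LIMSEQ_I)
    fix r :: real assume r: "r > 0"
    obtain d where d: "d > 0" "\<And>t. t \<in> {0..T} \<Longrightarrow> dist t \<rho> < d \<Longrightarrow> dist (Y t) (Y \<rho>) < r"
      using Y \<rho> r unfolding continuous_on_iff by (metis atLeastAtMost_iff)
    obtain N0 where N0: "N0 > 0" "T / real N0 < d"
      using reals_Archimedean2[of "T / d"] d T
      by (metis divide_less_eq divide_pos_pos mult.commute of_nat_0_less_iff order_less_trans)
    show "\<exists>no. \<forall>N\<ge>no. norm (?S N - (Y \<rho> - Y 0)) < r"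
    proof (intro exI allI impI)
      fix N assume N: "N \<ge> N0"
      then have Np: "N > 0" using N0 by simp
      obtain t where t: "t \<in> {0..T}" "\<bar>t - \<rho>\<bar> \<le> T / N" "?S N = Y t - Y 0" using ex[OF Np] by blast
      have "T / N \<le> T / N0" using N N0 T by (intro divide_left_mono) auto
      then have "dist (Y t) (Y \<rho>) < r" using d(2)[OF t(1)] t(2) N0(2) by (simp add: dist_real_def)
      then show "norm (?S N - (Y \<rho> - Y 0)) < r" unfolding t(3) by (simp add: dist_real_def)
    qed
  qed
  assume L: "\<And>t. t \<in> {0..T} \<Longrightarrow> \<bar>Y t\<bar> \<le> L"
  show "\<bar>?S N\<bar> \<le> 2 * L"
  proof (cases "N = 0")
    case True then show ?thesis using L[of 0] T by simp
  next
    case False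
    then obtain t where t: "t \<in> {0..T}" "?S N = Y t - Y 0" using ex[of N] by blast
    show ?thesis unfolding t(2) using L[OF t(1)] L[of 0] T by auto
  qed
qed

text \<open>\<open>\<beta>\<close> is merely measurable, so its cell integrals are kept exact; only
  the continuous weights \<open>g\<close> and \<open>p\<close> are frozen at left endpoints, and
  their uniform continuity controls the error.\<close>

lemma stopped_riemann_sum:
  fixes T \<rho> C :: real and g p \<beta> :: "real \<Rightarrow> real"
  assumes T: "T > 0" and \<rho>: "0 \<le> \<rho>" "\<rho> \<le> T" and g: "continuous_on {0..T} g" and p: "continuous_on {0..T} p"
    and \<beta>: "set_borel_measurable lborel {0..T} \<beta>" "\<And>s. s \<in> {0..T} \<Longrightarrow> \<bar>\<beta> s\<bar> \<le> C"
  shows "(\<lambda>N. \<Sum>i<N. indicator {..\<rho>} (T * i / N) *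
      (g (T * i / N) * (T / N) + p (T * i / N) * integral {T * i / N..T * Suc i / N} \<beta>))
    \<longlonglongrightarrow> (LINT s:{0..\<rho>}|lborel. g s + p s * \<beta> s)" (is "?S \<longlonglongrightarrow> _")
proof -
  have C: "C \<ge> 0" using \<beta>(2)[of 0] T by force
  obtain L where L: "\<And>t. t \<in> {0..T} \<Longrightarrow> \<bar>g t\<bar> \<le> L" "\<And>t. t \<in> {0..T} \<Longrightarrow> \<bar>p t\<bar> \<le> L"
  proof -
    have "bounded (g ` {0..T})" "bounded (p ` {0..T})"
      using g p by (auto intro: compact_imp_bounded compact_continuous_image)
    then obtain L1 L2 where "\<forall>t\<in>{0..T}. \<bar>g t\<bar> \<le> L1" "\<forall>t\<in>{0..T}. \<bar>p t\<bar> \<le> L2"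
      unfolding bounded_iff by (metis imageI real_norm_def)
    then show thesis using that[of "max L1 L2"] by (auto simp: le_max_iff_disj)
  qed
  have L0: "L \<ge> 0" using L(1)[of 0] T by force
  let ?q = "\<lambda>s. g s + p s * \<beta> s"
  define D where "D = L + L * C"
  have D0: "D \<ge> 0" using L0 C by (simp add: D_def)
  have qb: "\<bar>?q s\<bar> \<le> D" if "s \<in> {0..T}" for s
  proof -
    have "\<bar>p s * \<beta> s\<bar> \<le> L * C" unfolding abs_mult using L(2)[OF that] \<beta>(2)[OF that] L0 by (intro mult_mono) auto
    then show ?thesis using L(1)[OF that] unfolding D_def by linarith
  qed
  have qm: "set_borel_measurable lborel {0..T} ?q"
    using g p \<beta>(1) by (rule set_borel_measurable_affine)
  note qi = set_integrable_bounded_Icc[OF qm qb]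
  note bi = set_integrable_bounded_Icc[OF \<beta>]
  note qint = set_borel_integral_eq_integral(1)[OF qi]
  note bint = set_borel_integral_eq_integral(1)[OF bi]
  let ?t = "\<lambda>N i. T * real i / real N"
  let ?s = "\<lambda>N i. g (?t N i) * (T / N) + p (?t N i) * integral {?t N i..?t N (Suc i)} \<beta>"
  \<comment> \<open>\<open>e\<close> bounds the weighted oscillation of \<open>g\<close> and
    \<open>p\<close> over one mesh; summed over the cells, it becomes an error of \<open>e\<close>
    per unit of time.\<close>
  have main: "\<bar>(\<Sum>i<k. ?s N i) - integral {0..?t N k} ?q\<bar> \<le> e * ?t N k"
    if N: "N > 0" and k: "k \<le> N" and
      d: "\<And>s t. s \<in> {0..T} \<Longrightarrow> t \<in> {0..T} \<Longrightarrow> \<bar>s - t\<bar> \<le> T / N \<Longrightarrow> \<bar>g s - g t\<bar> + \<bar>p s - p t\<bar> * C \<le> e" for N k e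
    using k
  proof (induction k)
    case (Suc k)
    have rng: "0 \<le> ?t N k" "?t N k \<le> ?t N (Suc k)" "?t N (Suc k) \<le> T" "?t N (Suc k) - ?t N k = T / N"
    proof -
      have "T * real (Suc k) \<le> T * real N" using T Suc.prems by (intro mult_left_mono) auto
      then show "0 \<le> ?t N k" "?t N k \<le> ?t N (Suc k)" "?t N (Suc k) \<le> T" "?t N (Suc k) - ?t N k = T / N"
        using T N by (auto simp: field_simps)
    qed
    have split: "integral {0..?t N (Suc k)} ?q = integral {0..?t N k} ?q + integral {?t N k..?t N (Suc k)} ?q"
      using rng by (intro Henstock_Kurzweil_Integration.integral_combine[symmetric] qint) auto
    have "?s N k = integral {?t N k..?t N (Suc k)} (\<lambda>s. g (?t N k) + p (?t N k) * \<beta> s)"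
      using rng by (subst Henstock_Kurzweil_Integration.integral_add) (auto intro!: integrable_on_mult_right bint)
    then have "\<bar>?s N k - integral {?t N k..?t N (Suc k)} ?q\<bar> =
        \<bar>integral {?t N k..?t N (Suc k)} (\<lambda>s. (g (?t N k) + p (?t N k) * \<beta> s) - ?q s)\<bar>"
    proof -
      have "(\<lambda>s. g (?t N k) + p (?t N k) * \<beta> s) integrable_on {?t N k..?t N (Suc k)}"
        using rng by (intro integrable_add integrable_on_mult_right bint) auto
      moreover have "?q integrable_on {?t N k..?t N (Suc k)}" using rng by (intro qint) auto
      ultimately show ?thesis
        using \<open>?s N k = _\<close> by (simp only: Henstock_Kurzweil_Integration.integral_diff)
    qed
    also have "\<dots> \<le> integral {?t N k..?t N (Suc k)} (\<lambda>_. e)"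
    proof -
      have "norm (integral {?t N k..?t N (Suc k)} (\<lambda>s. (g (?t N k) + p (?t N k) * \<beta> s) - ?q s))
          \<le> integral {?t N k..?t N (Suc k)} (\<lambda>_. e)"
      proof (rule integral_norm_bound_integral)
        show "(\<lambda>s. (g (?t N k) + p (?t N k) * \<beta> s) - ?q s) integrable_on {?t N k..?t N (Suc k)}"
        proof (rule integrable_diff)
          show "(\<lambda>s. g (?t N k) + p (?t N k) * \<beta> s) integrable_on {?t N k..?t N (Suc k)}"
            using rng by (intro integrable_add integrable_on_mult_right bint) auto
          show "?q integrable_on {?t N k..?t N (Suc k)}" using rng by (intro qint) auto
        qed
        show "norm ((g (?t N k) + p (?t N k) * \<beta> s) - ?q s) \<le> e" if s: "s \<in> {?t N k..?t N (Suc k)}" for s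
        proof -
          have sT: "s \<in> {0..T}" "?t N k \<in> {0..T}" using s rng by auto
          have "\<bar>g (?t N k) - g s\<bar> + \<bar>p (?t N k) - p s\<bar> * C \<le> e"
            using s rng by (intro d sT) auto
          moreover have "\<bar>(p (?t N k) - p s) * \<beta> s\<bar> \<le> \<bar>p (?t N k) - p s\<bar> * C"
            unfolding abs_mult using \<beta>(2)[OF sT(1)] by (intro mult_left_mono) auto
          moreover have "(g (?t N k) + p (?t N k) * \<beta> s) - ?q s = (g (?t N k) - g s) + (p (?t N k) - p s) * \<beta> s"
            by (simp add: algebra_simps)
          ultimately show ?thesis unfolding real_norm_def by linarith
        qed
      qed auto
      then show ?thesis by simp
    qed
    also have "\<dots> = e * (T / N)" using rng by simp
    finally have "\<bar>?s N k - integral {?t N k..?t N (Suc k)} ?q\<bar> \<le> e * (T / N)" .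
    moreover have "\<bar>(\<Sum>i<k. ?s N i) - integral {0..?t N k} ?q\<bar> \<le> e * ?t N k" using Suc by simp
    moreover have e: "e * ?t N (Suc k) = e * ?t N k + e * (T / N)"
      unfolding rng(4)[symmetric] by (simp add: right_diff_distrib)
    moreover have "\<bar>(S + q) - (I + J)\<bar> \<le> u + v" if "\<bar>q - J\<bar> \<le> v" "\<bar>S - I\<bar> \<le> u" for S q I J u v :: real
      using that by linarith
    ultimately show ?case unfolding split e sum.lessThan_Suc by blast
  qed simp
  have tail: "\<bar>integral {0..t} ?q - integral {0..\<rho>} ?q\<bar> \<le> D * \<bar>t - \<rho>\<bar>" if t: "t \<in> {0..T}" for t
  proof -
    have *: "\<bar>integral {0..v} ?q - integral {0..u} ?q\<bar> \<le> D * (v - u)" if uv: "0 \<le> u" "u \<le> v" "v \<le> T" for u v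
    proof -
      have "integral {0..v} ?q = integral {0..u} ?q + integral {u..v} ?q"
        using uv by (intro Henstock_Kurzweil_Integration.integral_combine[symmetric] qint) auto
      moreover have "norm (integral {u..v} ?q) \<le> integral {u..v} (\<lambda>_. D)"
        using uv qb by (intro integral_norm_bound_integral qint) auto
      ultimately show ?thesis using uv by (simp add: mult.commute)
    qed
    show ?thesis using *[of t \<rho>] *[of \<rho> t] t \<rho> by (cases "t \<le> \<rho>") (auto simp: abs_minus_commute)
  qed
  have "?S \<longlonglongrightarrow> integral {0..\<rho>} ?q"
  proof (rule LIMSEQ_I)
    fix r :: real assume r: "r > 0"
    define e where "e = r / (2 * T)"
    have e: "e > 0" using r T by (simp add: e_def)
    have ug: "uniformly_continuous_on {0..T} g" "uniformly_continuous_on {0..T} p"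
      using g p by (auto intro: compact_uniformly_continuous)
    obtain d1 where d1: "d1 > 0" "\<And>s t. s \<in> {0..T} \<Longrightarrow> t \<in> {0..T} \<Longrightarrow> \<bar>s - t\<bar> < d1 \<Longrightarrow> \<bar>g s - g t\<bar> < e / 2"
      using ug(1) e unfolding uniformly_continuous_on_def dist_real_def by (metis half_gt_zero)
    have "e / (2 * (C + 1)) > 0" using e C by simp
    then obtain d2 where d2: "d2 > 0" "\<And>s t. s \<in> {0..T} \<Longrightarrow> t \<in> {0..T} \<Longrightarrow> \<bar>s - t\<bar> < d2 \<Longrightarrow> \<bar>p s - p t\<bar> < e / (2 * (C + 1))"
      using ug(2) unfolding uniformly_continuous_on_def dist_real_def by metis
    \<comment> \<open>The last bound on the mesh handles the piece between \<open>\<rho>\<close> and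
      the grid point where the sum stops: the integrand there is at most \<open>D\<close>.\<close>
    define d where "d = min (min d1 d2) (r / (2 * (D + 1)))"
    have dpos: "d > 0" using d1 d2 r D0 by (simp add: d_def)
    obtain N0 where N0: "N0 > 0" "T / real N0 < d"
      using reals_Archimedean2[of "T / d"] dpos T
      by (metis divide_less_eq divide_pos_pos mult.commute of_nat_0_less_iff order_less_trans)
    show "\<exists>no. \<forall>N\<ge>no. norm (?S N - integral {0..\<rho>} ?q) < r"
    proof (intro exI allI impI)
      fix N assume N: "N \<ge> N0"
      then have Np: "N > 0" using N0 by simp
      have "T / N \<le> T / N0" using N N0 T by (intro divide_left_mono) auto
      then have TN: "T / N < d" using N0(2) by linarith
      obtain k where k: "k \<le> N" "\<And>i. i < N \<Longrightarrow> T * i / N \<le> \<rho> \<longleftrightarrow> i < k" "\<bar>T * k / N - \<rho>\<bar> \<le> T / N"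
        using grid_stop_index[OF T \<rho> Np] by blast
      have "?S N = (\<Sum>i<N. if i < k then ?s N i else 0)"
        using k(2) by (intro sum.cong) (auto simp: indicator_def)
      also have "\<dots> = (\<Sum>i<k. ?s N i)"
        using k(1) by (intro sum.mono_neutral_cong_right) auto
      finally have S: "?S N = (\<Sum>i<k. ?s N i)" .
      have tk: "?t N k \<in> {0..T}" using k(1) T Np by (auto simp: field_simps)
      have "\<bar>g s - g t\<bar> + \<bar>p s - p t\<bar> * C \<le> e" if "s \<in> {0..T}" "t \<in> {0..T}" "\<bar>s - t\<bar> \<le> T / N" for s t
      proof -
        have gp: "\<bar>g s - g t\<bar> < e / 2" "\<bar>p s - p t\<bar> < e / (2 * (C + 1))"
          using d1(2)[of s t] d2(2)[of s t] that TN by (auto simp: d_def)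
        have "\<bar>p s - p t\<bar> * C \<le> e / (2 * (C + 1)) * (C + 1)"
          using gp(2) C by (intro mult_mono) auto
        also have "\<dots> = e / 2" using C by (simp add: field_simps)
        finally show ?thesis using gp(1) by linarith
      qed
      from main[OF Np k(1) this] have "\<bar>?S N - integral {0..?t N k} ?q\<bar> \<le> e * ?t N k" unfolding S .
      also have "\<dots> \<le> e * T" using tk e by (intro mult_left_mono) auto
      also have "\<dots> = r / 2" using T by (simp add: e_def)
      finally have 1: "\<bar>?S N - integral {0..?t N k} ?q\<bar> \<le> r / 2" .
      have "\<bar>integral {0..?t N k} ?q - integral {0..\<rho>} ?q\<bar> \<le> D * (T / N)"
        using tail[OF tk] mult_left_mono[OF k(3) D0] by linarith
      also have "\<dots> \<le> D * (r / (2 * (D + 1)))"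
        using TN D0 by (intro mult_left_mono) (auto simp: d_def)
      also have "\<dots> < (D + 1) * (r / (2 * (D + 1)))"
        using r D0 by (intro mult_strict_right_mono) auto
      also have "\<dots> = r / 2" using D0 by (simp add: field_simps)
      finally show "norm (?S N - integral {0..\<rho>} ?q) < r" using 1 unfolding real_norm_def by linarith
    qed
  qed
  moreover have "(LINT s:{0..\<rho>}|lborel. ?q s) = integral {0..\<rho>} ?q"
    using \<rho> by (intro set_borel_integral_eq_integral(2) qi) auto
  ultimately show ?thesis by (simp only:)
qed

section \<open>Dynkin's formula\<close>

text \<open>The drift is bounded and measurable along each path; adaptedness is required of the
  state, because the coefficients multiplying the Brownian increments are functions of the state at
  the left endpoint.\<close>

locale ito_process = brownian M W for M :: "'a measure" and W +
  fixes \<sigma> x C :: real and b :: "real \<Rightarrow> 'a \<Rightarrow> real"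
  assumes sigma_pos: "\<sigma> > 0"
    and b_measurable: "\<And>\<omega> T. \<omega> \<in> space M \<Longrightarrow> set_borel_measurable lborel {0..T} (\<lambda>s. b s \<omega>)"
    and b_bound: "\<And>\<omega> s. \<omega> \<in> space M \<Longrightarrow> s \<ge> 0 \<Longrightarrow> \<bar>b s \<omega>\<bar> \<le> C"
    and state_adapted: "\<And>t. t \<ge> 0 \<Longrightarrow>
      (\<lambda>\<omega>. x + (LINT s:{0..t}|lborel. b s \<omega>) + \<sigma> * W t \<omega>) \<in> borel_measurable (Fil t)"
begin

definition X :: "real \<Rightarrow> 'a \<Rightarrow> real" where
  "X t \<omega> = x + (LINT s:{0..t}|lborel. b s \<omega>) + \<sigma> * W t \<omega>"

lemma X_adapted: "t \<ge> 0 \<Longrightarrow> X t \<in> borel_measurable (Fil t)"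
  using state_adapted[of t] by (simp add: X_def[abs_def])

lemma X_measurable: "t \<ge> 0 \<Longrightarrow> X t \<in> borel_measurable M"
  using X_adapted measurable_Fil by blast

lemma C_nonneg: "C \<ge> 0"
proof -
  obtain \<omega> where "\<omega> \<in> space M" using not_empty by blast
  then show ?thesis using b_bound[of \<omega> 0] by linarith
qed

context
  fixes \<omega> assumes \<omega>: "\<omega> \<in> space M"
begin

lemma b_set_integrable: "0 \<le> u \<Longrightarrow> set_integrable lborel {u..v} (\<lambda>s. b s \<omega>)"
  by (rule set_integrable_bounded_Icc[OF b_measurable[OF \<omega>, of v] b_bound[OF \<omega>]]) auto

lemma b_integrable: "0 \<le> u \<Longrightarrow> (\<lambda>s. b s \<omega>) integrable_on {u..v}"
  by (rule set_borel_integral_eq_integral(1)[OF b_set_integrable])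

lemma X_eq: "X t \<omega> = x + integral {0..t} (\<lambda>s. b s \<omega>) + \<sigma> * W t \<omega>"
  unfolding X_def using set_borel_integral_eq_integral(2)[OF b_set_integrable[of 0 t]] by simp

lemma X_0: "X 0 \<omega> = x"
  unfolding X_eq by (simp add: W_zero[OF \<omega>])

lemma X_increment:
  assumes "0 \<le> s" "s \<le> t"
  shows "integral {s..t} (\<lambda>r. b r \<omega>) = X t \<omega> - X s \<omega> - \<sigma> * (W t \<omega> - W s \<omega>)"
proof -
  have "integral {0..s} (\<lambda>r. b r \<omega>) + integral {s..t} (\<lambda>r. b r \<omega>) = integral {0..t} (\<lambda>r. b r \<omega>)"
    using assms by (intro Henstock_Kurzweil_Integration.integral_combine b_integrable) auto
  then show ?thesis unfolding X_eq by (simp add: algebra_simps)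
qed

lemma drift_increment_bound:
  assumes "0 \<le> s" "s \<le> t"
  shows "\<bar>X t \<omega> - X s \<omega> - \<sigma> * (W t \<omega> - W s \<omega>)\<bar> \<le> C * (t - s)"
proof -
  have "norm (integral {s..t} (\<lambda>r. b r \<omega>)) \<le> integral {s..t} (\<lambda>_. C)"
    using assms by (intro integral_norm_bound_integral b_integrable) (auto intro!: b_bound[OF \<omega>])
  then show ?thesis using assms by (simp add: X_increment[symmetric] mult.commute)
qed

lemma X_continuous: "continuous_on {0..} (\<lambda>t. X t \<omega>)"
proof (rule continuous_on_atLeastI)
  fix T :: real
  have "continuous_on {0..T} (\<lambda>t. x + integral {0..t} (\<lambda>s. b s \<omega>) + \<sigma> * W t \<omega>)"
    by (intro continuous_intros indefinite_integral_continuous_1 b_integrable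
        continuous_on_subset[OF W_continuous[OF \<omega>]]) auto
  then show "continuous_on {0..T} (\<lambda>t. X t \<omega>)" by (simp add: X_eq)
qed

end

end

locale ito_test = ito_process M W \<sigma> x C b + C2_bounded f f1 f2 K
  for M :: "'a measure" and W \<sigma> x C b f f1 f2 K +
  fixes c :: real assumes c_pos: "c > 0"
begin

definition Y :: "real \<Rightarrow> 'a \<Rightarrow> real" where
  "Y t \<omega> = exp (- c * t) * f (X t \<omega>)"
definition g :: "real \<Rightarrow> 'a \<Rightarrow> real" where
  "g t \<omega> = exp (- c * t) * (\<sigma>\<^sup>2 / 2 * f2 (X t \<omega>) - c * f (X t \<omega>))"
definition p :: "real \<Rightarrow> 'a \<Rightarrow> real" where
  "p t \<omega> = exp (- c * t) * f1 (X t \<omega>)"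
text \<open>The drift contribution is written as the state increment minus the noise increment, so
  measurability in \<open>\<omega>\<close> comes from \<open>X\<close> and \<open>W\<close>. By
  \<open>X_increment\<close> it equals the integral of the drift.\<close>

definition one_step :: "real \<Rightarrow> real \<Rightarrow> 'a \<Rightarrow> real" where
  "one_step s t \<omega> = Y t \<omega> - Y s \<omega>
     - (g s \<omega> * (t - s) + p s \<omega> * (X t \<omega> - X s \<omega> - \<sigma> * (W t \<omega> - W s \<omega>)))"

abbreviation "D \<equiv> remainder_const \<sigma> C c"

lemma Ygp_measurable [measurable]:
  assumes [measurable]: "X t \<in> borel_measurable N"
  shows "Y t \<in> borel_measurable N" "g t \<in> borel_measurable N" "p t \<in> borel_measurable N"
  unfolding Y_def g_def p_def by measurable

lemma exp_c_le: "t \<ge> 0 \<Longrightarrow> exp (- c * t) \<le> 1"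
  using c_pos by simp

lemma Ygp_bound:
  assumes "t \<ge> 0"
  shows "\<bar>Y t \<omega>\<bar> \<le> K" "\<bar>g t \<omega>\<bar> \<le> \<sigma>\<^sup>2 / 2 * K + c * K" "\<bar>p t \<omega>\<bar> \<le> K"
proof -
  have *: "\<bar>exp (- c * t) * z\<bar> \<le> L" if "\<bar>z\<bar> \<le> L" for z L :: real
  proof -
    have "exp (- c * t) * \<bar>z\<bar> \<le> 1 * \<bar>z\<bar>" using exp_c_le[OF assms] by (intro mult_right_mono) auto
    then show ?thesis using that by (simp add: abs_mult)
  qed
  show "\<bar>Y t \<omega>\<bar> \<le> K" "\<bar>p t \<omega>\<bar> \<le> K" unfolding Y_def p_def by (intro * bounds)+
  have "\<bar>\<sigma>\<^sup>2 / 2 * f2 (X t \<omega>)\<bar> \<le> \<sigma>\<^sup>2 / 2 * K" "\<bar>c * f (X t \<omega>)\<bar> \<le> c * K"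
    using bounds(1)[of "X t \<omega>"] bounds(3)[of "X t \<omega>"] c_pos unfolding abs_mult
    by (auto intro!: mult_left_mono)
  then show "\<bar>g t \<omega>\<bar> \<le> \<sigma>\<^sup>2 / 2 * K + c * K" unfolding g_def by (intro *) linarith
qed

lemma Ygp_continuous:
  assumes "\<omega> \<in> space M"
  shows "continuous_on {0..T} (\<lambda>t. Y t \<omega>)" "continuous_on {0..T} (\<lambda>t. g t \<omega>)" "continuous_on {0..T} (\<lambda>t. p t \<omega>)"
proof -
  have X: "continuous_on {0..T} (\<lambda>t. X t \<omega>)"
    by (rule continuous_on_subset[OF X_continuous[OF assms]]) auto
  note comp = continuous_on_compose2[OF cont(1)[of UNIV] X] continuous_on_compose2[OF cont(2)[of UNIV] X]
    continuous_on_compose2[OF cont(3)[of UNIV] X]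
  show "continuous_on {0..T} (\<lambda>t. Y t \<omega>)" "continuous_on {0..T} (\<lambda>t. g t \<omega>)" "continuous_on {0..T} (\<lambda>t. p t \<omega>)"
    unfolding Y_def g_def p_def by (intro continuous_intros comp; simp)+
qed

lemma one_step_measurable: "0 \<le> s \<Longrightarrow> 0 \<le> t \<Longrightarrow> one_step s t \<in> borel_measurable M"
proof -
  assume "0 \<le> s" "0 \<le> t"
  then have [measurable]: "X s \<in> borel_measurable M" "X t \<in> borel_measurable M" by (auto intro: X_measurable)
  show ?thesis unfolding one_step_def[abs_def] by measurable
qed

text \<open>The event \<open>A\<close> and the coefficients are known at time \<open>s\<close> and
  bounded. They are independent of the increment, whose first moment is 0 and whose square has mean
  \<open>t - s\<close>.\<close>

lemma martingale_part:
  assumes s: "0 \<le> s" "s < t" and A: "A \<in> sets (Fil s)"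
  defines "N \<equiv> \<lambda>\<omega>. exp (- c * s) * (\<sigma> * f1 (X s \<omega>) * (W t \<omega> - W s \<omega>)
      + \<sigma>\<^sup>2 / 2 * f2 (X s \<omega>) * ((W t \<omega> - W s \<omega>)\<^sup>2 - (t - s)))"
  shows "integrable M (\<lambda>\<omega>. indicator A \<omega> * N \<omega>)" "expectation (\<lambda>\<omega>. indicator A \<omega> * N \<omega>) = 0"
proof -
  let ?w = "\<lambda>\<omega>. W t \<omega> - W s \<omega>"
  let ?Z1 = "\<lambda>\<omega>. indicator A \<omega> * (exp (- c * s) * (\<sigma> * f1 (X s \<omega>)))"
  let ?Z2 = "\<lambda>\<omega>. indicator A \<omega> * (exp (- c * s) * (\<sigma>\<^sup>2 / 2 * f2 (X s \<omega>)))"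
  have [measurable]: "X s \<in> borel_measurable (Fil s)" "A \<in> sets (Fil s)" using X_adapted s A by auto
  have Zm: "?Z1 \<in> borel_measurable (Fil s)" "?Z2 \<in> borel_measurable (Fil s)" by measurable
  have b1: "\<bar>?Z1 \<omega>\<bar> \<le> exp (- c * s) * (\<sigma> * K)" for \<omega>
  proof -
    have "\<bar>exp (- c * s) * (\<sigma> * f1 (X s \<omega>))\<bar> \<le> exp (- c * s) * (\<sigma> * K)"
      unfolding abs_mult using bounds sigma_pos by (intro mult_mono) auto
    then show ?thesis using K_nonneg sigma_pos by (auto simp: indicator_def)
  qed
  have b2: "\<bar>?Z2 \<omega>\<bar> \<le> exp (- c * s) * (\<sigma>\<^sup>2 / 2 * K)" for \<omega>
  proof -
    have "\<bar>exp (- c * s) * (\<sigma>\<^sup>2 / 2 * f2 (X s \<omega>))\<bar> \<le> exp (- c * s) * (\<sigma>\<^sup>2 / 2 * K)"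
      unfolding abs_mult using bounds by (intro mult_mono) auto
    then show ?thesis using K_nonneg by (auto simp: indicator_def)
  qed
  have Zi: "integrable M ?Z1" "integrable M ?Z2"
    by (rule integrable_const_bound[OF AE_I2[OF b1[folded real_norm_def]] Zm(1)[THEN measurable_Fil]],
        rule integrable_const_bound[OF AE_I2[OF b2[folded real_norm_def]] Zm(2)[THEN measurable_Fil]])
  have wi: "integrable M ?w" "integrable M (\<lambda>\<omega>. (?w \<omega>)\<^sup>2 - (t - s))"
    using increment_integrable_power(1)[OF s, of 1] increment_integrable_power(1)[OF s, of 2] by auto
  have ind1: "indep_var borel ?Z1 borel ?w" by (rule increment_indep_Fil[OF Zm(1) s])
  have "indep_var borel ((\<lambda>z. z) \<circ> ?Z2) borel ((\<lambda>w. w\<^sup>2 - (t - s)) \<circ> ?w)"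
    by (rule indep_var_compose[OF increment_indep_Fil[OF Zm(2) s]]) auto
  then have ind2: "indep_var borel ?Z2 borel (\<lambda>\<omega>. (?w \<omega>)\<^sup>2 - (t - s))" by (simp add: comp_def)
  have w2: "expectation (\<lambda>\<omega>. (?w \<omega>)\<^sup>2 - (t - s)) = 0"
    using increment_square[OF s] increment_integrable_power(1)[OF s, of 2] by (simp add: prob_space)
  have eq: "indicator A \<omega> * N \<omega> = ?Z1 \<omega> * ?w \<omega> + ?Z2 \<omega> * ((?w \<omega>)\<^sup>2 - (t - s))" for \<omega>
    by (simp add: N_def algebra_simps)
  note i1 = indep_var_integrable[OF ind1 Zi(1) wi(1)] and i2 = indep_var_integrable[OF ind2 Zi(2) wi(2)]
  show "integrable M (\<lambda>\<omega>. indicator A \<omega> * N \<omega>)"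
    unfolding eq by (intro Bochner_Integration.integrable_add i1 i2)
  show "expectation (\<lambda>\<omega>. indicator A \<omega> * N \<omega>) = 0"
    unfolding eq Bochner_Integration.integral_add[OF i1 i2]
      indep_var_lebesgue_integral[OF ind1 Zi(1) wi(1)] indep_var_lebesgue_integral[OF ind2 Zi(2) wi(2)]
      increment_mean[OF s] w2 by simp
qed

lemma D_nonneg: "D \<ge> 0"
  unfolding remainder_const_def using K_nonneg C_nonneg sigma_pos c_pos by (intro mult_nonneg_nonneg add_nonneg_nonneg) auto

text \<open>Subtracting the mean-zero part leaves only the pointwise remainder. Multiplication by an
  event known at time \<open>s\<close> preserves this, which is what permits stopping.\<close>

lemma one_step_expectation:
  assumes s: "0 \<le> s" "s < t" "t - s \<le> 1" and A: "A \<in> sets (Fil s)"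
  shows "integrable M (\<lambda>\<omega>. indicator A \<omega> * one_step s t \<omega>)"
    "\<bar>expectation (\<lambda>\<omega>. indicator A \<omega> * one_step s t \<omega>)\<bar> \<le> 4 * D * (t - s) * sqrt (t - s)"
proof -
  let ?w = "\<lambda>\<omega>. W t \<omega> - W s \<omega>" and ?\<delta> = "t - s"
  define N where "N = (\<lambda>\<omega>. exp (- c * s) * (\<sigma> * f1 (X s \<omega>) * ?w \<omega> + \<sigma>\<^sup>2 / 2 * f2 (X s \<omega>) * ((?w \<omega>)\<^sup>2 - ?\<delta>)))"
  let ?R = "\<lambda>\<omega>. D * (?\<delta>\<^sup>2 + ?\<delta> * \<bar>?w \<omega>\<bar> + \<bar>?w \<omega>\<bar> ^ 3)"
  have mart: "integrable M (\<lambda>\<omega>. indicator A \<omega> * N \<omega>)" "expectation (\<lambda>\<omega>. indicator A \<omega> * N \<omega>) = 0"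
    using martingale_part[OF s(1,2) A] unfolding N_def by auto
  have AM: "A \<in> events" using A sets_Fil_subset by auto
  have [measurable]: "X s \<in> borel_measurable M" "X t \<in> borel_measurable M" using s by (auto intro: X_measurable)
  have Nm: "N \<in> borel_measurable M" unfolding N_def by measurable
  have bd: "\<bar>one_step s t \<omega> - N \<omega>\<bar> \<le> ?R \<omega>" if \<omega>: "\<omega> \<in> space M" for \<omega>
  proof -
    let ?B = "X t \<omega> - X s \<omega> - \<sigma> * ?w \<omega>"
    have st: "s + ?\<delta> = t" "X s \<omega> + ?B + \<sigma> * ?w \<omega> = X t \<omega>" by auto
    have "\<bar>?B\<bar> \<le> C * ?\<delta>" using drift_increment_bound[OF \<omega>, of s t] s by auto
    from one_step_expansion[OF _ s(3) this sigma_pos c_pos C_nonneg s(1), of "X s \<omega>" "?w \<omega>", unfolded st]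
    show ?thesis using s unfolding one_step_def Y_def g_def p_def N_def
      by (simp add: algebra_simps)
  qed
  have bdA: "\<bar>indicator A \<omega> * (one_step s t \<omega> - N \<omega>)\<bar> \<le> ?R \<omega>" if \<omega>: "\<omega> \<in> space M" for \<omega>
    using bd[OF \<omega>] order_trans[OF abs_ge_zero bd[OF \<omega>]] by (cases "\<omega> \<in> A") simp_all
  have Ri: "integrable M ?R"
    using increment_integrable_power(2)[OF s(1,2), of 1] increment_integrable_power(2)[OF s(1,2), of 3] by simp
  have ii: "integrable M (\<lambda>\<omega>. indicator A \<omega> * (one_step s t \<omega> - N \<omega>))"
  proof (rule Bochner_Integration.integrable_bound[OF Ri])
    show "(\<lambda>\<omega>. indicator A \<omega> * (one_step s t \<omega> - N \<omega>)) \<in> borel_measurable M"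
      using AM Nm one_step_measurable[of s t] s by auto
    show "AE \<omega> in M. norm (indicator A \<omega> * (one_step s t \<omega> - N \<omega>)) \<le> norm (?R \<omega>)"
      using bdA by (intro AE_I2) (simp only: real_norm_def order_trans[OF _ abs_ge_self])
  qed
  have eq: "indicator A \<omega> * one_step s t \<omega> = indicator A \<omega> * (one_step s t \<omega> - N \<omega>) + indicator A \<omega> * N \<omega>" for \<omega>
    by (simp add: algebra_simps)
  show "integrable M (\<lambda>\<omega>. indicator A \<omega> * one_step s t \<omega>)"
    unfolding eq by (intro Bochner_Integration.integrable_add ii mart)
  have E: "expectation (\<lambda>\<omega>. indicator A \<omega> * one_step s t \<omega>) = expectation (\<lambda>\<omega>. indicator A \<omega> * (one_step s t \<omega> - N \<omega>))"
    by (subst eq, subst Bochner_Integration.integral_add[OF ii mart(1)]) (simp only: mart(2) add_0_right)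
  have "\<bar>expectation (\<lambda>\<omega>. indicator A \<omega> * (one_step s t \<omega> - N \<omega>))\<bar>
      \<le> expectation (\<lambda>\<omega>. \<bar>indicator A \<omega> * (one_step s t \<omega> - N \<omega>)\<bar>)"
    using integral_norm_bound[of M "\<lambda>\<omega>. indicator A \<omega> * (one_step s t \<omega> - N \<omega>)"] by simp
  also have "\<dots> \<le> expectation ?R"
    by (rule integral_mono[OF integrable_abs[OF ii] Ri bdA])
  also have "expectation ?R = D * (?\<delta>\<^sup>2 + ?\<delta> * expectation (\<lambda>\<omega>. \<bar>?w \<omega>\<bar>) + expectation (\<lambda>\<omega>. \<bar>?w \<omega>\<bar> ^ 3))"
    using increment_integrable_power(2)[OF s(1,2), of 1] increment_integrable_power(2)[OF s(1,2), of 3]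
    by (simp add: prob_space)
  \<comment> \<open>Each moment is compared with \<open>?\<delta> * sqrt ?\<delta>\<close>, using
    \<open>?\<delta> \<le> 1\<close> for the square; the weights 1, 1 and 2 add up to the factor
    4.\<close>
  also have "\<dots> \<le> D * (?\<delta> * sqrt ?\<delta> + ?\<delta> * sqrt ?\<delta> + 2 * (?\<delta> * sqrt ?\<delta>))"
  proof (intro mult_left_mono add_mono D_nonneg)
    have "sqrt ?\<delta> * sqrt ?\<delta> \<le> sqrt ?\<delta> * 1" using s by (intro mult_left_mono) auto
    then have "?\<delta> \<le> sqrt ?\<delta>" using s by simp
    then show "?\<delta>\<^sup>2 \<le> ?\<delta> * sqrt ?\<delta>" using s unfolding power2_eq_square by (intro mult_left_mono) auto
    show "expectation (\<lambda>\<omega>. \<bar>?w \<omega>\<bar>) \<le> sqrt ?\<delta>" using increment_abs[OF s(1,2)] .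
    show "expectation (\<lambda>\<omega>. \<bar>?w \<omega>\<bar> ^ 3) \<le> 2 * (?\<delta> * sqrt ?\<delta>)"
      using increment_abs_cube[OF s(1,2)] s by (simp add: power3_eq_cube)
  qed (use s in auto)
  also have "\<dots> = 4 * D * ?\<delta> * sqrt ?\<delta>" by simp
  finally show "\<bar>expectation (\<lambda>\<omega>. indicator A \<omega> * one_step s t \<omega>)\<bar> \<le> 4 * D * ?\<delta> * sqrt ?\<delta>"
    unfolding E .
qed

text \<open>No stochastic integral is needed: the Taylor expansions over a grid of mesh \<open>T / N\<close> have remainders of expectation \<open>O((T / N) powr (3/2))\<close>.\<close>

lemma dynkin:
  assumes T: "T > 0" and \<rho>: "\<And>\<omega>. \<omega> \<in> space M \<Longrightarrow> 0 \<le> \<rho> \<omega> \<and> \<rho> \<omega> \<le> T"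
    and \<rho>_opt: "\<And>t. 0 \<le> t \<Longrightarrow> t < T \<Longrightarrow> {\<omega>\<in>space M. t \<le> \<rho> \<omega>} \<in> sets (Fil t)"
  defines "Q \<equiv> \<lambda>\<omega>. Y (\<rho> \<omega>) \<omega> - f x - (LINT s:{0..\<rho> \<omega>}|lborel. g s \<omega> + p s \<omega> * b s \<omega>)"
  shows "integrable M Q" "expectation Q = 0"
proof -
  let ?t = "\<lambda>N i. T * real i / real N"
  \<comment> \<open>A step is included exactly when the grid point at its left end has not passed
    \<open>\<rho>\<close>. By \<open>\<rho>_opt\<close> this event is known at that grid
    point.\<close>
  define QN where "QN = (\<lambda>N \<omega>. \<Sum>i<N. indicator {\<omega>\<in>space M. ?t N i \<le> \<rho> \<omega>} \<omega> * one_step (?t N i) (?t N (Suc i)) \<omega>)"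
  have grid: "0 \<le> ?t N i" "?t N i < ?t N (Suc i)" "?t N i < T" "?t N (Suc i) \<le> T" "?t N (Suc i) - ?t N i = T / N"
    if "i < N" for i N
  proof -
    have "T * real (Suc i) \<le> T * real N" "T * real i < T * real N"
      using T that by (auto intro!: mult_left_mono)
    then show "0 \<le> ?t N i" "?t N i < ?t N (Suc i)" "?t N i < T" "?t N (Suc i) \<le> T" "?t N (Suc i) - ?t N i = T / N"
      using T that by (auto simp: field_simps)
  qed
  have split: "QN N \<omega> = (\<Sum>i<N. indicator {..\<rho> \<omega>} (?t N i) * (Y (?t N (Suc i)) \<omega> - Y (?t N i) \<omega>))
      - (\<Sum>i<N. indicator {..\<rho> \<omega>} (?t N i) * (g (?t N i) \<omega> * (T / N) + p (?t N i) \<omega> * integral {?t N i..?t N (Suc i)} (\<lambda>s. b s \<omega>)))"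
    if \<omega>: "\<omega> \<in> space M" for N \<omega>
    unfolding QN_def sum_subtractf[symmetric]
  proof (rule sum.cong[OF refl])
    fix i assume "i \<in> {..<N}"
    then have i: "i < N" by simp
    have "integral {?t N i..?t N (Suc i)} (\<lambda>s. b s \<omega>) =
      X (?t N (Suc i)) \<omega> - X (?t N i) \<omega> - \<sigma> * (W (?t N (Suc i)) \<omega> - W (?t N i) \<omega>)"
      using grid[OF i] by (intro X_increment[OF \<omega>]) auto
    then show "indicator {\<omega>\<in>space M. ?t N i \<le> \<rho> \<omega>} \<omega> * one_step (?t N i) (?t N (Suc i)) \<omega> =
      indicator {..\<rho> \<omega>} (?t N i) * (Y (?t N (Suc i)) \<omega> - Y (?t N i) \<omega>) -
      indicator {..\<rho> \<omega>} (?t N i) * (g (?t N i) \<omega> * (T / N) + p (?t N i) \<omega> * integral {?t N i..?t N (Suc i)} (\<lambda>s. b s \<omega>))"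
      using \<omega> unfolding one_step_def grid(5)[OF i] by (auto simp: indicator_def)
  qed
  have lim: "(\<lambda>N. QN N \<omega>) \<longlonglongrightarrow> Q \<omega>" if \<omega>: "\<omega> \<in> space M" for \<omega>
  proof -
    have Y0: "Y 0 \<omega> = f x" by (simp add: Y_def X_0[OF \<omega>])
    show ?thesis unfolding split[OF \<omega>] Q_def Y0[symmetric] using \<rho>[OF \<omega>]
      by (intro tendsto_diff stopped_telescope(1)[OF T] stopped_riemann_sum[OF T, where C = C]
          Ygp_continuous[OF \<omega>] b_measurable[OF \<omega>] b_bound[OF \<omega>]) auto
  qed
  \<comment> \<open>A deterministic bound on all discrete sums: \<open>2 * K\<close> from the
    telescoping part, and the time horizon times the bound on the compensating integrand.\<close>
  define L where "L = 2 * K + T * (\<sigma>\<^sup>2 / 2 * K + c * K + K * C)"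
  have Qbound: "\<bar>QN N \<omega>\<bar> \<le> L" if \<omega>: "\<omega> \<in> space M" for N \<omega>
  proof -
    have 1: "\<bar>\<Sum>i<N. indicator {..\<rho> \<omega>} (?t N i) * (Y (?t N (Suc i)) \<omega> - Y (?t N i) \<omega>)\<bar> \<le> 2 * K"
      using \<rho>[OF \<omega>] by (intro stopped_telescope(2)[OF T] Ygp_continuous[OF \<omega>] Ygp_bound) auto
    have "\<bar>\<Sum>i<N. indicator {..\<rho> \<omega>} (?t N i) * (g (?t N i) \<omega> * (T / N) + p (?t N i) \<omega> * integral {?t N i..?t N (Suc i)} (\<lambda>s. b s \<omega>))\<bar>
        \<le> (\<Sum>i<N. (\<sigma>\<^sup>2 / 2 * K + c * K + K * C) * (T / N))"
    proof (rule order_trans[OF sum_abs], rule sum_mono)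
      fix i assume "i \<in> {..<N}"
      then have i: "i < N" by simp
      let ?I = "integral {?t N i..?t N (Suc i)} (\<lambda>s. b s \<omega>)"
      have "\<bar>?I\<bar> \<le> C * (?t N (Suc i) - ?t N i)"
        using drift_increment_bound[OF \<omega>, of "?t N i" "?t N (Suc i)"] X_increment[OF \<omega>, of "?t N i" "?t N (Suc i)"] grid[OF i]
        by simp
      then have I: "\<bar>?I\<bar> \<le> C * (T / N)" unfolding grid(5)[OF i] .
      have "\<bar>g (?t N i) \<omega> * (T / N)\<bar> \<le> (\<sigma>\<^sup>2 / 2 * K + c * K) * (T / N)"
        using Ygp_bound(2)[OF grid(1)[OF i]] order_trans[OF abs_ge_zero Ygp_bound(2)[OF grid(1)[OF i]]] T
        unfolding abs_mult by (intro mult_mono) auto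
      moreover have "\<bar>p (?t N i) \<omega> * ?I\<bar> \<le> K * (C * (T / N))"
        unfolding abs_mult using Ygp_bound(3)[OF grid(1)[OF i]] K_nonneg by (intro mult_mono I) auto
      ultimately have "\<bar>g (?t N i) \<omega> * (T / N) + p (?t N i) \<omega> * ?I\<bar> \<le> (\<sigma>\<^sup>2 / 2 * K + c * K) * (T / N) + K * (C * (T / N))"
        by linarith
      also have "\<dots> = (\<sigma>\<^sup>2 / 2 * K + c * K + K * C) * (T / N)" by (simp only: distrib_right mult.assoc)
      finally have le: "\<bar>g (?t N i) \<omega> * (T / N) + p (?t N i) \<omega> * ?I\<bar> \<le> (\<sigma>\<^sup>2 / 2 * K + c * K + K * C) * (T / N)" .
      show "\<bar>indicator {..\<rho> \<omega>} (?t N i) * (g (?t N i) \<omega> * (T / N) + p (?t N i) \<omega> * ?I)\<bar>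
          \<le> (\<sigma>\<^sup>2 / 2 * K + c * K + K * C) * (T / N)"
        using order_trans[OF abs_ge_zero le] le by (cases "?t N i \<le> \<rho> \<omega>") auto
    qed
    also have "\<dots> \<le> T * (\<sigma>\<^sup>2 / 2 * K + c * K + K * C)"
      using T K_nonneg C_nonneg c_pos by (cases "N = 0") auto
    finally show ?thesis unfolding split[OF \<omega>] L_def using 1 by linarith
  qed
  have Qm: "QN N \<in> borel_measurable M" for N
    unfolding QN_def
  proof (intro borel_measurable_sum borel_measurable_times borel_measurable_indicator)
    fix i assume "i \<in> {..<N}"
    then have i: "i < N" by simp
    show "{\<omega>\<in>space M. ?t N i \<le> \<rho> \<omega>} \<in> events"
      using \<rho>_opt[OF grid(1)[OF i] grid(3)[OF i]] sets_Fil_subset by blast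
    show "one_step (?t N i) (?t N (Suc i)) \<in> borel_measurable M"
      using grid[OF i] by (intro one_step_measurable) auto
  qed
  have Qmeas: "Q \<in> borel_measurable M"
    by (rule borel_measurable_LIMSEQ_real[where u = QN, OF lim Qm])
  have dom: "integrable M (\<lambda>_. L)" by simp
  note dc = Qmeas Qm dom AE_I2[of M, OF lim] AE_I2[of M, OF Qbound[folded real_norm_def]]
  show "integrable M Q" by (rule integrable_dominated_convergence[OF dc])
  have E: "(\<lambda>N. expectation (QN N)) \<longlonglongrightarrow> expectation Q"
    by (rule integral_dominated_convergence[OF dc])
  have "(\<lambda>N. expectation (QN N)) \<longlonglongrightarrow> 0"
  proof (rule Lim_null_comparison)
    have "(\<lambda>N. T / real N) \<longlonglongrightarrow> 0" by (intro tendsto_divide_0[OF tendsto_const] filterlim_at_top_imp_at_infinity filterlim_real_sequentially)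
    then have "(\<lambda>N. 4 * D * T * sqrt (T / real N)) \<longlonglongrightarrow> 4 * D * T * sqrt 0"
      by (intro tendsto_intros)
    then show "(\<lambda>N. 4 * D * T * sqrt (T / real N)) \<longlonglongrightarrow> 0" by simp
    \<comment> \<open>\<open>N\<close> errors of size \<open>(T / N) * sqrt (T / N)\<close> add up
      to \<open>T * sqrt (T / N)\<close>; \<open>N\<close> beyond \<open>T\<close> ensures that the
      mesh is at most 1, as the one-step estimate requires.\<close>
    show "\<forall>\<^sub>F N in sequentially. norm (expectation (QN N)) \<le> 4 * D * T * sqrt (T / real N)"
    proof (rule eventually_sequentiallyI)
      fix N assume N: "N \<ge> nat \<lceil>T\<rceil> + 1"
      have TN: "T \<le> real N" using N by linarith
      have Np: "N > 0" using N by simp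
      have T1: "T / N \<le> 1" using TN Np by simp
      have stepN: "integrable M (\<lambda>\<omega>. indicator {\<omega>\<in>space M. ?t N i \<le> \<rho> \<omega>} \<omega> * one_step (?t N i) (?t N (Suc i)) \<omega>)"
        "\<bar>expectation (\<lambda>\<omega>. indicator {\<omega>\<in>space M. ?t N i \<le> \<rho> \<omega>} \<omega> * one_step (?t N i) (?t N (Suc i)) \<omega>)\<bar>
          \<le> 4 * D * (T / N) * sqrt (T / N)" if "i < N" for i
        using one_step_expectation[OF grid(1,2)[OF that] _ \<rho>_opt[OF grid(1,3)[OF that]], unfolded grid(5)[OF that], OF T1] by auto
      let ?e = "\<lambda>i. expectation (\<lambda>\<omega>. indicator {\<omega>\<in>space M. ?t N i \<le> \<rho> \<omega>} \<omega> * one_step (?t N i) (?t N (Suc i)) \<omega>)"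
      have sum: "expectation (QN N) = (\<Sum>i<N. ?e i)"
        unfolding QN_def using stepN by (intro Bochner_Integration.integral_sum) auto
      have "\<bar>\<Sum>i<N. ?e i\<bar> \<le> (\<Sum>i<N. 4 * D * (T / N) * sqrt (T / N))"
        using stepN(2) by (intro order_trans[OF sum_abs] sum_mono) auto
      also have "\<dots> = 4 * D * (real N * (T / N)) * sqrt (T / N)"
        by (simp only: sum_constant card_lessThan ac_simps)
      also have "real N * (T / N) = T" using Np by simp
      finally show "norm (expectation (QN N)) \<le> 4 * D * T * sqrt (T / real N)" unfolding sum real_norm_def .
    qed
  qed
  then show "expectation Q = 0" using LIMSEQ_unique[OF E] by simp
qed

end

section \<open>Ruin time and verification\<close>

lemma has_real_derivative_glue:
  assumes u: "\<And>y. y \<ge> 0 \<Longrightarrow> (u has_real_derivative u' y) (at y within {0..})"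
    and w: "\<And>y. y \<le> 0 \<Longrightarrow> (w has_real_derivative w' y) (at y)" and eq: "u 0 = w 0" "u' 0 = w' 0"
  shows "((\<lambda>y. if y \<ge> 0 then u y else w y) has_real_derivative (if y \<ge> 0 then u' y else w' y)) (at (y :: real))"
    (is "(?F has_real_derivative ?F' y) _")
proof -
  consider "y > 0" | "y < 0" | "y = 0" by linarith
  then show ?thesis
  proof cases
    case 1
    have "(?F has_real_derivative u' y) (at y)"
      by (rule has_field_derivative_transform_within[OF DERIV_from_half_line[OF u], where d = y])
        (use 1 in \<open>auto simp: dist_real_def\<close>)
    then show ?thesis using 1 by simp
  next
    case 2
    have "(?F has_real_derivative w' y) (at y)"
      by (rule has_field_derivative_transform_within[OF w, where d = "- y"]) (use 2 in \<open>auto simp: dist_real_def\<close>)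
    then show ?thesis using 2 by simp
  next
    case 3
    have "(?F has_real_derivative u' 0) (at 0 within {0..})"
      by (rule has_field_derivative_transform_within[OF u, where d = 1]) auto
    moreover have "(?F has_real_derivative u' 0) (at 0 within {..0})"
      by (rule has_field_derivative_transform_within[where d = 1, OF has_field_derivative_at_within[OF w[of 0]], folded eq(2)])
        (auto simp: eq)
    ultimately have "(?F has_real_derivative u' 0) (at 0 within {0..} \<union> {..0})"
      unfolding has_field_derivative_iff Lim_within_Un by blast
    moreover have "{0..} \<union> {..0} = (UNIV :: real set)" by auto
    ultimately show ?thesis using 3 by simp
  qed
qed

lemma exp_times_bounds:
  fixes y :: real
  assumes "y \<le> 0"
  shows "\<bar>exp y\<bar> \<le> 1" "\<bar>y * exp y\<bar> \<le> 1" "\<bar>y\<^sup>2 * exp y\<bar> \<le> 2"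
proof -
  have pos: "exp (- y) > 0" by simp
  have "1 + (- y) + (- y)\<^sup>2 / 2 \<le> exp (- y)" using exp_lower_Taylor_quadratic[of "- y"] assms by simp
  then have 2: "y\<^sup>2 \<le> 2 * exp (- y)" using assms by simp
  have 1: "- y \<le> exp (- y)" using exp_ge_add_one_self[of "- y"] by linarith
  show "\<bar>exp y\<bar> \<le> 1" using assms by simp
  have "- y * exp y \<le> exp (- y) * exp y" using 1 by (intro mult_right_mono) auto
  then show "\<bar>y * exp y\<bar> \<le> 1" using assms by (simp add: abs_mult exp_minus)
  have "y\<^sup>2 * exp y \<le> 2 * exp (- y) * exp y" by (rule mult_right_mono[OF 2]) simp
  also have "\<dots> = 2" by (simp add: exp_minus)
  finally show "\<bar>y\<^sup>2 * exp y\<bar> \<le> 2" by (simp only: abs_mult abs_exp_cancel abs_power2)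
qed

text \<open>Dynkin's formula needs a test function on the whole line, as the state becomes negative
  after ruin. To the left of 0 the extension is \<open>exp y\<close> times a quadratic polynomial, a
  family closed under differentiation and bounded for \<open>y \<le> 0\<close>.\<close>

lemma C2_extension:
  assumes v: "\<And>y. y \<ge> 0 \<Longrightarrow> (v has_real_derivative v1 y) (at y within {0..})"
    and v1: "\<And>y. y \<ge> 0 \<Longrightarrow> (v1 has_real_derivative v2 y) (at y within {0..})"
    and bd: "\<And>y. y \<ge> 0 \<Longrightarrow> \<bar>v y\<bar> \<le> K" "\<And>y. y \<ge> 0 \<Longrightarrow> \<bar>v1 y\<bar> \<le> K" "\<And>y. y \<ge> 0 \<Longrightarrow> \<bar>v2 y\<bar> \<le> K"
    and lip: "\<And>y z. y \<ge> 0 \<Longrightarrow> z \<ge> 0 \<Longrightarrow> \<bar>v2 y - v2 z\<bar> \<le> K * \<bar>y - z\<bar>" and v0: "v 0 = 0"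
  obtains f f1 f2 K' where "C2_bounded f f1 f2 K'"
    "\<And>y. y \<ge> 0 \<Longrightarrow> f y = v y" "\<And>y. y \<ge> 0 \<Longrightarrow> f1 y = v1 y" "\<And>y. y \<ge> 0 \<Longrightarrow> f2 y = v2 y"
proof -
  \<comment> \<open>At 0 the function \<open>P 0 \<alpha> \<beta>\<close> has slope
    \<open>\<alpha>\<close> and second derivative \<open>2 * \<alpha> + 2 * \<beta>\<close>; these
    are matched to \<open>v1 0\<close> and \<open>v2 0\<close>.\<close>
  define \<alpha> \<beta> where "\<alpha> = v1 0" and "\<beta> = v2 0 / 2 - v1 0"
  define P where "P = (\<lambda>r s t y. exp y * (r + s * y + t * y\<^sup>2) :: real)"
  have dP: "(P r s t has_real_derivative P (r + s) (s + 2 * t) t y) (at y)" for r s t y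
    unfolding P_def by (auto intro!: derivative_eq_intros simp: algebra_simps)
  have bP: "\<bar>P r s t y\<bar> \<le> \<bar>r\<bar> + \<bar>s\<bar> + 2 * \<bar>t\<bar>" if "y \<le> 0" for r s t y
  proof -
    have "P r s t y = r * exp y + s * (y * exp y) + t * (y\<^sup>2 * exp y)" by (simp add: P_def algebra_simps)
    moreover have "\<bar>r * exp y\<bar> \<le> \<bar>r\<bar> * 1" "\<bar>s * (y * exp y)\<bar> \<le> \<bar>s\<bar> * 1" "\<bar>t * (y\<^sup>2 * exp y)\<bar> \<le> \<bar>t\<bar> * 2"
      unfolding abs_mult[of r] abs_mult[of s] abs_mult[of t] using exp_times_bounds[OF that] by (intro mult_left_mono; simp)+
    ultimately show ?thesis by linarith
  qed
  let ?w = "P 0 \<alpha> \<beta>" and ?w1 = "P \<alpha> (\<alpha> + 2 * \<beta>) \<beta>" and ?w2 = "P (2 * \<alpha> + 2 * \<beta>) (\<alpha> + 4 * \<beta>) \<beta>"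
  let ?w3 = "P (3 * \<alpha> + 6 * \<beta>) (\<alpha> + 6 * \<beta>) \<beta>"
  have dw: "(?w has_real_derivative ?w1 y) (at y)" "(?w1 has_real_derivative ?w2 y) (at y)" "(?w2 has_real_derivative ?w3 y) (at y)" for y
    using dP[of 0 \<alpha> \<beta> y] dP[of \<alpha> "\<alpha> + 2 * \<beta>" \<beta> y] dP[of "2 * \<alpha> + 2 * \<beta>" "\<alpha> + 4 * \<beta>" \<beta> y]
    by (simp_all add: algebra_simps)
  define f where "f = (\<lambda>y. if y \<ge> 0 then v y else ?w y)"
  define f1 where "f1 = (\<lambda>y. if y \<ge> 0 then v1 y else ?w1 y)"
  define f2 where "f2 = (\<lambda>y. if y \<ge> 0 then v2 y else ?w2 y)"
  \<comment> \<open>The largest requirement comes from \<open>?w3\<close>, which is at most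
    \<open>4 * \<bar>\<alpha>\<bar> + 14 * \<bar>\<beta>\<bar>\<close>; 20 is a convenient
    excess.\<close>
  define K' where "K' = K + 20 * (\<bar>\<alpha>\<bar> + \<bar>\<beta>\<bar>)"
  have K0: "K \<ge> 0" using bd(1)[of 0] by simp
  have KK: "K \<le> K'" "K' \<ge> 0" using K0 by (auto simp: K'_def)
  have tri: "\<bar>\<alpha> + 2 * \<beta>\<bar> \<le> \<bar>\<alpha>\<bar> + 2 * \<bar>\<beta>\<bar>" "\<bar>2 * \<alpha> + 2 * \<beta>\<bar> \<le> 2 * \<bar>\<alpha>\<bar> + 2 * \<bar>\<beta>\<bar>"
    "\<bar>\<alpha> + 4 * \<beta>\<bar> \<le> \<bar>\<alpha>\<bar> + 4 * \<bar>\<beta>\<bar>" "\<bar>3 * \<alpha> + 6 * \<beta>\<bar> \<le> 3 * \<bar>\<alpha>\<bar> + 6 * \<bar>\<beta>\<bar>"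
    "\<bar>\<alpha> + 6 * \<beta>\<bar> \<le> \<bar>\<alpha>\<bar> + 6 * \<bar>\<beta>\<bar>"
    by linarith+
  have Kb: "\<bar>?w y\<bar> \<le> K'" "\<bar>?w1 y\<bar> \<le> K'" "\<bar>?w2 y\<bar> \<le> K'" "\<bar>?w3 y\<bar> \<le> K'" if "y \<le> 0" for y
    using bP[OF that, of 0 \<alpha> \<beta>] bP[OF that, of \<alpha> "\<alpha> + 2 * \<beta>" \<beta>] bP[OF that, of "2 * \<alpha> + 2 * \<beta>" "\<alpha> + 4 * \<beta>" \<beta>]
      bP[OF that, of "3 * \<alpha> + 6 * \<beta>" "\<alpha> + 6 * \<beta>" \<beta>] K0 tri abs_ge_zero[of \<alpha>] abs_ge_zero[of \<beta>]
    unfolding K'_def by (smt (verit) distrib_left)+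
  have w0: "?w 0 = 0" "?w1 0 = v1 0" "?w2 0 = v2 0" by (simp_all add: P_def \<alpha>_def \<beta>_def)
  have lipw: "\<bar>?w2 y - ?w2 z\<bar> \<le> K' * \<bar>y - z\<bar>" if "y \<le> 0" "z \<le> 0" for y z
  proof -
    have *: "\<bar>?w2 q - ?w2 p\<bar> \<le> K' * (q - p)" if "p < q" "q \<le> 0" for p q
    proof -
      obtain r where r: "p < r" "r < q" "?w2 q - ?w2 p = (q - p) * ?w3 r"
        using MVT2[OF \<open>p < q\<close>, of ?w2 ?w3] dw(3) by blast
      then show ?thesis using Kb(4)[of r] that by (simp add: abs_mult mult.commute mult_left_mono)
    qed
    consider "y < z" | "z < y" | "y = z" by linarith
    then show ?thesis using *[of y z] *[of z y] that by cases (auto simp: abs_minus_commute)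
  qed
  have lip': "\<bar>f2 y - f2 z\<bar> \<le> K' * (z - y)" if "y \<le> z" for y z
  proof -
    consider "y \<ge> 0" | "y < 0" "z \<le> 0" | "y < 0" "z > 0" by linarith
    then show ?thesis
    proof cases
      case 1
      then have "\<bar>v2 y - v2 z\<bar> \<le> K * \<bar>y - z\<bar>" using that by (intro lip) auto
      also have "\<dots> \<le> K' * \<bar>y - z\<bar>" using KK by (intro mult_right_mono) auto
      finally show ?thesis using 1 that by (simp add: f2_def)
    next
      case 2
      have "f2 z = ?w2 z" using 2 w0 by (cases "z = 0") (auto simp: f2_def)
      then show ?thesis using lipw[of y z] 2 that by (simp add: f2_def)
    next
      case 3
      have "\<bar>?w2 y - ?w2 0\<bar> \<le> K' * \<bar>y - 0\<bar>" using 3 by (intro lipw) auto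
      moreover have "\<bar>v2 0 - v2 z\<bar> \<le> K' * \<bar>0 - z\<bar>"
        using lip[of 0 z] 3 KK by (smt (verit) mult_right_mono)
      ultimately have "\<bar>?w2 y - v2 z\<bar> \<le> K' * \<bar>y - 0\<bar> + K' * \<bar>0 - z\<bar>" using w0(3) by linarith
      also have "\<dots> = K' * (z - y)" using 3 by (simp add: algebra_simps)
      finally show ?thesis using 3 by (simp add: f2_def)
    qed
  qed
  have "C2_bounded f f1 f2 K'"
  proof
    show "(f has_real_derivative f1 y) (at y)" for y
      unfolding f_def f1_def by (rule has_real_derivative_glue) (use v dw w0 v0 in auto)
    show "(f1 has_real_derivative f2 y) (at y)" for y
      unfolding f1_def f2_def by (rule has_real_derivative_glue) (use v1 dw w0 v0 in auto)
    show "\<bar>f y\<bar> \<le> K'" "\<bar>f1 y\<bar> \<le> K'" "\<bar>f2 y\<bar> \<le> K'" for y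
      using Kb[of y] bd[of y] KK unfolding f_def f1_def f2_def by (auto intro: order_trans)
    show "\<bar>f2 y - f2 z\<bar> \<le> K' * \<bar>y - z\<bar>" for y z
      using lip'[of y z] lip'[of z y] by (cases "y \<le> z") (auto simp: abs_minus_commute)
  qed
  then show thesis by (rule that) (auto simp: f_def f1_def f2_def)
qed

lemma measurable_restrict_Icc_clamp:
  fixes H :: "real \<Rightarrow> 'a \<Rightarrow> real"
  assumes "(\<lambda>(s, \<omega>). H s \<omega>) \<in> borel_measurable (restrict_space lborel {0..T} \<Otimes>\<^sub>M N)" "T \<ge> 0"
  shows "(\<lambda>(\<omega>, s). H (max 0 (min T s)) \<omega>) \<in> borel_measurable (N \<Otimes>\<^sub>M lborel)"
proof -
  have "(\<lambda>(\<omega>, s). (max 0 (min T s), \<omega>)) \<in> N \<Otimes>\<^sub>M lborel \<rightarrow>\<^sub>M restrict_space lborel {0..T} \<Otimes>\<^sub>M N"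
    unfolding split_beta using assms(2)
    by (intro measurable_Pair measurable_restrict_space2 measurable_snd) (auto simp: Pi_iff)
  from measurable_compose[OF this assms(1)] show ?thesis by (simp add: split_beta)
qed

section \<open>Ruin as an optional time, and the two verification inequalities\<close>

context ito_process
begin

abbreviation "\<tau> \<equiv> ruin_time X"

definition stop :: "real \<Rightarrow> 'a \<Rightarrow> real" where
  "stop T \<omega> = real_of_ereal (min (\<tau> \<omega>) (ereal T))"

lemma ruin_time_nonneg: "0 \<le> \<tau> \<omega>"
  unfolding ruin_time_def by (rule Inf_greatest) auto

lemma before_ruin: "0 \<le> x \<Longrightarrow> \<omega> \<in> space M \<Longrightarrow> 0 \<le> t \<Longrightarrow> ereal t < \<tau> \<omega> \<Longrightarrow> 0 \<le> X t \<omega>"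
proof (cases "t = 0")
  case False
  assume t: "0 \<le> t" "ereal t < \<tau> \<omega>"
  show "0 \<le> X t \<omega>"
  proof (rule ccontr)
    assume "\<not> 0 \<le> X t \<omega>"
    then have "\<tau> \<omega> \<le> ereal t" unfolding ruin_time_def using False t by (intro Inf_lower) auto
    then show False using t by simp
  qed
qed (simp add: X_0)

lemma ruin_before_iff: "\<tau> \<omega> < ereal t \<longleftrightarrow> (\<exists>s. 0 < s \<and> s < t \<and> X s \<omega> < 0)"
  unfolding ruin_time_def Inf_less_iff by auto

text \<open>Continuity gives both inequalities: negative values occur arbitrarily soon after the
  ruin time, none before it. Together with \<open>v 0 = 0\<close> this removes the boundary term in
  the verification.\<close>

lemma at_ruin:
  assumes x: "0 \<le> x" and \<omega>: "\<omega> \<in> space M" and r: "\<tau> \<omega> = ereal r"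
  shows "X r \<omega> = 0"
proof (rule antisym)
  have r0: "r \<ge> 0" using ruin_time_nonneg[of \<omega>] r by simp
  have cont: "continuous_on {0..} (\<lambda>t. X t \<omega>)" by (rule X_continuous[OF \<omega>])
  show "X r \<omega> \<le> 0"
  proof (rule ccontr)
    assume "\<not> X r \<omega> \<le> 0"
    then obtain d where d: "d > 0" "\<And>t. t \<ge> 0 \<Longrightarrow> dist t r < d \<Longrightarrow> dist (X t \<omega>) (X r \<omega>) < X r \<omega>"
      using cont r0 unfolding continuous_on_iff by (metis atLeast_iff not_le)
    have "\<tau> \<omega> < ereal (r + d)" using r d by simp
    then obtain s where s: "0 < s" "s < r + d" "X s \<omega> < 0" unfolding ruin_before_iff by blast
    have "\<tau> \<omega> \<le> ereal s" unfolding ruin_time_def using s by (intro Inf_lower) auto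
    then have "dist (X s \<omega>) (X r \<omega>) < X r \<omega>" using r s by (intro d) (auto simp: dist_real_def)
    then show False using s by (simp add: dist_real_def)
  qed
  show "0 \<le> X r \<omega>"
  proof (cases "r = 0")
    case True then show ?thesis using X_0[OF \<omega>] x by simp
  next
    case False
    show ?thesis
    proof (rule ccontr)
      assume "\<not> 0 \<le> X r \<omega>"
      then obtain d where d: "d > 0" "\<And>t. t \<ge> 0 \<Longrightarrow> dist t r < d \<Longrightarrow> dist (X t \<omega>) (X r \<omega>) < - X r \<omega>"
        using cont r0 unfolding continuous_on_iff by (metis atLeast_iff not_le neg_0_less_iff_less)
      define t where "t = max (r / 2) (r - d / 2)"
      have t: "t \<ge> 0" "t < r" "dist t r < d" using False r0 d(1) by (auto simp: t_def dist_real_def)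
      have "dist (X t \<omega>) (X r \<omega>) < - X r \<omega>" using t by (intro d)
      moreover have "0 \<le> X t \<omega>" using t r by (intro before_ruin[OF x \<omega>]) auto
      ultimately show False by (simp add: dist_real_def)
    qed
  qed
qed

text \<open>The negative half-line is open, so by continuity ruin before \<open>t\<close> is already
  witnessed at a rational time before \<open>t\<close>, where the state is measurable with respect
  to \<open>Fil t\<close>. This is the form of optionality that \<open>dynkin\<close> asks
  for.\<close>

lemma ruin_optional: "0 \<le> t \<Longrightarrow> {\<omega>\<in>space M. ereal t \<le> \<tau> \<omega>} \<in> sets (Fil t)"
proof -
  assume t: "0 \<le> t"
  let ?S = "{q \<in> \<rat>. 0 < q \<and> q < t}"
  have "{\<omega>\<in>space M. ereal t \<le> \<tau> \<omega>} = {\<omega>\<in>space (Fil t). \<forall>q\<in>?S. X q \<omega> \<ge> 0}"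
  proof (intro Collect_cong conj_cong)
    fix \<omega> assume \<omega>: "\<omega> \<in> space (Fil t)"
    have "(\<exists>s. 0 < s \<and> s < t \<and> X s \<omega> < 0) \<longleftrightarrow> (\<exists>q\<in>?S. X q \<omega> < 0)"
    proof
      assume "\<exists>s. 0 < s \<and> s < t \<and> X s \<omega> < 0"
      then obtain s where s: "0 < s" "s < t" "X s \<omega> < 0" by blast
      then obtain d where d: "d > 0" "\<And>r. r \<ge> 0 \<Longrightarrow> dist r s < d \<Longrightarrow> dist (X r \<omega>) (X s \<omega>) < - X s \<omega>"
        using X_continuous[of \<omega>] \<omega> unfolding continuous_on_iff
        by (metis atLeast_iff neg_0_less_iff_less less_imp_le space_Fil)
      obtain q where q: "q \<in> \<rat>" "s < q" "q < min t (s + d)"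
        using Rats_dense_in_real[of s "min t (s + d)"] s d by auto
      then have "dist (X q \<omega>) (X s \<omega>) < - X s \<omega>" using s by (intro d) (auto simp: dist_real_def)
      then have "X q \<omega> < 0" by (simp add: dist_real_def)
      then show "\<exists>q\<in>?S. X q \<omega> < 0" using q s by auto
    qed auto
    then show "ereal t \<le> \<tau> \<omega> \<longleftrightarrow> (\<forall>q\<in>?S. X q \<omega> \<ge> 0)"
      using ruin_before_iff[of \<omega> t] by (meson not_le)
  qed simp
  moreover have "{\<omega>\<in>space (Fil t). \<forall>q\<in>?S. X q \<omega> \<ge> 0} \<in> sets (Fil t)"
  proof (rule sets.sets_Collect_countable_All')
    show "countable ?S" using countable_rat by (rule countable_subset[rotated]) auto
    show "{\<omega> \<in> space (Fil t). X q \<omega> \<ge> 0} \<in> sets (Fil t)" if "q \<in> ?S" for q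
    proof -
      have "X q \<in> borel_measurable (Fil t)"
        using that by (intro measurable_Fil_mono[OF X_adapted]) auto
      then show ?thesis by measurable
    qed
  qed
  ultimately show ?thesis by simp
qed

context
  fixes T :: real assumes T: "T > 0"
begin

lemma stop_bounds: "0 \<le> stop T \<omega>" "stop T \<omega> \<le> T"
  using ruin_time_nonneg[of \<omega>] T unfolding stop_def by (cases "\<tau> \<omega>"; auto simp: min_def)+

lemma less_stop_iff: "t < T \<Longrightarrow> t < stop T \<omega> \<longleftrightarrow> ereal t < \<tau> \<omega>"
  using ruin_time_nonneg[of \<omega>] T unfolding stop_def by (cases "\<tau> \<omega>") (auto simp: min_def)

lemma le_stop_iff: "t \<le> T \<Longrightarrow> t \<le> stop T \<omega> \<longleftrightarrow> ereal t \<le> \<tau> \<omega>"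
  using ruin_time_nonneg[of \<omega>] T unfolding stop_def by (cases "\<tau> \<omega>") (auto simp: min_def)

lemma stop_cases: obtains "stop T \<omega> = T" | "\<tau> \<omega> = ereal (stop T \<omega>)"
proof -
  have "stop T \<omega> = T \<or> \<tau> \<omega> = ereal (stop T \<omega>)"
    using ruin_time_nonneg[of \<omega>] T unfolding stop_def by (cases "\<tau> \<omega>") (auto simp: min_def)
  then show thesis using that by blast
qed

lemma stop_optional: "0 \<le> t \<Longrightarrow> t < T \<Longrightarrow> {\<omega>\<in>space M. t \<le> stop T \<omega>} \<in> sets (Fil t)"
  using ruin_optional[of t] by (simp add: le_stop_iff)

lemma stop_measurable: "stop T \<in> borel_measurable M"
  unfolding borel_measurable_iff_ge
proof
  fix a
  consider "a \<le> 0" | "0 < a" "a \<le> T" | "T < a" by linarith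
  then show "{\<omega>\<in>space M. a \<le> stop T \<omega>} \<in> events"
  proof cases
    case 1
    then have "{\<omega>\<in>space M. a \<le> stop T \<omega>} = space M" using order_trans[OF _ stop_bounds(1)] by blast
    then show ?thesis by simp
  next
    case 2
    then show ?thesis using ruin_optional[of a] sets_Fil_subset[of a] by (auto simp: le_stop_iff)
  next
    case 3
    then have e: "{\<omega>\<in>space M. a \<le> stop T \<omega>} = {}" using order_trans[OF _ stop_bounds(2)] by (auto dest: leD)
    show ?thesis unfolding e by simp
  qed
qed

end


text \<open>Dynkin's formula up to ruin or a finite horizon turns the generator inequality into a
  bound on the expected reward, with an error that decays like the discount factor. The horizon is
  then removed by dominated convergence, with the integrability \<open>H_fin\<close> as
  domination.\<close>

lemma verification_upper:
  assumes x: "x \<ge> 0" and c: "c > 0"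
    and v: "\<And>y. y \<ge> 0 \<Longrightarrow> (v has_real_derivative v1 y) (at y within {0..})"
    and v1: "\<And>y. y \<ge> 0 \<Longrightarrow> (v1 has_real_derivative v2 y) (at y within {0..})"
    and bd: "\<And>y. y \<ge> 0 \<Longrightarrow> \<bar>v y\<bar> \<le> K" "\<And>y. y \<ge> 0 \<Longrightarrow> \<bar>v1 y\<bar> \<le> K" "\<And>y. y \<ge> 0 \<Longrightarrow> \<bar>v2 y\<bar> \<le> K"
    and lip: "\<And>y z. y \<ge> 0 \<Longrightarrow> z \<ge> 0 \<Longrightarrow> \<bar>v2 y - v2 z\<bar> \<le> K * \<bar>y - z\<bar>" and v0: "v 0 = 0"
    and H_meas: "\<And>T. T \<ge> 0 \<Longrightarrow> (\<lambda>(s, \<omega>). H s \<omega>) \<in> borel_measurable (restrict_space lborel {0..T} \<Otimes>\<^sub>M M)"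
    and H_fin: "(\<integral>\<^sup>+ \<omega>. (\<integral>\<^sup>+ t. indicator {t. 0 \<le> t \<and> ereal t < \<tau> \<omega>} t
                     * ennreal (exp (- c * t) * \<bar>H t \<omega>\<bar>) \<partial>lborel) \<partial>M) < \<infinity>"
    and H_le: "\<And>\<omega> s. \<omega> \<in> space M \<Longrightarrow> 0 \<le> s \<Longrightarrow> ereal s < \<tau> \<omega> \<Longrightarrow>
      H s \<omega> \<le> - (\<sigma>\<^sup>2 / 2 * v2 (X s \<omega>) + b s \<omega> * v1 (X s \<omega>) - c * v (X s \<omega>))"
  shows "(\<integral>\<omega>. (LINT t:{t. 0 \<le> t \<and> ereal t < \<tau> \<omega>}|lborel. exp (- c * t) * H t \<omega>) \<partial>M) \<le> v x"
proof -
  obtain f f1 f2 K' where C2: "C2_bounded f f1 f2 K'"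
    and ext: "\<And>y. y \<ge> 0 \<Longrightarrow> f y = v y" "\<And>y. y \<ge> 0 \<Longrightarrow> f1 y = v1 y" "\<And>y. y \<ge> 0 \<Longrightarrow> f2 y = v2 y"
    using C2_extension[OF v v1 bd lip v0] by metis
  interpret C2_bounded f f1 f2 K' by (rule C2)
  interpret ito_test M W \<sigma> x C b f f1 f2 K' c
    by standard (rule c)
  interpret P: pair_sigma_finite M lborel
    by (intro pair_sigma_finite.intro) (auto intro: sigma_finite_measure_axioms sigma_finite_lborel)
  define h where "h = (\<lambda>(\<omega>, t). if 0 \<le> t \<and> ereal t < \<tau> \<omega> then exp (- c * t) * H t \<omega> else 0)"
  \<comment> \<open>\<open>Suc N\<close> is a positive horizon. Below it the reward may be evaluated
    at a clamped time, which yields measurability on the full product space.\<close>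
  define hN where "hN = (\<lambda>N (\<omega>, t). if 0 \<le> t \<and> t < stop (real (Suc N)) \<omega> then exp (- c * t) * H t \<omega> else 0)"
  have hN_meas: "hN N \<in> borel_measurable (M \<Otimes>\<^sub>M lborel)" for N
  proof -
    let ?T = "real (Suc N)"
    have T: "?T > 0" by simp
    have [measurable]: "stop ?T \<in> borel_measurable M" by (rule stop_measurable[OF T])
    have [measurable]: "(\<lambda>q. H (max 0 (min ?T (snd q))) (fst q)) \<in> borel_measurable (M \<Otimes>\<^sub>M lborel)"
      using measurable_restrict_Icc_clamp[OF H_meas, of ?T] by (simp add: split_beta)
    have "(\<lambda>q. if 0 \<le> snd q \<and> snd q < stop ?T (fst q) then exp (- c * snd q) * H (max 0 (min ?T (snd q))) (fst q) else 0)
      \<in> borel_measurable (M \<Otimes>\<^sub>M lborel)" by measurable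
    moreover have "hN N q = (if 0 \<le> snd q \<and> snd q < stop ?T (fst q) then exp (- c * snd q) * H (max 0 (min ?T (snd q))) (fst q) else 0)" for q
      using stop_bounds(2)[OF T, of "fst q"] by (auto simp: hN_def split_beta max_def min_def)
    ultimately show ?thesis by presburger
  qed
  have lim: "(\<lambda>N. hN N q) \<longlonglongrightarrow> h q" for q
  proof (rule tendsto_eventually, rule eventually_sequentiallyI)
    fix N assume "N \<ge> nat \<lceil>snd q\<rceil>"
    then have "snd q < real (Suc N)" by linarith
    then show "hN N q = h q" using less_stop_iff[of "real (Suc N)" "snd q" "fst q"]
      by (simp add: hN_def h_def split_beta)
  qed
  have h_meas: "h \<in> borel_measurable (M \<Otimes>\<^sub>M lborel)"
    by (rule borel_measurable_LIMSEQ_real[where u = hN, OF lim hN_meas])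
  have h_int: "integrable (M \<Otimes>\<^sub>M lborel) h"
  proof (rule integrableI_bounded[OF h_meas])
    have "(\<integral>\<^sup>+ q. ennreal (norm (h q)) \<partial>(M \<Otimes>\<^sub>M lborel)) = (\<integral>\<^sup>+ \<omega>. (\<integral>\<^sup>+ t. ennreal (norm (h (\<omega>, t))) \<partial>lborel) \<partial>M)"
      by (intro lborel.nn_integral_fst[symmetric] measurable_compose[OF h_meas]) measurable
    also have "\<dots> = (\<integral>\<^sup>+ \<omega>. (\<integral>\<^sup>+ t. indicator {t. 0 \<le> t \<and> ereal t < \<tau> \<omega>} t
                     * ennreal (exp (- c * t) * \<bar>H t \<omega>\<bar>) \<partial>lborel) \<partial>M)"
      by (intro nn_integral_cong) (auto simp: h_def abs_mult)
    finally show "(\<integral>\<^sup>+ q. ennreal (norm (h q)) \<partial>(M \<Otimes>\<^sub>M lborel)) < \<infinity>" using H_fin by simp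
  qed
  have hN_le: "norm (hN N q) \<le> norm (h q)" for N q
    using less_stop_iff[of "real (Suc N)" "snd q" "fst q"] stop_bounds(2)[of "real (Suc N)" "fst q"]
    by (auto simp: hN_def h_def split_beta)
  have hN_int: "integrable (M \<Otimes>\<^sub>M lborel) (hN N)" for N
    using hN_le by (intro Bochner_Integration.integrable_bound[OF h_int hN_meas]) auto
  have J: "(\<integral>\<omega>. (LINT t:{t. 0 \<le> t \<and> ereal t < \<tau> \<omega>}|lborel. exp (- c * t) * H t \<omega>) \<partial>M) = integral\<^sup>L (M \<Otimes>\<^sub>M lborel) h"
    unfolding P.integral_fst'[OF h_int, symmetric] set_lebesgue_integral_def
    by (intro Bochner_Integration.integral_cong) (auto simp: h_def)
  have le: "integral\<^sup>L (M \<Otimes>\<^sub>M lborel) (hN N) \<le> v x + exp (- c * real (Suc N)) * K'" for N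
  proof -
    let ?T = "real (Suc N)"
    have T: "?T > 0" by simp
    let ?I = "\<lambda>\<omega>. LINT s:{0..stop ?T \<omega>}|lborel. g s \<omega> + p s \<omega> * b s \<omega>"
    let ?Q = "\<lambda>\<omega>. Y (stop ?T \<omega>) \<omega> - f x - ?I \<omega>"
    note dyn = dynkin[OF T, of "stop ?T", OF _ stop_optional[OF T]]
    have Q: "integrable M ?Q" "expectation ?Q = 0"
      using dyn stop_bounds[OF T] by auto
    have Yle: "\<bar>Y (stop ?T \<omega>) \<omega>\<bar> \<le> exp (- c * ?T) * K'" if \<omega>: "\<omega> \<in> space M" for \<omega>
    proof (cases rule: stop_cases[OF T, of \<omega>])
      \<comment> \<open>At the horizon the factor \<open>exp (- c * ?T)\<close> remains; in the
        other case ruin has occurred and the state is 0.\<close>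
      case 1
      then show ?thesis using bounds(1)[of "X ?T \<omega>"] by (simp add: Y_def abs_mult)
    next
      case 2
      then have "X (stop ?T \<omega>) \<omega> = 0" by (rule at_ruin[OF x \<omega>])
      then show ?thesis using ext(1)[of 0] v0 K_nonneg by (simp add: Y_def)
    qed
    \<comment> \<open>Fubini provides the integrability \<open>i\<close> for almost every path only,
      so the pathwise bound is stated under it and integrated by
      \<open>integral_mono_AE\<close>.\<close>
    have pw: "(\<integral>t. hN N (\<omega>, t) \<partial>lborel) \<le> v x + exp (- c * ?T) * K' + ?Q \<omega>"
      if \<omega>: "\<omega> \<in> space M" and i: "integrable lborel (\<lambda>t. hN N (\<omega>, t))" for \<omega>
    proof -
      let ?q = "\<lambda>s. g s \<omega> + p s \<omega> * b s \<omega>"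
      have "\<bar>?q s\<bar> \<le> \<sigma>\<^sup>2 / 2 * K' + c * K' + K' * C" if "s \<in> {0..stop ?T \<omega>}" for s
      proof -
        have s: "s \<ge> 0" using that by simp
        have "\<bar>p s \<omega> * b s \<omega>\<bar> \<le> K' * C" unfolding abs_mult
          using Ygp_bound(3)[OF s] b_bound[OF \<omega> s] K_nonneg by (intro mult_mono) auto
        then show ?thesis using Ygp_bound(2)[OF s, of \<omega>] by linarith
      qed
      then have "set_integrable lborel {0..stop ?T \<omega>} ?q"
        by (intro set_integrable_bounded_Icc[OF set_borel_measurable_affine] Ygp_continuous \<omega> b_measurable) auto
      then have qi: "integrable lborel (\<lambda>s. indicator {0..stop ?T \<omega>} s * ?q s)" by (simp add: set_integrable_def)
      have "(\<integral>t. hN N (\<omega>, t) \<partial>lborel) \<le> (\<integral>t. - (indicator {0..stop ?T \<omega>} t * ?q t) \<partial>lborel)"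
      proof (rule integral_mono_AE[OF i])
        show "integrable lborel (\<lambda>t. - (indicator {0..stop ?T \<omega>} t * ?q t))" using qi by simp
        \<comment> \<open>The reward is cut off before the stopping time while the integral in
          Dynkin's formula includes it; the endpoint is a null set.\<close>
        have "AE t in lborel. t \<noteq> stop ?T \<omega>" by (rule AE_lborel_singleton)
        then show "AE t in lborel. hN N (\<omega>, t) \<le> - (indicator {0..stop ?T \<omega>} t * ?q t)"
        proof eventually_elim
          case (elim t)
          show ?case
          proof (cases "0 \<le> t \<and> t < stop ?T \<omega>")
            case True
            then have t: "0 \<le> t" "t < ?T" using stop_bounds(2)[OF T, of \<omega>] by auto
            then have tt: "ereal t < \<tau> \<omega>" using less_stop_iff[OF T t(2), of \<omega>] True by simp
            have X0: "X t \<omega> \<ge> 0" by (rule before_ruin[OF x \<omega> t(1) tt])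
            have "exp (- c * t) * H t \<omega> \<le> exp (- c * t) * (- (\<sigma>\<^sup>2 / 2 * v2 (X t \<omega>) + b t \<omega> * v1 (X t \<omega>) - c * v (X t \<omega>)))"
              by (intro mult_left_mono H_le \<omega> t tt) simp
            also have "\<dots> = - ?q t" using ext[OF X0] by (simp add: g_def p_def algebra_simps)
            finally show ?thesis using True by (simp add: hN_def)
          next
            case False
            then show ?thesis using elim by (auto simp: hN_def indicator_def)
          qed
        qed
      qed
      also have "\<dots> = - ?I \<omega>" by (simp add: set_lebesgue_integral_def)
      also have "\<dots> \<le> v x + exp (- c * ?T) * K' + ?Q \<omega>"
        using Yle[OF \<omega>] ext(1)[OF x] by (simp add: abs_le_iff)
      finally show ?thesis .
    qed
    have "(\<integral>\<omega>. (\<integral>t. hN N (\<omega>, t) \<partial>lborel) \<partial>M) \<le> (\<integral>\<omega>. v x + exp (- c * ?T) * K' + ?Q \<omega> \<partial>M)"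
    proof (rule integral_mono_AE)
      show "integrable M (\<lambda>\<omega>. \<integral>t. hN N (\<omega>, t) \<partial>lborel)" by (rule P.integrable_fst'[OF hN_int])
      show "integrable M (\<lambda>\<omega>. v x + exp (- c * ?T) * K' + ?Q \<omega>)"
        by (rule Bochner_Integration.integrable_add[OF integrable_const Q(1)])
      show "AE \<omega> in M. (\<integral>t. hN N (\<omega>, t) \<partial>lborel) \<le> v x + exp (- c * ?T) * K' + ?Q \<omega>"
        using P.AE_integrable_fst'[OF hN_int[of N]] AE_space by eventually_elim (rule pw)
    qed
    also have "\<dots> = v x + exp (- c * ?T) * K'"
      using Q(2) by (subst Bochner_Integration.integral_add[OF integrable_const Q(1)]) (simp only: Q(2), simp add: prob_space)
    finally show ?thesis unfolding P.integral_fst'[OF hN_int] .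
  qed
  have lim1: "(\<lambda>N. integral\<^sup>L (M \<Otimes>\<^sub>M lborel) (hN N)) \<longlonglongrightarrow> integral\<^sup>L (M \<Otimes>\<^sub>M lborel) h"
    using lim hN_le by (intro integral_dominated_convergence[where w = "\<lambda>q. norm (h q)"] h_meas hN_meas integrable_norm h_int) auto
  have lim2: "(\<lambda>N. v x + exp (- c * real (Suc N)) * K') \<longlonglongrightarrow> v x + 0 * K'"
  proof (intro tendsto_add tendsto_const tendsto_mult)
    have "(\<lambda>N. exp (- c) ^ Suc N) \<longlonglongrightarrow> 0"
      using c by (intro LIMSEQ_Suc LIMSEQ_realpow_zero) auto
    then show "(\<lambda>N. exp (- c * real (Suc N))) \<longlonglongrightarrow> 0"
      by (simp only: exp_of_nat_mult[symmetric] mult.commute)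
  qed
  show ?thesis unfolding J using LIMSEQ_le[OF lim1 lim2] le by auto
qed

text \<open>The hypotheses on the regularity of \<open>v\<close> and on \<open>H\<close> are
  symmetric under a change of sign, so the upper inequality is applied to \<open>- v\<close> and
  \<open>- H\<close>.\<close>

lemma verification_lower:
  assumes x: "x \<ge> 0" and c: "c > 0"
    and v: "\<And>y. y \<ge> 0 \<Longrightarrow> (v has_real_derivative v1 y) (at y within {0..})"
    and v1: "\<And>y. y \<ge> 0 \<Longrightarrow> (v1 has_real_derivative v2 y) (at y within {0..})"
    and bd: "\<And>y. y \<ge> 0 \<Longrightarrow> \<bar>v y\<bar> \<le> K" "\<And>y. y \<ge> 0 \<Longrightarrow> \<bar>v1 y\<bar> \<le> K" "\<And>y. y \<ge> 0 \<Longrightarrow> \<bar>v2 y\<bar> \<le> K"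
    and lip: "\<And>y z. y \<ge> 0 \<Longrightarrow> z \<ge> 0 \<Longrightarrow> \<bar>v2 y - v2 z\<bar> \<le> K * \<bar>y - z\<bar>" and v0: "v 0 = 0"
    and H_meas: "\<And>T. T \<ge> 0 \<Longrightarrow> (\<lambda>(s, \<omega>). H s \<omega>) \<in> borel_measurable (restrict_space lborel {0..T} \<Otimes>\<^sub>M M)"
    and H_fin: "(\<integral>\<^sup>+ \<omega>. (\<integral>\<^sup>+ t. indicator {t. 0 \<le> t \<and> ereal t < \<tau> \<omega>} t
                     * ennreal (exp (- c * t) * \<bar>H t \<omega>\<bar>) \<partial>lborel) \<partial>M) < \<infinity>"
    and H_ge: "\<And>\<omega> s. \<omega> \<in> space M \<Longrightarrow> 0 \<le> s \<Longrightarrow> ereal s < \<tau> \<omega> \<Longrightarrow>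
      - (\<sigma>\<^sup>2 / 2 * v2 (X s \<omega>) + b s \<omega> * v1 (X s \<omega>) - c * v (X s \<omega>)) \<le> H s \<omega>"
  shows "v x \<le> (\<integral>\<omega>. (LINT t:{t. 0 \<le> t \<and> ereal t < \<tau> \<omega>}|lborel. exp (- c * t) * H t \<omega>) \<partial>M)"
proof -
  have "(\<integral>\<omega>. (LINT t:{t. 0 \<le> t \<and> ereal t < \<tau> \<omega>}|lborel. exp (- c * t) * - H t \<omega>) \<partial>M) \<le> - v x"
  proof (rule verification_upper[OF x c, where ?v1.0 = "\<lambda>y. - v1 y" and ?v2.0 = "\<lambda>y. - v2 y" and K = K])
    show "(\<lambda>(s, \<omega>). - H s \<omega>) \<in> borel_measurable (restrict_space lborel {0..T} \<Otimes>\<^sub>M M)" if "T \<ge> 0" for T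
      using borel_measurable_uminus[OF H_meas[OF that]] by (simp add: split_beta')
    show "- H s \<omega> \<le> - (\<sigma>\<^sup>2 / 2 * - v2 (X s \<omega>) + b s \<omega> * - v1 (X s \<omega>) - c * - v (X s \<omega>))"
      if "\<omega> \<in> space M" "0 \<le> s" "ereal s < \<tau> \<omega>" for \<omega> s
      using H_ge[OF that] by (simp add: algebra_simps)
    show "\<bar>- v2 y - - v2 z\<bar> \<le> K * \<bar>y - z\<bar>" if "y \<ge> 0" "z \<ge> 0" for y z
      using lip[OF that] by (simp add: abs_minus_commute)
  qed (use v v1 bd v0 H_fin in \<open>auto intro!: derivative_eq_intros\<close>)
  then show ?thesis by (simp add: set_lebesgue_integral_def)
qed

end

section \<open>Open-loop controls\<close>

lemma borel_measurable_set_integral: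
  fixes f :: "'b \<Rightarrow> real \<Rightarrow> real"
  assumes f: "(\<lambda>(q, w). f q w) \<in> borel_measurable (N \<Otimes>\<^sub>M restrict_space lborel A)" and A: "A \<in> sets borel"
  shows "(\<lambda>q. LINT w:A|lborel. f q w) \<in> borel_measurable N"
proof -
  interpret R: sigma_finite_measure "restrict_space lborel A"
    using A by (intro sigma_finite_measure_restrict_space sigma_finite_lborel) auto
  have "(\<lambda>q. \<integral>w. f q w \<partial>restrict_space lborel A) \<in> borel_measurable N"
    by (rule R.borel_measurable_lebesgue_integral[OF f])
  then show ?thesis using A by (simp add: integral_restrict_space set_lebesgue_integral_def)
qed

lemma borel_measurable_exchange:
  "(\<lambda>(s, q). f s q) \<in> borel_measurable (A \<Otimes>\<^sub>M B) \<Longrightarrow> (\<lambda>(q, s). f s q) \<in> borel_measurable (B \<Otimes>\<^sub>M A)"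
proof -
  assume "(\<lambda>(s, q). f s q) \<in> borel_measurable (A \<Otimes>\<^sub>M B)"
  from measurable_compose[OF measurable_pair_swap' this] show ?thesis by (simp add: split_beta')
qed

context brownian
begin

text \<open>The process is the limit of its values on grids of mesh \<open>1 / n\<close> to the left of the current time.\<close>

lemma progressive_of_continuous:
  assumes cont: "\<And>\<omega>. \<omega> \<in> space M \<Longrightarrow> continuous_on {0..} (\<lambda>t. Z t \<omega>)"
    and adapted: "\<And>t. 0 \<le> t \<Longrightarrow> Z t \<in> borel_measurable (Fil t)" and T: "0 \<le> T"
  shows "(\<lambda>(s, \<omega>). Z s \<omega> :: real) \<in> borel_measurable (restrict_space lborel {0..T} \<Otimes>\<^sub>M Fil T)"
proof -
  let ?N = "restrict_space lborel {0..T} \<Otimes>\<^sub>M Fil T"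
  \<comment> \<open>Clamping to \<open>{0..T}\<close> keeps the sampled values measurable with
    respect to \<open>Fil T\<close>; the sampling times for a fixed \<open>n\<close> range over a
    countable set.\<close>
  define r where "r = (\<lambda>n (i::int). max 0 (min T (real_of_int i / real (Suc n))))"
  have rT: "0 \<le> r n i" "r n i \<le> T" for n i using T by (auto simp: r_def)
  show ?thesis
  proof (rule borel_measurable_LIMSEQ_real[where u = "\<lambda>n q. Z (r n \<lfloor>real (Suc n) * fst q\<rfloor>) (snd q)"])
    fix n
    show "(\<lambda>q. Z (r n \<lfloor>real (Suc n) * fst q\<rfloor>) (snd q)) \<in> borel_measurable ?N"
    proof (rule measurable_compose_countable[where f = "\<lambda>i q. Z (r n i) (snd q)"])
      show "(\<lambda>q. Z (r n i) (snd q)) \<in> borel_measurable ?N" for i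
        by (rule measurable_compose[OF measurable_snd measurable_Fil_mono[OF adapted[OF rT(1)] rT(2)]])
      have "fst \<in> ?N \<rightarrow>\<^sub>M borel"
        using measurable_compose[OF measurable_fst, of "\<lambda>s. s" "restrict_space lborel {0..T}" borel "Fil T"]
        by (simp add: measurable_restrict_space1)
      then show "(\<lambda>q. \<lfloor>real (Suc n) * fst q\<rfloor>) \<in> ?N \<rightarrow>\<^sub>M count_space UNIV" by measurable
    qed
  next
    fix q assume "q \<in> space ?N"
    then have q: "0 \<le> fst q" "fst q \<le> T" "snd q \<in> space M"
      by (auto simp: space_pair_measure space_restrict_space)
    have "(\<lambda>n. real_of_int \<lfloor>real (Suc n) * fst q\<rfloor> / real (Suc n) - fst q) \<longlonglongrightarrow> 0"
    proof (rule Lim_null_comparison[OF _ LIMSEQ_inverse_real_of_nat], rule always_eventually, rule allI)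
      fix n
      have "\<bar>real_of_int \<lfloor>real (Suc n) * fst q\<rfloor> - real (Suc n) * fst q\<bar> \<le> 1" by linarith
      then have "\<bar>real_of_int \<lfloor>real (Suc n) * fst q\<rfloor> - real (Suc n) * fst q\<bar> / real (Suc n) \<le> 1 / real (Suc n)"
        by (rule divide_right_mono) simp
      moreover have "real_of_int \<lfloor>real (Suc n) * fst q\<rfloor> / real (Suc n) - fst q
          = (real_of_int \<lfloor>real (Suc n) * fst q\<rfloor> - real (Suc n) * fst q) / real (Suc n)"
        by (simp add: diff_divide_distrib del: of_nat_Suc)
      ultimately show "norm (real_of_int \<lfloor>real (Suc n) * fst q\<rfloor> / real (Suc n) - fst q) \<le> inverse (real (Suc n))"
        by (simp add: abs_divide inverse_eq_divide del: of_nat_Suc)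
    qed
    then have "(\<lambda>n. real_of_int \<lfloor>real (Suc n) * fst q\<rfloor> / real (Suc n)) \<longlonglongrightarrow> fst q"
      by (rule LIM_zero_cancel)
    then have "(\<lambda>n. r n \<lfloor>real (Suc n) * fst q\<rfloor>) \<longlonglongrightarrow> max 0 (min T (fst q))"
      unfolding r_def by (intro tendsto_intros)
    then have lim: "(\<lambda>n. r n \<lfloor>real (Suc n) * fst q\<rfloor>) \<longlonglongrightarrow> fst q" using q by simp
    have "(\<lambda>n. Z (r n \<lfloor>real (Suc n) * fst q\<rfloor>) (snd q)) \<longlonglongrightarrow> Z (fst q) (snd q)"
      by (rule continuous_on_tendsto_compose[OF cont[OF q(3)] lim]) (use q rT in auto)
    then show "(\<lambda>n. Z (r n \<lfloor>real (Suc n) * fst q\<rfloor>) (snd q)) \<longlonglongrightarrow> (case q of (s, \<omega>) \<Rightarrow> Z s \<omega>)"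
      by (simp add: split_beta)
  qed
qed

lemma progressive_imp_measurable:
  fixes Z :: "real \<Rightarrow> 'a \<Rightarrow> real"
  assumes "(\<lambda>(s, \<omega>). Z s \<omega>) \<in> borel_measurable (restrict_space lborel {0..T} \<Otimes>\<^sub>M Fil T)"
  shows "(\<lambda>(s, \<omega>). Z s \<omega>) \<in> borel_measurable (restrict_space lborel {0..T} \<Otimes>\<^sub>M M)"
proof -
  have "(\<lambda>\<omega>. \<omega>) \<in> M \<rightarrow>\<^sub>M Fil T"
    using measurable_Fil[of "\<lambda>\<omega>. \<omega>" T] sets_Fil_subset[of T]
    by (intro measurableI) (auto simp: sets.Int_space_eq2 subset_iff)
  then have "(\<lambda>q. (fst q, snd q)) \<in> restrict_space lborel {0..T} \<Otimes>\<^sub>M M \<rightarrow>\<^sub>M restrict_space lborel {0..T} \<Otimes>\<^sub>M Fil T"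
    by (intro measurable_Pair measurable_fst measurable_compose[OF measurable_snd])
  from measurable_compose[OF this assms] show ?thesis by (simp add: split_beta')
qed

lemma progressive_section:
  fixes Z :: "real \<Rightarrow> 'a \<Rightarrow> real"
  assumes "(\<lambda>(s, \<omega>). Z s \<omega>) \<in> borel_measurable (restrict_space lborel {0..T} \<Otimes>\<^sub>M Fil T)" "\<omega> \<in> space M"
  shows "set_borel_measurable lborel {0..T} (\<lambda>s. Z s \<omega>)"
proof -
  have "(\<lambda>s. (s, \<omega>)) \<in> restrict_space lborel {0..T} \<rightarrow>\<^sub>M restrict_space lborel {0..T} \<Otimes>\<^sub>M Fil T"
    using assms(2) by (intro measurable_Pair) auto
  from measurable_compose[OF this assms(1)] show ?thesis
    by (simp add: borel_measurable_restrict_space_iff set_borel_measurable_def)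
qed

lemma progressive_integral_adapted:
  fixes Z :: "real \<Rightarrow> 'a \<Rightarrow> real"
  assumes "(\<lambda>(s, \<omega>). Z s \<omega>) \<in> borel_measurable (restrict_space lborel {0..T} \<Otimes>\<^sub>M Fil T)"
  shows "(\<lambda>\<omega>. LINT s:{0..T}|lborel. Z s \<omega>) \<in> borel_measurable (Fil T)"
  by (rule borel_measurable_set_integral[OF borel_measurable_exchange[OF assms]]) simp

end

locale relaxed_control = brownian M W + gibbs_params lam a
  for M :: "'a measure" and W and lam a :: real +
  fixes \<mu> \<sigma> c :: real
  assumes vol_pos: "\<sigma> > 0" and disc_pos: "c > 0"
begin

definition mean_action :: "(real \<Rightarrow> 'a \<Rightarrow> real \<Rightarrow> real) \<Rightarrow> real \<Rightarrow> 'a \<Rightarrow> real" where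
  "mean_action \<pi> s \<omega> = (LINT w:{0..a}|lborel. w * \<pi> s \<omega> w)"

context
  fixes \<pi> assumes ol: "open_loop_control M W a \<pi>"
begin

lemma ol_density:
  assumes "s \<ge> 0" "\<omega> \<in> space M"
  shows "\<forall>w\<in>{0..a}. 0 \<le> \<pi> s \<omega> w" "set_integrable lborel {0..a} (\<pi> s \<omega>)" "(LINT w:{0..a}|lborel. \<pi> s \<omega> w) = 1"
  using ol assms unfolding open_loop_control_def by auto

lemma mean_action_bounds: "s \<ge> 0 \<Longrightarrow> \<omega> \<in> space M \<Longrightarrow> 0 \<le> mean_action \<pi> s \<omega> \<and> mean_action \<pi> s \<omega> \<le> a"
  unfolding mean_action_def by (intro conjI mean_bounds(2,3)[OF ol_density])

text \<open>One measurability argument for two integrands: \<open>w * p\<close> gives the mean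
  action, and \<open>(w - lam * ln p) * p\<close> the running reward.\<close>

lemma action_integral_progressive:
  fixes \<phi> :: "real \<Rightarrow> real \<Rightarrow> real"
  assumes T: "T \<ge> 0" and \<phi> [measurable]: "(\<lambda>q. \<phi> (fst q) (snd q)) \<in> borel_measurable (borel \<Otimes>\<^sub>M borel)"
  shows "(\<lambda>(s, \<omega>). LINT w:{0..a}|lborel. \<phi> w (\<pi> s \<omega> w)) \<in> borel_measurable (restrict_space lborel {0..T} \<Otimes>\<^sub>M Fil T)"
proof -
  let ?A = "restrict_space lborel {0..T}" and ?B = "restrict_space lborel {0..a}"
  have \<pi>: "(\<lambda>(s, \<omega>, w). \<pi> s \<omega> w) \<in> borel_measurable (?A \<Otimes>\<^sub>M (Fil T \<Otimes>\<^sub>M ?B))"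
    using ol T unfolding open_loop_control_def by blast
  have "(\<lambda>q. (fst (fst q), snd (fst q), snd q)) \<in> (?A \<Otimes>\<^sub>M Fil T) \<Otimes>\<^sub>M ?B \<rightarrow>\<^sub>M ?A \<Otimes>\<^sub>M (Fil T \<Otimes>\<^sub>M ?B)"
    by measurable
  from measurable_compose[OF this \<pi>]
  have m: "(\<lambda>q. \<pi> (fst (fst q)) (snd (fst q)) (snd q)) \<in> borel_measurable ((?A \<Otimes>\<^sub>M Fil T) \<Otimes>\<^sub>M ?B)"
    by (simp add: split_beta)
  have "snd \<in> (?A \<Otimes>\<^sub>M Fil T) \<Otimes>\<^sub>M ?B \<rightarrow>\<^sub>M borel"
    using measurable_compose[OF measurable_snd, of "\<lambda>s. s" ?B borel "?A \<Otimes>\<^sub>M Fil T"]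
    by (simp add: measurable_restrict_space1)
  from measurable_compose[OF measurable_Pair[OF this m] \<phi>]
  have "(\<lambda>(p, w). (\<lambda>(s, \<omega>). \<phi> w (\<pi> s \<omega> w)) p) \<in> borel_measurable ((?A \<Otimes>\<^sub>M Fil T) \<Otimes>\<^sub>M ?B)"
    by (simp add: split_beta)
  from borel_measurable_set_integral[OF this] show ?thesis by (simp add: split_beta')
qed

lemma mean_action_progressive:
  "T \<ge> 0 \<Longrightarrow> (\<lambda>(s, \<omega>). mean_action \<pi> s \<omega>) \<in> borel_measurable (restrict_space lborel {0..T} \<Otimes>\<^sub>M Fil T)"
  using action_integral_progressive[of T "\<lambda>w p. w * p"] unfolding mean_action_def by simp

lemma Hrew_progressive:
  "T \<ge> 0 \<Longrightarrow> (\<lambda>(s, \<omega>). Hrew lam a \<pi> s \<omega>) \<in> borel_measurable (restrict_space lborel {0..T} \<Otimes>\<^sub>M Fil T)"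
  using action_integral_progressive[of T "\<lambda>w p. (w - lam * ln p) * p"] unfolding Hrew_def by simp

lemma ol_ito: "ito_process M W \<sigma> x (\<bar>\<mu>\<bar> + a) (\<lambda>s \<omega>. \<mu> - mean_action \<pi> s \<omega>)"
proof
  have prog: "(\<lambda>(s, \<omega>). \<mu> - mean_action \<pi> s \<omega>) \<in> borel_measurable (restrict_space lborel {0..T} \<Otimes>\<^sub>M Fil T)" if "T \<ge> 0" for T
    using borel_measurable_diff[OF borel_measurable_const mean_action_progressive[OF that], of \<mu>] by (simp add: split_beta')
  show "0 < \<sigma>" by (rule vol_pos)
  show "set_borel_measurable lborel {0..T} (\<lambda>s. \<mu> - mean_action \<pi> s \<omega>)" if "\<omega> \<in> space M" for \<omega> T
  proof (cases "T \<ge> 0")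
    case True then show ?thesis using progressive_section[OF prog that] by simp
  next
    case False then show ?thesis by (simp add: set_borel_measurable_def)
  qed
  show "\<bar>\<mu> - mean_action \<pi> s \<omega>\<bar> \<le> \<bar>\<mu>\<bar> + a" if "\<omega> \<in> space M" "s \<ge> 0" for \<omega> s
    using mean_action_bounds[OF that(2,1)] by linarith
  show "(\<lambda>\<omega>. x + (LINT s:{0..t}|lborel. \<mu> - mean_action \<pi> s \<omega>) + \<sigma> * W t \<omega>) \<in> borel_measurable (Fil t)" if "t \<ge> 0" for t
    using progressive_integral_adapted[OF prog[OF that]] W_adapted[OF that order_refl]
    by (intro borel_measurable_add borel_measurable_times) auto
qed

lemma ol_state_eq: "ito_process.X W \<sigma> x (\<lambda>s \<omega>. \<mu> - mean_action \<pi> s \<omega>) = ol_state W \<mu> \<sigma> a x \<pi>"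
  by (intro ext) (unfold ito_process.X_def[OF ol_ito], unfold ol_state_def mean_action_def, rule refl)

end

text \<open>The class to which verification applies: value 0 at ruin, and bounds on the function,
  both derivatives and the Lipschitz modulus of the second one, merged into one constant.\<close>

definition C2_half_line :: "(real \<Rightarrow> real) \<Rightarrow> (real \<Rightarrow> real) \<Rightarrow> (real \<Rightarrow> real) \<Rightarrow> bool" where
  "C2_half_line v v1 v2 \<longleftrightarrow> v 0 = 0 \<and> (\<exists>K.
     (\<forall>y\<ge>0. (v has_real_derivative v1 y) (at y within {0..}) \<and> (v1 has_real_derivative v2 y) (at y within {0..})
        \<and> \<bar>v y\<bar> \<le> K \<and> \<bar>v1 y\<bar> \<le> K \<and> \<bar>v2 y\<bar> \<le> K \<and> (\<forall>z\<ge>0. \<bar>v2 y - v2 z\<bar> \<le> K * \<bar>y - z\<bar>)))"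

lemma Jol_upper:
  assumes v: "C2_half_line v v1 v2" and x: "x \<ge> 0" and adm: "admissible M W \<mu> \<sigma> c a lam x \<pi>"
    and le: "\<And>\<omega> s. \<omega> \<in> space M \<Longrightarrow> 0 \<le> s \<Longrightarrow> ol_state W \<mu> \<sigma> a x \<pi> s \<omega> \<ge> 0 \<Longrightarrow>
      Hrew lam a \<pi> s \<omega> \<le> - (\<sigma>\<^sup>2 / 2 * v2 (ol_state W \<mu> \<sigma> a x \<pi> s \<omega>)
        + (\<mu> - mean_action \<pi> s \<omega>) * v1 (ol_state W \<mu> \<sigma> a x \<pi> s \<omega>) - c * v (ol_state W \<mu> \<sigma> a x \<pi> s \<omega>))"
  shows "Jol M W \<mu> \<sigma> c a lam x \<pi> \<le> v x"
proof -
  have ol: "open_loop_control M W a \<pi>" using adm by (simp add: admissible_def)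
  interpret I: ito_process M W \<sigma> x "\<bar>\<mu>\<bar> + a" "\<lambda>s \<omega>. \<mu> - mean_action \<pi> s \<omega>" by (rule ol_ito[OF ol])
  note X = ol_state_eq[OF ol, of x]
  from v obtain K where K: "v 0 = 0" "\<And>y. y \<ge> 0 \<Longrightarrow> (v has_real_derivative v1 y) (at y within {0..})"
    "\<And>y. y \<ge> 0 \<Longrightarrow> (v1 has_real_derivative v2 y) (at y within {0..})" "\<And>y. y \<ge> 0 \<Longrightarrow> \<bar>v y\<bar> \<le> K"
    "\<And>y. y \<ge> 0 \<Longrightarrow> \<bar>v1 y\<bar> \<le> K" "\<And>y. y \<ge> 0 \<Longrightarrow> \<bar>v2 y\<bar> \<le> K" "\<And>y z. y \<ge> 0 \<Longrightarrow> z \<ge> 0 \<Longrightarrow> \<bar>v2 y - v2 z\<bar> \<le> K * \<bar>y - z\<bar>"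
    unfolding C2_half_line_def by blast
  show ?thesis unfolding Jol_def X[symmetric]
  proof (rule I.verification_upper[OF x disc_pos K(2-7) K(1)])
    show "(\<lambda>(s, \<omega>). Hrew lam a \<pi> s \<omega>) \<in> borel_measurable (restrict_space lborel {0..T} \<Otimes>\<^sub>M M)" if "T \<ge> 0" for T
      by (rule progressive_imp_measurable[OF Hrew_progressive[OF ol that]])
    show "(\<integral>\<^sup>+ \<omega>. (\<integral>\<^sup>+ t. indicator {t. 0 \<le> t \<and> ereal t < ruin_time I.X \<omega>} t
        * ennreal (exp (- c * t) * \<bar>Hrew lam a \<pi> t \<omega>\<bar>) \<partial>lborel) \<partial>M) < \<infinity>"
      unfolding X using adm by (simp add: admissible_def)
    show "Hrew lam a \<pi> s \<omega> \<le> - (\<sigma>\<^sup>2 / 2 * v2 (I.X s \<omega>) + (\<mu> - mean_action \<pi> s \<omega>) * v1 (I.X s \<omega>) - c * v (I.X s \<omega>))"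
      if "\<omega> \<in> space M" "0 \<le> s" "ereal s < ruin_time I.X \<omega>" for \<omega> s
      using I.before_ruin[OF x that] le[OF that(1,2)] unfolding X by blast
  qed
qed

lemma Jol_lower:
  assumes v: "C2_half_line v v1 v2" and x: "x \<ge> 0" and adm: "admissible M W \<mu> \<sigma> c a lam x \<pi>"
    and le: "\<And>\<omega> s. \<omega> \<in> space M \<Longrightarrow> 0 \<le> s \<Longrightarrow> ol_state W \<mu> \<sigma> a x \<pi> s \<omega> \<ge> 0 \<Longrightarrow>
      - (\<sigma>\<^sup>2 / 2 * v2 (ol_state W \<mu> \<sigma> a x \<pi> s \<omega>)
        + (\<mu> - mean_action \<pi> s \<omega>) * v1 (ol_state W \<mu> \<sigma> a x \<pi> s \<omega>) - c * v (ol_state W \<mu> \<sigma> a x \<pi> s \<omega>)) \<le> Hrew lam a \<pi> s \<omega>"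
  shows "v x \<le> Jol M W \<mu> \<sigma> c a lam x \<pi>"
proof -
  have ol: "open_loop_control M W a \<pi>" using adm by (simp add: admissible_def)
  interpret I: ito_process M W \<sigma> x "\<bar>\<mu>\<bar> + a" "\<lambda>s \<omega>. \<mu> - mean_action \<pi> s \<omega>" by (rule ol_ito[OF ol])
  note X = ol_state_eq[OF ol, of x]
  from v obtain K where K: "v 0 = 0" "\<And>y. y \<ge> 0 \<Longrightarrow> (v has_real_derivative v1 y) (at y within {0..})"
    "\<And>y. y \<ge> 0 \<Longrightarrow> (v1 has_real_derivative v2 y) (at y within {0..})" "\<And>y. y \<ge> 0 \<Longrightarrow> \<bar>v y\<bar> \<le> K"
    "\<And>y. y \<ge> 0 \<Longrightarrow> \<bar>v1 y\<bar> \<le> K" "\<And>y. y \<ge> 0 \<Longrightarrow> \<bar>v2 y\<bar> \<le> K" "\<And>y z. y \<ge> 0 \<Longrightarrow> z \<ge> 0 \<Longrightarrow> \<bar>v2 y - v2 z\<bar> \<le> K * \<bar>y - z\<bar>"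
    unfolding C2_half_line_def by blast
  show ?thesis unfolding Jol_def X[symmetric]
  proof (rule I.verification_lower[OF x disc_pos K(2-7) K(1)])
    show "(\<lambda>(s, \<omega>). Hrew lam a \<pi> s \<omega>) \<in> borel_measurable (restrict_space lborel {0..T} \<Otimes>\<^sub>M M)" if "T \<ge> 0" for T
      by (rule progressive_imp_measurable[OF Hrew_progressive[OF ol that]])
    show "(\<integral>\<^sup>+ \<omega>. (\<integral>\<^sup>+ t. indicator {t. 0 \<le> t \<and> ereal t < ruin_time I.X \<omega>} t
        * ennreal (exp (- c * t) * \<bar>Hrew lam a \<pi> t \<omega>\<bar>) \<partial>lborel) \<partial>M) < \<infinity>"
      unfolding X using adm by (simp add: admissible_def)
    show "- (\<sigma>\<^sup>2 / 2 * v2 (I.X s \<omega>) + (\<mu> - mean_action \<pi> s \<omega>) * v1 (I.X s \<omega>) - c * v (I.X s \<omega>)) \<le> Hrew lam a \<pi> s \<omega>"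
      if "\<omega> \<in> space M" "0 \<le> s" "ereal s < ruin_time I.X \<omega>" for \<omega> s
      using I.before_ruin[OF x that] le[OF that(1,2)] unfolding X by blast
  qed
qed

text \<open>The Gibbs variational inequality is applied at \<open>y = 1 - v'\<close>.\<close>

lemma hjb_upper:
  assumes v: "C2_half_line v v1 v2"
    and hjb: "\<And>y. y \<ge> 0 \<Longrightarrow> \<sigma>\<^sup>2 / 2 * v2 y + \<mu> * v1 y - c * v y + \<Phi> (1 - v1 y) \<le> 0"
    and x: "x \<ge> 0" and adm: "admissible M W \<mu> \<sigma> c a lam x \<pi>"
  shows "Jol M W \<mu> \<sigma> c a lam x \<pi> \<le> v x"
proof (rule Jol_upper[OF v x adm])
  fix \<omega> s assume \<omega>: "\<omega> \<in> space M" "0 \<le> s" "ol_state W \<mu> \<sigma> a x \<pi> s \<omega> \<ge> 0"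
  let ?y = "ol_state W \<mu> \<sigma> a x \<pi> s \<omega>"
  have ol: "open_loop_control M W a \<pi>" using adm by (simp add: admissible_def)
  have "Hrew lam a \<pi> s \<omega> \<le> \<Phi> (1 - v1 ?y) + (1 - (1 - v1 ?y)) * mean_action \<pi> s \<omega>"
    unfolding Hrew_def mean_action_def using adm \<omega>
    by (intro gibbs_variational ol_density[OF ol]) (auto simp: admissible_def)
  then show "Hrew lam a \<pi> s \<omega> \<le> - (\<sigma>\<^sup>2 / 2 * v2 ?y + (\<mu> - mean_action \<pi> s \<omega>) * v1 ?y - c * v ?y)"
    using hjb[OF \<omega>(3)] by (simp add: algebra_simps)
qed

end

section \<open>Feedback controls\<close>

lemma nn_integral_exp_discount:
  assumes "c > 0"
  shows "(\<integral>\<^sup>+ t. indicator {0..} t * ennreal (exp (- c * t)) \<partial>lborel) = ennreal (1 / c)"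
proof -
  interpret E: prob_space "density lborel (exponential_density c)"
    by (rule prob_space_exponential_density[OF assms])
  have 1: "(\<integral>\<^sup>+ t. ennreal (exponential_density c t) \<partial>lborel) = 1"
    using E.emeasure_space_1 by (simp add: emeasure_density)
  have "(\<integral>\<^sup>+ t. indicator {0..} t * ennreal (exp (- c * t)) \<partial>lborel) = (\<integral>\<^sup>+ t. ennreal (1 / c) * ennreal (exponential_density c t) \<partial>lborel)"
    using assms by (intro nn_integral_cong)
      (auto simp: exponential_density_def indicator_def ennreal_mult[symmetric] mult.commute)
  also have "\<dots> = ennreal (1 / c)" by (subst nn_integral_cmult) (auto simp: 1)
  finally show ?thesis .
qed

text \<open>The defining equation of \<open>cl_path\<close> uses Lebesgue integrals, which are 0 by convention when the integrand is
  not measurable; a bounded drift rules out such spurious solutions because up to and after the first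
  failure of measurability the path would be continuous.\<close>

lemma volterra_solution_continuous:
  fixes d g f :: "real \<Rightarrow> real"
  assumes d: "continuous_on UNIV d" "\<And>y. \<bar>d y\<bar> \<le> C" and g: "continuous_on {0..} g"
    and f: "\<And>t. f t = g t + (LINT s:{0..t}|lborel. d (f s))"
  shows "continuous_on {0..} f"
proof -
  let ?\<beta> = "\<lambda>s. d (f s)"
  let ?ok = "\<lambda>t. set_borel_measurable lborel {0..t} ?\<beta>"
  have cont_ok: "continuous_on {0..T} f" if ok: "?ok T" for T
  proof -
    have i: "set_integrable lborel {0..t} ?\<beta>" if "t \<le> T" for t
      by (rule set_integrable_bounded_Icc[OF ok d(2)]) (use that in auto)
    have "continuous_on {0..T} (\<lambda>t. g t + integral {0..t} ?\<beta>)"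
      by (intro continuous_intros indefinite_integral_continuous_1 continuous_on_subset[OF g]
          set_borel_integral_eq_integral(1)[OF i]) auto
    moreover have "f t = g t + integral {0..t} ?\<beta>" if "t \<in> {0..T}" for t
      using f[of t] set_borel_integral_eq_integral(2)[OF i[of t]] that by simp
    ultimately show ?thesis by (metis (no_types, lifting) continuous_on_cong)
  qed
  have "?ok T" for T
  proof (rule ccontr)
    assume bad: "\<not> ?ok T"
    \<comment> \<open>Measurability on an interval passes to shorter ones, so failure is upward
      closed and is described by the infimum \<open>t0\<close>.\<close>
    define A where "A = {t. 0 \<le> t \<and> \<not> ?ok t}"
    have "T \<ge> 0" using bad by (cases "T \<ge> 0") (auto simp: set_borel_measurable_def)
    with bad have TA: "T \<in> A" by (simp add: A_def)
    have bdd: "bdd_below A" by (auto simp: A_def intro!: bdd_belowI[of _ 0])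
    define t0 where "t0 = Inf A"
    have t0: "t0 \<ge> 0" unfolding t0_def using TA by (intro cInf_greatest) (auto simp: A_def)
    have below: "?ok t" if "0 \<le> t" "t < t0" for t
      using that cInf_lower[OF _ bdd, of t] unfolding t0_def[symmetric] by (auto simp: A_def)
    have above: "\<not> ?ok t" if "t0 < t" for t
    proof
      assume ok: "?ok t"
      have "A \<noteq> {}" "Inf A < t" using TA \<open>t0 < t\<close> by (auto simp: t0_def)
      then obtain r where "r \<in> A" "r < t" using cInf_lessD by blast
      moreover from this have "?ok r" by (intro set_borel_measurable_subset[OF ok]) auto
      ultimately show False by (simp add: A_def)
    qed
    have c1: "continuous_on {0..<t0} f"
    proof (subst continuous_on_eq_continuous_within, rule ballI)
      fix t assume t: "t \<in> {0..<t0}"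
      define r where "r = (t + t0) / 2"
      have r: "t < r" "r < t0" "0 \<le> r" using t by (auto simp: r_def)
      have "continuous (at t within {0..r}) f"
        using cont_ok[OF below[OF r(3,2)]] t r by (auto simp: continuous_on_eq_continuous_within)
      moreover have "at t within {0..<t0} = at t within {0..r}"
        by (rule at_within_nhd[of _ "{..<r}"]) (use r in auto)
      ultimately show "continuous (at t within {0..<t0}) f" by simp
    qed
    \<comment> \<open>Beyond \<open>t0\<close> the integrand is not integrable, the integral
      defaults to 0, and the path reduces to the continuous \<open>g\<close>.\<close>
    have "f t = g t" if "t0 < t" for t
    proof -
      have "\<not> set_integrable lborel {0..t} ?\<beta>"
        using above[OF that] by (auto simp: set_integrable_def set_borel_measurable_def)
      then have "(LINT s:{0..t}|lborel. ?\<beta> s) = 0"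
        unfolding set_lebesgue_integral_def set_integrable_def by (rule not_integrable_integral_eq)
      then show ?thesis using f[of t] by simp
    qed
    then have c2: "continuous_on {t0<..} f"
      by (subst continuous_on_cong[OF refl, of _ f g]) (use t0 in \<open>auto intro: continuous_on_subset[OF g]\<close>)
    have "(\<lambda>s. indicator {0..<t0} s *\<^sub>R d (f s)) \<in> borel_measurable borel"
      "(\<lambda>s. indicator {t0<..} s *\<^sub>R d (f s)) \<in> borel_measurable borel"
      using continuous_on_compose2[OF d(1) c1] continuous_on_compose2[OF d(1) c2]
      by (intro borel_measurable_continuous_on_indicator; simp)+
    \<comment> \<open>The integrand is assembled from the two sides of \<open>t0\<close> and its
      value at that single point, where continuity of \<open>f\<close> is unknown.\<close>
    then have "(\<lambda>s. indicator {0..T} s * (indicator {0..<t0} s *\<^sub>R d (f s) + indicator {t0<..} s *\<^sub>R d (f s) + indicator {t0} s * d (f t0))) \<in> borel_measurable borel"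
      by (intro borel_measurable_times borel_measurable_add borel_measurable_indicator) auto
    moreover have "(\<lambda>s. indicator {0..T} s * (indicator {0..<t0} s *\<^sub>R d (f s) + indicator {t0<..} s *\<^sub>R d (f s) + indicator {t0} s * d (f t0)))
        = (\<lambda>s. indicator {0..T} s *\<^sub>R d (f s))"
      by (auto simp: indicator_def fun_eq_iff)
    ultimately have "?ok T" by (simp only: set_borel_measurable_def measurable_lborel2)
    with bad show False ..
  qed
  then show ?thesis using cont_ok by (intro continuous_on_atLeastI) auto
qed

text \<open>The policy is prescribed only for nonnegative states, since \<open>cl_path\<close> and
  \<open>induced_control\<close> evaluate it at \<open>max 0\<close> of the state. Bounds on
  \<open>\<kappa>\<close> confine the Gibbs parameter to a range on which the mean action is
  Lipschitz.\<close>

locale feedback = relaxed_control M W lam a \<mu> \<sigma> c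
  for M :: "'a measure" and W and lam a \<mu> \<sigma> c :: real +
  fixes \<kappa> :: "real \<Rightarrow> real" and pol :: "real \<Rightarrow> real \<Rightarrow> real" and Kb L\<kappa> :: real
  assumes pol: "\<And>w y. y \<ge> 0 \<Longrightarrow> pol w y = Gibbs lam a w (\<kappa> y)"
    and \<kappa>_bound: "\<And>y. y \<ge> 0 \<Longrightarrow> \<bar>\<kappa> y\<bar> \<le> Kb"
    and \<kappa>_lipschitz: "\<And>y z. y \<ge> 0 \<Longrightarrow> z \<ge> 0 \<Longrightarrow> \<bar>\<kappa> y - \<kappa> z\<bar> \<le> L\<kappa> * \<bar>y - z\<bar>"
begin

definition drift :: "real \<Rightarrow> real" where
  "drift y = \<mu> - m (\<kappa> (max 0 y))"

lemma \<kappa>_clamp_lipschitz: "\<bar>\<kappa> (max 0 y) - \<kappa> (max 0 z)\<bar> \<le> \<bar>L\<kappa>\<bar> * \<bar>y - z\<bar>"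
proof -
  have "\<bar>\<kappa> (max 0 y) - \<kappa> (max 0 z)\<bar> \<le> L\<kappa> * \<bar>max 0 y - max 0 z\<bar>"
    by (rule \<kappa>_lipschitz) auto
  also have "\<dots> \<le> \<bar>L\<kappa>\<bar> * \<bar>y - z\<bar>" by (intro mult_mono) auto
  finally show ?thesis .
qed

lemma \<kappa>_clamp_continuous: "continuous_on UNIV (\<lambda>y. \<kappa> (max 0 y))"
  by (rule lipschitz_on_continuous_on[where L = "\<bar>L\<kappa>\<bar>"])
    (auto intro!: lipschitz_onI simp: dist_real_def \<kappa>_clamp_lipschitz)

lemma drift_lipschitz: obtains L where "L \<ge> 0" "\<And>y z. \<bar>drift y - drift z\<bar> \<le> L * \<bar>y - z\<bar>"
proof -
  obtain L where L: "L \<ge> 0" "\<And>y z. \<bar>y\<bar> \<le> Kb \<Longrightarrow> \<bar>z\<bar> \<le> Kb \<Longrightarrow> \<bar>m y - m z\<bar> \<le> L * \<bar>y - z\<bar>"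
    using gibbs_mean_locally_lipschitz by blast
  show thesis
  proof (rule that)
    show "L * \<bar>L\<kappa>\<bar> \<ge> 0" using L(1) by simp
    fix y z
    have "\<bar>drift y - drift z\<bar> \<le> L * \<bar>\<kappa> (max 0 y) - \<kappa> (max 0 z)\<bar>"
      using L(2)[OF \<kappa>_bound[of "max 0 y"] \<kappa>_bound[of "max 0 z"]] by (simp add: drift_def abs_minus_commute)
    also have "\<dots> \<le> L * (\<bar>L\<kappa>\<bar> * \<bar>y - z\<bar>)" by (intro mult_left_mono \<kappa>_clamp_lipschitz L(1))
    finally show "\<bar>drift y - drift z\<bar> \<le> L * \<bar>L\<kappa>\<bar> * \<bar>y - z\<bar>" by (simp add: mult.assoc)
  qed
qed

lemma drift_continuous: "continuous_on UNIV drift"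
proof -
  obtain L where "L \<ge> 0" "\<And>y z. \<bar>drift y - drift z\<bar> \<le> L * \<bar>y - z\<bar>" using drift_lipschitz by blast
  then show ?thesis
    by (intro lipschitz_on_continuous_on[where L = L] lipschitz_onI) (auto simp: dist_real_def)
qed

lemma drift_bound: "\<bar>drift y\<bar> \<le> \<bar>\<mu>\<bar> + a"
  unfolding drift_def using gibbs_mean_bounds[of "\<kappa> (max 0 y)"] by linarith

lemma drift_eq: "\<mu> - (LINT w:{0..a}|lborel. w * pol w (max 0 y)) = drift y"
  by (simp add: drift_def gibbs_mean_def pol)

section \<open>The closed-loop state: existence, uniqueness and adaptedness\<close>

definition noise :: "real \<Rightarrow> 'a \<Rightarrow> real \<Rightarrow> real" where
  "noise x \<omega> t = x + \<sigma> * W t \<omega>"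

definition approx_path :: "real \<Rightarrow> nat \<Rightarrow> real \<Rightarrow> 'a \<Rightarrow> real" where
  "approx_path x n t \<omega> = picard (\<lambda>_. drift) (noise x \<omega>) n t"

abbreviation path :: "real \<Rightarrow> real \<Rightarrow> 'a \<Rightarrow> real" where
  "path x t \<omega> \<equiv> cl_path W \<mu> \<sigma> a x pol \<omega> t"

lemma drift_field: obtains L where "lipschitz_field (\<lambda>_. drift) L"
proof -
  obtain L where L: "L \<ge> 0" "\<And>y z. \<bar>drift y - drift z\<bar> \<le> L * \<bar>y - z\<bar>" using drift_lipschitz by blast
  have "lipschitz_field (\<lambda>_. drift) L"
    by standard (use L in \<open>auto intro: continuous_on_compose2[OF drift_continuous]\<close>)
  then show thesis by (rule that)
qed

lemma noise_continuous: "\<omega> \<in> space M \<Longrightarrow> continuous_on {0..} (noise x \<omega>)"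
  unfolding noise_def by (intro continuous_intros W_continuous)

lemma approx_path_continuous: "\<omega> \<in> space M \<Longrightarrow> continuous_on {0..} (\<lambda>t. approx_path x n t \<omega>)"
  unfolding approx_path_def
  by (rule drift_field) (rule lipschitz_field.picard_continuous[OF _ noise_continuous])

lemma LINT_drift:
  fixes y :: "real \<Rightarrow> real"
  assumes "continuous_on {0..} y"
  shows "(LINT s:{0..t}|lborel. drift (y s)) = integral {0..t} (\<lambda>s. drift (y s))"
proof -
  have "continuous_on {0..t} (\<lambda>s. drift (y s))"
    by (rule continuous_on_compose2[OF drift_continuous continuous_on_subset[OF assms]]) auto
  from set_borel_integral_eq_integral(2)[OF set_integrable_continuous[OF this]] show ?thesis .
qed

lemma path_exists:
  assumes \<omega>: "\<omega> \<in> space M"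
  shows "\<forall>t. path x t \<omega> = noise x \<omega> t + (LINT s:{0..t}|lborel. drift (path x s \<omega>))" (is ?sol)
    and "continuous_on {0..} (\<lambda>t. path x t \<omega>)" (is ?cont)
    and "t \<ge> 0 \<Longrightarrow> (\<lambda>n. approx_path x n t \<omega>) \<longlonglongrightarrow> path x t \<omega>"
proof -
  obtain L where "lipschitz_field (\<lambda>_. drift) L" by (rule drift_field)
  then interpret lipschitz_field "\<lambda>_. drift" L .
  let ?P = "\<lambda>f. \<forall>t. f t = noise x \<omega> t + (LINT s:{0..t}|lborel. drift (f s))"
  obtain y where y: "continuous_on {0..} y" "\<And>t. t \<ge> 0 \<Longrightarrow> (\<lambda>n. picard (\<lambda>_. drift) (noise x \<omega>) n t) \<longlonglongrightarrow> y t"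
    "\<And>t. t \<ge> 0 \<Longrightarrow> y t = noise x \<omega> t + integral {0..t} (\<lambda>s. drift (y s))"
    using picard_limit[OF noise_continuous[OF \<omega>]] by blast
  \<comment> \<open>\<open>cl_path\<close> describes a function on the whole line; for negative
    \<open>t\<close> the interval \<open>{0..t}\<close> is empty and the equation prescribes the
    noise.\<close>
  define f where "f = (\<lambda>t. if t \<ge> 0 then y t else noise x \<omega> t)"
  have fP: "?P f"
  proof
    fix t
    show "f t = noise x \<omega> t + (LINT s:{0..t}|lborel. drift (f s))"
    proof (cases "t \<ge> 0")
      case True
      have "(LINT s:{0..t}|lborel. drift (f s)) = (LINT s:{0..t}|lborel. drift (y s))"
        by (intro set_lebesgue_integral_cong) (auto simp: f_def)
      then show ?thesis using True y(3)[OF True] LINT_drift[OF y(1)] by (simp add: f_def)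
    qed (simp add: f_def set_lebesgue_integral_def)
  qed
  \<comment> \<open>Uniqueness must hold among all functions solving the equation with Lebesgue
    integrals, so each of them is first shown to be continuous; then the Volterra uniqueness
    applies.\<close>
  have contP: "continuous_on {0..} h" if "?P h" for h
    by (rule volterra_solution_continuous[OF drift_continuous drift_bound noise_continuous[OF \<omega>, of x]]) (use that in blast)
  have uniq: "h = f" if h: "?P h" for h
  proof
    fix t
    show "h t = f t"
    proof (cases "t \<ge> 0")
      case True
      have hi: "h s = noise x \<omega> s + integral {0..s} (\<lambda>r. drift (h r))" if "s \<ge> 0" for s
        unfolding LINT_drift[OF contP[OF h], symmetric] by (rule spec[OF h])
      have fi: "f s = noise x \<omega> s + integral {0..s} (\<lambda>r. drift (f r))" if "s \<ge> 0" for s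
        unfolding LINT_drift[OF contP[OF fP], symmetric] by (rule spec[OF fP])
      show ?thesis by (rule volterra_unique[OF contP[OF h] contP[OF fP] hi fi True])
    next
      case False
      then have "{0..t} = {}" by simp
      then show ?thesis using spec[OF h, of t] spec[OF fP, of t] by (simp add: set_lebesgue_integral_def)
    qed
  qed
  have "cl_path W \<mu> \<sigma> a x pol \<omega> = (THE f. ?P f)"
    unfolding cl_path_def drift_eq noise_def by (simp add: ac_simps)
  also have "\<dots> = f" by (rule the_equality) (use fP uniq in blast)+
  finally have eq: "cl_path W \<mu> \<sigma> a x pol \<omega> = f" .
  show ?sol unfolding eq by (rule fP)
  show ?cont unfolding eq by (rule contP[OF fP])
  show "(\<lambda>n. approx_path x n t \<omega>) \<longlonglongrightarrow> path x t \<omega>" if "t \<ge> 0"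
    unfolding eq approx_path_def using y(2)[OF that] that by (simp add: f_def)
qed

text \<open>In each Picard step the previous iterate is continuous and adapted, hence progressive,
  and its integral up to \<open>t\<close> is measurable with respect to
  \<open>Fil t\<close>.\<close>

lemma approx_path_adapted: "t \<ge> 0 \<Longrightarrow> approx_path x n t \<in> borel_measurable (Fil t)"
proof (induction n arbitrary: t)
  case 0
  have "W t \<in> borel_measurable (Fil t)" using W_adapted[OF 0 order_refl] .
  then show ?case by (simp add: approx_path_def noise_def)
next
  case (Suc n)
  have Wt: "W t \<in> borel_measurable (Fil t)" using W_adapted[OF Suc.prems order_refl] .
  have "(\<lambda>(s, \<omega>). drift (approx_path x n s \<omega>)) \<in> borel_measurable (restrict_space lborel {0..t} \<Otimes>\<^sub>M Fil t)"
  proof (rule progressive_of_continuous)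
    show "continuous_on {0..} (\<lambda>t. drift (approx_path x n t \<omega>))" if "\<omega> \<in> space M" for \<omega>
      by (rule continuous_on_compose2[OF drift_continuous approx_path_continuous[OF that]]) auto
    show "(\<lambda>\<omega>. drift (approx_path x n s \<omega>)) \<in> borel_measurable (Fil s)" if "0 \<le> s" for s
      by (rule measurable_compose[OF Suc.IH[OF that]]) (rule borel_measurable_continuous_onI[OF drift_continuous])
  qed (rule Suc.prems)
  from progressive_integral_adapted[OF this]
  have "(\<lambda>\<omega>. x + \<sigma> * W t \<omega> + (LINT s:{0..t}|lborel. drift (approx_path x n s \<omega>))) \<in> borel_measurable (Fil t)"
    using Wt by (intro borel_measurable_add borel_measurable_times) auto
  moreover have "approx_path x (Suc n) t \<omega> = x + \<sigma> * W t \<omega> + (LINT s:{0..t}|lborel. drift (approx_path x n s \<omega>))"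
    if "\<omega> \<in> space (Fil t)" for \<omega>
    using LINT_drift[OF approx_path_continuous[of \<omega> x n], of t] that by (simp add: approx_path_def noise_def)
  ultimately show ?case by (subst measurable_cong) auto
qed

lemma path_adapted: "t \<ge> 0 \<Longrightarrow> path x t \<in> borel_measurable (Fil t)"
  by (rule borel_measurable_LIMSEQ_real[where u = "\<lambda>n. approx_path x n t"])
    (auto intro: path_exists(3) approx_path_adapted)

section \<open>The open-loop control induced by a feedback, and its cost\<close>

abbreviation "ctl x \<equiv> induced_control W \<mu> \<sigma> a x pol"

lemma ctl_eq: "ctl x t \<omega> w = G w (\<kappa> (max 0 (path x t \<omega>)))"
  by (simp add: induced_control_def pol)

lemma ctl_open_loop: "open_loop_control M W a (ctl x)"
  unfolding open_loop_control_def
proof (intro conjI allI impI ballI)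
  show "0 \<le> ctl x t \<omega> w" for t \<omega> w
    unfolding ctl_eq by (rule less_imp_le[OF Gibbs_pos])
  show "set_integrable lborel {0..a} (ctl x t \<omega>)" "(LINT w:{0..a}|lborel. ctl x t \<omega> w) = 1" for t \<omega>
    unfolding ctl_eq[abs_def] by (rule Gibbs_density integral_Gibbs)+
  fix t :: real assume t: "t \<ge> 0"
  let ?A = "restrict_space lborel {0..t}" and ?B = "restrict_space lborel {0..a}"
  let ?N = "?A \<Otimes>\<^sub>M (Fil t \<Otimes>\<^sub>M ?B)"
  have "(\<lambda>(s, \<omega>). \<kappa> (max 0 (path x s \<omega>))) \<in> borel_measurable (?A \<Otimes>\<^sub>M Fil t)"
  proof (rule progressive_of_continuous[OF _ _ t])
    show "continuous_on {0..} (\<lambda>t. \<kappa> (max 0 (path x t \<omega>)))" if "\<omega> \<in> space M" for \<omega>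
      by (rule continuous_on_compose2[OF \<kappa>_clamp_continuous path_exists(2)[OF that]]) auto
    show "(\<lambda>\<omega>. \<kappa> (max 0 (path x s \<omega>))) \<in> borel_measurable (Fil s)" if "0 \<le> s" for s
      by (rule measurable_compose[OF path_adapted[OF that]]) (rule borel_measurable_continuous_onI[OF \<kappa>_clamp_continuous])
  qed
  moreover have "(\<lambda>q. (fst q, fst (snd q))) \<in> ?N \<rightarrow>\<^sub>M ?A \<Otimes>\<^sub>M Fil t" by measurable
  ultimately have \<kappa>: "(\<lambda>q. \<kappa> (max 0 (path x (fst q) (fst (snd q))))) \<in> borel_measurable ?N"
    using measurable_compose by fastforce
  have "(\<lambda>w. w) \<in> ?B \<rightarrow>\<^sub>M borel" by (simp add: measurable_restrict_space1)
  moreover have "(\<lambda>q. snd (snd q)) \<in> ?N \<rightarrow>\<^sub>M ?B" by measurable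
  ultimately have w: "(\<lambda>q. snd (snd q)) \<in> ?N \<rightarrow>\<^sub>M borel"
    using measurable_compose by fastforce
  have "continuous_on UNIV \<Phi>"
    by (rule lipschitz_on_continuous_on[where L = a])
      (use a_pos in \<open>auto intro!: lipschitz_onI simp: dist_real_def log_partition_lipschitz\<close>)
  then have [measurable]: "\<Phi> \<in> borel_measurable borel" by (rule borel_measurable_continuous_onI)
  \<comment> \<open>In the exponential form the case distinction at parameter 0 disappears, and
    joint measurability follows from that of \<open>\<Phi>\<close>.\<close>
  have "(\<lambda>q. exp ((snd (snd q) * \<kappa> (max 0 (path x (fst q) (fst (snd q)))) - \<Phi> (\<kappa> (max 0 (path x (fst q) (fst (snd q)))))) / lam)) \<in> borel_measurable ?N"
    using \<kappa> w by measurable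
  then show "(\<lambda>(s, \<omega>, w). ctl x s \<omega> w) \<in> borel_measurable ?N"
    by (simp add: split_beta' ctl_eq Gibbs_eq_exp)
qed

lemma ctl_Hrew: "Hrew lam a (ctl x) t \<omega> = gibbs_reward lam a (\<kappa> (max 0 (path x t \<omega>)))"
  unfolding Hrew_def ctl_eq by (rule integral_gibbs_reward)

lemma ctl_mean: "mean_action (ctl x) t \<omega> = m (\<kappa> (max 0 (path x t \<omega>)))"
  unfolding mean_action_def ctl_eq gibbs_mean_def ..

lemma ctl_state: "\<omega> \<in> space M \<Longrightarrow> ol_state W \<mu> \<sigma> a x (ctl x) t \<omega> = path x t \<omega>"
proof -
  assume \<omega>: "\<omega> \<in> space M"
  have "ol_state W \<mu> \<sigma> a x (ctl x) t \<omega> = noise x \<omega> t + (LINT s:{0..t}|lborel. drift (path x s \<omega>))"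
    by (simp add: ol_state_def ctl_eq drift_def gibbs_mean_def noise_def)
  also have "\<dots> = path x t \<omega>" by (rule spec[OF path_exists(1)[OF \<omega>], symmetric])
  finally show ?thesis .
qed

lemma reward_bound: "y \<ge> 0 \<Longrightarrow> \<bar>gibbs_reward lam a (\<kappa> y)\<bar> \<le> lam * \<bar>ln a\<bar> + a * Kb + (1 + Kb) * a"
proof -
  assume y: "y \<ge> 0"
  have "\<bar>\<Phi> (\<kappa> y)\<bar> \<le> lam * \<bar>ln a\<bar> + a * \<bar>\<kappa> y\<bar>"
    using log_partition_lipschitz[of "\<kappa> y" 0] log_partition_0 lam_pos abs_triangle_ineq2[of "\<Phi> (\<kappa> y)" "\<Phi> 0"]
    by (simp add: abs_mult)
  also have "\<dots> \<le> lam * \<bar>ln a\<bar> + a * Kb" using \<kappa>_bound[OF y] a_pos by simp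
  finally have "\<bar>\<Phi> (\<kappa> y)\<bar> \<le> lam * \<bar>ln a\<bar> + a * Kb" .
  moreover have "\<bar>(1 - \<kappa> y) * m (\<kappa> y)\<bar> \<le> (1 + Kb) * a"
    unfolding abs_mult using \<kappa>_bound[OF y] gibbs_mean_bounds[of "\<kappa> y"] by (intro mult_mono) auto
  ultimately show ?thesis unfolding gibbs_reward_def by linarith
qed

lemma ctl_admissible: "admissible M W \<mu> \<sigma> c a lam x (ctl x)"
  unfolding admissible_def
proof (intro conjI allI impI ballI)
  show "open_loop_control M W a (ctl x)" by (rule ctl_open_loop)
  show "set_integrable lborel {0..a} (\<lambda>w. (w - lam * ln (ctl x t \<omega> w)) * ctl x t \<omega> w)" for t \<omega>
    unfolding ctl_eq by (rule set_integrable_gibbs_reward)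
  define R where "R = lam * \<bar>ln a\<bar> + a * Kb + (1 + Kb) * a"
  have R: "R \<ge> 0" using reward_bound[of 0] unfolding R_def by linarith
  have "(\<integral>\<^sup>+ \<omega>. (\<integral>\<^sup>+ t. indicator {t. 0 \<le> t \<and> ereal t < ruin_time (ol_state W \<mu> \<sigma> a x (ctl x)) \<omega>} t
                     * ennreal (exp (- c * t) * \<bar>Hrew lam a (ctl x) t \<omega>\<bar>) \<partial>lborel) \<partial>M)
    \<le> (\<integral>\<^sup>+ \<omega>. (\<integral>\<^sup>+ t. ennreal R * (indicator {0..} t * ennreal (exp (- c * t))) \<partial>lborel) \<partial>M)"
  proof (intro nn_integral_mono)
    fix \<omega> t
    have "exp (- c * t) * \<bar>Hrew lam a (ctl x) t \<omega>\<bar> \<le> R * exp (- c * t)"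
      using reward_bound[of "max 0 (path x t \<omega>)"] unfolding ctl_Hrew R_def by (simp add: mult.commute)
    then have "ennreal (exp (- c * t) * \<bar>Hrew lam a (ctl x) t \<omega>\<bar>) \<le> ennreal R * ennreal (exp (- c * t))"
      using R by (simp add: ennreal_mult[symmetric] ennreal_leI)
    then show "indicator {t. 0 \<le> t \<and> ereal t < ruin_time (ol_state W \<mu> \<sigma> a x (ctl x)) \<omega>} t
        * ennreal (exp (- c * t) * \<bar>Hrew lam a (ctl x) t \<omega>\<bar>)
      \<le> ennreal R * (indicator {0..} t * ennreal (exp (- c * t)))"
      by (auto simp: indicator_def)
  qed
  also have "\<dots> = ennreal R * ennreal (1 / c)"
  proof -
    have "(\<integral>\<^sup>+ t. ennreal R * (indicator {0..} t * ennreal (exp (- c * t))) \<partial>lborel) = ennreal R * ennreal (1 / c)"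
      by (subst nn_integral_cmult) (simp, simp only: nn_integral_exp_discount[OF disc_pos])
    then show ?thesis by (simp only: nn_integral_const emeasure_space_1 mult_1_right)
  qed
  also have "\<dots> < \<infinity>" by (simp add: ennreal_mult_less_top)
  finally show "(\<integral>\<^sup>+ \<omega>. (\<integral>\<^sup>+ t. indicator {t. 0 \<le> t \<and> ereal t < ruin_time (ol_state W \<mu> \<sigma> a x (ctl x)) \<omega>} t
                     * ennreal (exp (- c * t) * \<bar>Hrew lam a (ctl x) t \<omega>\<bar>) \<partial>lborel) \<partial>M) < \<infinity>" .
qed

abbreviation "J x \<equiv> Jcl M W \<mu> \<sigma> c a lam x pol"

text \<open>Comparison with a subsolution of the equation of this fixed policy. It serves three
  times: for evaluating a policy, for monotonicity (with the previous value as subsolution) and for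
  the optimality of the limit policy.\<close>

lemma Jcl_ge:
  assumes v: "C2_half_line v v1 v2" and x: "x \<ge> 0"
    and sub: "\<And>y. y \<ge> 0 \<Longrightarrow> \<sigma>\<^sup>2 / 2 * v2 y + (\<mu> - m (\<kappa> y)) * v1 y - c * v y + gibbs_reward lam a (\<kappa> y) \<ge> 0"
  shows "v x \<le> J x"
  unfolding Jcl_def
proof (rule Jol_lower[OF v x ctl_admissible])
  fix \<omega> s assume \<omega>: "\<omega> \<in> space M" "0 \<le> s" "ol_state W \<mu> \<sigma> a x (ctl x) s \<omega> \<ge> 0"
  then have p: "max 0 (path x s \<omega>) = path x s \<omega>" "path x s \<omega> \<ge> 0" by (auto simp: ctl_state)
  show "- (\<sigma>\<^sup>2 / 2 * v2 (ol_state W \<mu> \<sigma> a x (ctl x) s \<omega>)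
        + (\<mu> - mean_action (ctl x) s \<omega>) * v1 (ol_state W \<mu> \<sigma> a x (ctl x) s \<omega>)
        - c * v (ol_state W \<mu> \<sigma> a x (ctl x) s \<omega>)) \<le> Hrew lam a (ctl x) s \<omega>"
    unfolding ctl_state[OF \<omega>(1)] ctl_mean ctl_Hrew p(1) using sub[OF p(2)] by linarith
qed

lemma Jcl_le:
  assumes v: "C2_half_line v v1 v2" and x: "x \<ge> 0"
    and super: "\<And>y. y \<ge> 0 \<Longrightarrow> \<sigma>\<^sup>2 / 2 * v2 y + (\<mu> - m (\<kappa> y)) * v1 y - c * v y + gibbs_reward lam a (\<kappa> y) \<le> 0"
  shows "J x \<le> v x"
  unfolding Jcl_def
proof (rule Jol_upper[OF v x ctl_admissible])
  fix \<omega> s assume \<omega>: "\<omega> \<in> space M" "0 \<le> s" "ol_state W \<mu> \<sigma> a x (ctl x) s \<omega> \<ge> 0"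
  then have p: "max 0 (path x s \<omega>) = path x s \<omega>" "path x s \<omega> \<ge> 0" by (auto simp: ctl_state)
  show "Hrew lam a (ctl x) s \<omega> \<le> - (\<sigma>\<^sup>2 / 2 * v2 (ol_state W \<mu> \<sigma> a x (ctl x) s \<omega>)
        + (\<mu> - mean_action (ctl x) s \<omega>) * v1 (ol_state W \<mu> \<sigma> a x (ctl x) s \<omega>)
        - c * v (ol_state W \<mu> \<sigma> a x (ctl x) s \<omega>))"
    unfolding ctl_state[OF \<omega>(1)] ctl_mean ctl_Hrew p(1) using super[OF p(2)] by linarith
qed

end

section \<open>Policy evaluation\<close>

lemma lipschitz_of_derivative_bound:
  assumes f: "\<And>t. t \<ge> 0 \<Longrightarrow> (f has_real_derivative f' t) (at t within {0..})"
    and L: "\<And>t. t \<ge> 0 \<Longrightarrow> \<bar>f' t\<bar> \<le> L" and yz: "y \<ge> 0" "z \<ge> 0"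
  shows "\<bar>f y - f z\<bar> \<le> L * \<bar>y - z\<bar>"
proof -
  have *: "\<bar>f q - f p\<bar> \<le> L * \<bar>q - p\<bar>" if "0 \<le> p" "p < q" for p q
  proof -
    obtain t where t: "p < t" "t < q" "f q - f p = f' t * (q - p)"
      using mvt_half_line[OF f \<open>0 \<le> p\<close> \<open>p < q\<close>] by blast
    then show ?thesis using L[of t] that by (simp add: abs_mult mult_right_mono)
  qed
  consider "y < z" | "z < y" | "y = z" by linarith
  then show ?thesis using *[of y z] *[of z y] yz by cases (auto simp: abs_minus_commute)
qed

text \<open>In contrast to differentiability itself, this inequality with a constant independent of
  \<open>n\<close> survives pointwise limits.\<close>

lemma quadratic_remainder:
  assumes f: "\<And>t. t \<ge> 0 \<Longrightarrow> (f has_real_derivative f' t) (at t within {0..})"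
    and L: "\<And>s t. s \<ge> 0 \<Longrightarrow> t \<ge> 0 \<Longrightarrow> \<bar>f' s - f' t\<bar> \<le> L * \<bar>s - t\<bar>" and xy: "x \<ge> 0" "y \<ge> 0"
  shows "\<bar>f y - f x - f' x * (y - x)\<bar> \<le> L * (y - x)\<^sup>2"
proof (cases "x = y")
  case False
  have "\<exists>t\<ge>0. \<bar>t - x\<bar> \<le> \<bar>y - x\<bar> \<and> f y - f x = f' t * (y - x)"
  proof (cases "x < y")
    case True
    then obtain t where "x < t" "t < y" "f y - f x = f' t * (y - x)"
      using mvt_half_line[OF f xy(1)] by blast
    then show ?thesis using xy by (intro exI[of _ t]) auto
  next
    case False
    then have "y < x" using \<open>x \<noteq> y\<close> by simp
    then obtain t where "y < t" "t < x" "f x - f y = f' t * (x - y)"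
      using mvt_half_line[OF f xy(2)] by blast
    then show ?thesis using xy by (intro exI[of _ t]) (auto simp: algebra_simps)
  qed
  then obtain t where t: "t \<ge> 0" "\<bar>t - x\<bar> \<le> \<bar>y - x\<bar>" "f y - f x = f' t * (y - x)" by blast
  have "L \<ge> 0" using L[OF xy] False by (smt (verit) mult_neg_pos)
  then have "\<bar>f' t - f' x\<bar> \<le> L * \<bar>y - x\<bar>"
    using L[OF t(1) xy(1)] mult_left_mono[OF t(2)] by fastforce
  then have "\<bar>f' t - f' x\<bar> * \<bar>y - x\<bar> \<le> L * \<bar>y - x\<bar> * \<bar>y - x\<bar>" by (rule mult_right_mono) simp
  moreover have "f y - f x - f' x * (y - x) = (f' t - f' x) * (y - x)" using t by (simp add: algebra_simps)
  ultimately show ?thesis by (simp add: abs_mult power2_eq_square mult.assoc)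
qed simp

text \<open>The way back after the limit: division by \<open>y - x\<close> leaves an error linear in
  \<open>\<bar>y - x\<bar>\<close>.\<close>

lemma has_real_derivative_of_quadratic_remainder:
  fixes f :: "real \<Rightarrow> real"
  assumes "\<And>y. y \<ge> 0 \<Longrightarrow> \<bar>f y - f x - D * (y - x)\<bar> \<le> L * (y - x)\<^sup>2"
  shows "(f has_real_derivative D) (at x within {0..})"
proof -
  have "((\<lambda>y. (f y - f x) / (y - x) - D) \<longlongrightarrow> 0) (at x within {0..})"
  proof (rule Lim_null_comparison)
    show "((\<lambda>y. L * \<bar>y - x\<bar>) \<longlongrightarrow> 0) (at x within {0..})"
      by (rule tendsto_eq_intros refl | simp)+
    show "\<forall>\<^sub>F y in at x within {0..}. norm ((f y - f x) / (y - x) - D) \<le> L * \<bar>y - x\<bar>"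
      unfolding eventually_at_filter
    proof (intro always_eventually allI impI)
      fix y assume y: "y \<noteq> x" "y \<in> {0..}"
      have "(f y - f x) / (y - x) - D = (f y - f x - D * (y - x)) / (y - x)"
        using y by (simp add: diff_divide_distrib)
      then have "norm ((f y - f x) / (y - x) - D) = \<bar>f y - f x - D * (y - x)\<bar> / \<bar>y - x\<bar>"
        by (simp only: real_norm_def abs_divide)
      also have "\<dots> \<le> L * (y - x)\<^sup>2 / \<bar>y - x\<bar>" using assms[of y] y by (intro divide_right_mono) auto
      also have "(y - x)\<^sup>2 = \<bar>y - x\<bar> * \<bar>y - x\<bar>" by (simp add: power2_eq_square)
      also have "L * (\<bar>y - x\<bar> * \<bar>y - x\<bar>) / \<bar>y - x\<bar> = L * \<bar>y - x\<bar>"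
        using y by (simp only: mult.assoc[symmetric] nonzero_mult_div_cancel_right abs_eq_0 eq_iff_diff_eq_0[symmetric] not_False_eq_True)
      finally show "norm ((f y - f x) / (y - x) - D) \<le> L * \<bar>y - x\<bar>" .
    qed
  qed
  then show ?thesis unfolding has_field_derivative_iff by (rule LIM_zero_cancel)
qed

text \<open>A finite net of \<open>K\<close> reduces the claim to finitely many points. Moving to
  the net costs a quarter of \<open>e\<close> for \<open>f n\<close> and for the limit, which
  inherits the Lipschitz constant, and a quarter is spent on the net itself.\<close>

lemma equi_lipschitz_uniform_limit:
  fixes f :: "nat \<Rightarrow> real \<Rightarrow> real"
  assumes lip: "\<And>n y z. y \<ge> 0 \<Longrightarrow> z \<ge> 0 \<Longrightarrow> \<bar>f n y - f n z\<bar> \<le> L * \<bar>y - z\<bar>"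
    and lim: "\<And>y. y \<ge> 0 \<Longrightarrow> (\<lambda>n. f n y) \<longlonglongrightarrow> F y" and K: "compact K" "K \<subseteq> {0..}"
  shows "uniform_limit K f F sequentially"
proof (rule uniform_limitI)
  fix e :: real assume e: "e > 0"
  define L' where "L' = \<bar>L\<bar> + 1"
  have lip': "\<bar>f n y - f n z\<bar> \<le> L' * \<bar>y - z\<bar>" if "y \<ge> 0" "z \<ge> 0" for n y z
    using order_trans[OF lip[OF that] mult_right_mono[of L L' "\<bar>y - z\<bar>"]] by (simp add: L'_def)
  have limlip: "\<bar>F y - F z\<bar> \<le> L' * \<bar>y - z\<bar>" if "y \<ge> 0" "z \<ge> 0" for y z
  proof (rule LIMSEQ_le_const2)
    show "(\<lambda>n. \<bar>f n y - f n z\<bar>) \<longlonglongrightarrow> \<bar>F y - F z\<bar>" by (intro tendsto_intros lim that)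
  qed (use lip' that in auto)
  define r where "r = e / (4 * L')"
  have L'pos: "L' > 0" by (simp add: L'_def)
  have r: "r > 0" "L' * r = e / 4" using e L'pos by (auto simp: r_def)
  obtain T where T: "T \<subseteq> K" "finite T" "K \<subseteq> (\<Union>t\<in>T. ball t r)"
  proof (rule compactE_image[OF K(1), of K "\<lambda>t. ball t r"])
    show "K \<subseteq> (\<Union>t\<in>K. ball t r)" using r by force
  qed auto
  have "\<forall>\<^sub>F n in sequentially. \<forall>t\<in>T. dist (f n t) (F t) < e / 4"
    using T K e by (intro eventually_ball_finite ballI tendstoD lim) auto
  then show "\<forall>\<^sub>F n in sequentially. \<forall>x\<in>K. dist (f n x) (F x) < e"
  proof eventually_elim
    case (elim n)
    show ?case
    proof
      fix x assume x: "x \<in> K"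
      then obtain t where t: "t \<in> T" "dist t x < r" using T by auto
      have pos: "x \<ge> 0" "t \<ge> 0" using x t T K by auto
      have "L' * \<bar>x - t\<bar> \<le> L' * r" using t L'pos by (intro mult_left_mono) (auto simp: dist_real_def)
      then have "\<bar>f n x - f n t\<bar> \<le> e / 4" "\<bar>F x - F t\<bar> \<le> e / 4"
        using lip'[OF pos, of n] limlip[OF pos] r by linarith+
      moreover have "\<bar>f n t - F t\<bar> < e / 4" using elim t by (simp add: dist_real_def)
      ultimately show "dist (f n x) (F x) < e" using e unfolding dist_real_def by linarith
    qed
  qed
qed

text \<open>The tangent to \<open>ln\<close> at \<open>1 / \<epsilon>\<close>; its slope can be made
  as small as desired.\<close>

lemma ln_le_linear: "ln t \<le> \<epsilon> * t - 1 - ln \<epsilon>" if "t > 0" "\<epsilon> > 0" for t \<epsilon> :: real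
  using ln_le_minus_one[of "\<epsilon> * t"] that by (simp add: ln_mult)

context gibbs_params
begin

lemma gibbs_reward_locally_lipschitz:
  fixes K :: real
  obtains L where "L \<ge> 0"
    "\<And>y z. \<bar>y\<bar> \<le> K \<Longrightarrow> \<bar>z\<bar> \<le> K \<Longrightarrow> \<bar>gibbs_reward lam a y - gibbs_reward lam a z\<bar> \<le> L * \<bar>y - z\<bar>"
proof -
  obtain L where L: "L \<ge> 0" "\<And>y z. \<bar>y\<bar> \<le> K \<Longrightarrow> \<bar>z\<bar> \<le> K \<Longrightarrow> \<bar>m y - m z\<bar> \<le> L * \<bar>y - z\<bar>"
    using gibbs_mean_locally_lipschitz by blast
  show thesis
  proof (rule that[of "a + (1 + \<bar>K\<bar>) * L + a"])
    show "a + (1 + \<bar>K\<bar>) * L + a \<ge> 0" using L a_pos by simp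
    fix y z assume yz: "\<bar>y\<bar> \<le> K" "\<bar>z\<bar> \<le> K"
    have "\<bar>(1 - y) * (m y - m z)\<bar> \<le> (1 + \<bar>K\<bar>) * (L * \<bar>y - z\<bar>)"
      unfolding abs_mult using yz L(1) by (intro mult_mono L(2)) auto
    moreover have "\<bar>(z - y) * m z\<bar> \<le> \<bar>y - z\<bar> * a"
      unfolding abs_mult using gibbs_mean_bounds[of z] by (intro mult_mono) auto
    moreover have "gibbs_reward lam a y - gibbs_reward lam a z = (\<Phi> y - \<Phi> z) + (1 - y) * (m y - m z) + (z - y) * m z"
      by (simp add: gibbs_reward_def algebra_simps)
    ultimately have "\<bar>gibbs_reward lam a y - gibbs_reward lam a z\<bar> \<le> a * \<bar>y - z\<bar> + (1 + \<bar>K\<bar>) * (L * \<bar>y - z\<bar>) + \<bar>y - z\<bar> * a"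
      using log_partition_lipschitz[of y z] by linarith
    then show "\<bar>gibbs_reward lam a y - gibbs_reward lam a z\<bar> \<le> (a + (1 + \<bar>K\<bar>) * L + a) * \<bar>y - z\<bar>"
      by (simp add: algebra_simps)
  qed
qed

lemma gibbs_mean_continuous: "isCont m y"
proof -
  obtain L where L: "L \<ge> 0" "\<And>x z. \<bar>x\<bar> \<le> \<bar>y\<bar> + 1 \<Longrightarrow> \<bar>z\<bar> \<le> \<bar>y\<bar> + 1 \<Longrightarrow> \<bar>m x - m z\<bar> \<le> L * \<bar>x - z\<bar>"
    using gibbs_mean_locally_lipschitz by blast
  have "L-lipschitz_on {y - 1<..<y + 1} m"
    using L by (intro lipschitz_onI) (auto simp: dist_real_def)
  then have "continuous_on {y - 1<..<y + 1} m" by (rule lipschitz_on_continuous_on)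
  then show ?thesis by (rule continuous_on_interior) simp
qed

lemma log_partition_continuous: "isCont \<Phi> y"
proof -
  have "a-lipschitz_on UNIV \<Phi>"
    using a_pos by (intro lipschitz_onI) (auto simp: dist_real_def log_partition_lipschitz)
  from lipschitz_on_continuous_on[OF this] show ?thesis by (simp add: continuous_on_eq_continuous_at)
qed

text \<open>Logarithmic growth in usable form: the bound \<open>K\<close> on the parameter enters
  with an arbitrarily small factor \<open>\<epsilon>\<close>, at the expense of a larger
  constant.\<close>

lemma gibbs_reward_abs:
  assumes "\<epsilon> > 0" "\<bar>y\<bar> \<le> K"
  shows "\<bar>gibbs_reward lam a y\<bar> \<le> a + lam * \<bar>ln a\<bar> + lam * (\<epsilon> / a + \<bar>ln \<epsilon>\<bar>) + \<epsilon> * K"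
proof -
  have t: "1 / a + \<bar>y\<bar> / lam > 0" using a_pos lam_pos by (simp add: add_pos_nonneg)
  have "lam * ln (1 / a + \<bar>y\<bar> / lam) \<le> lam * (\<epsilon> * (1 / a + \<bar>y\<bar> / lam) - 1 - ln \<epsilon>)"
    using ln_le_linear[OF t assms(1)] lam_pos by (intro mult_left_mono) auto
  also have "\<dots> = lam * (\<epsilon> / a - ln \<epsilon>) + \<epsilon> * \<bar>y\<bar> - lam" using lam_pos by (simp add: field_simps)
  also have "\<dots> \<le> lam * (\<epsilon> / a + \<bar>ln \<epsilon>\<bar>) + \<epsilon> * K"
    using lam_pos assms by (intro order_trans[OF diff_left_mono[of 0 lam]]) (auto intro!: add_mono mult_left_mono)
  finally have 1: "lam * ln (1 / a + \<bar>y\<bar> / lam) \<le> lam * (\<epsilon> / a + \<bar>ln \<epsilon>\<bar>) + \<epsilon> * K" .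
  have 2: "0 \<le> a + lam * \<bar>ln a\<bar>" "0 \<le> lam * (\<epsilon> / a + \<bar>ln \<epsilon>\<bar>) + \<epsilon> * K"
    using a_pos lam_pos assms by (auto intro!: add_nonneg_nonneg mult_nonneg_nonneg)
  show ?thesis using gibbs_reward_upper[of y] gibbs_reward_lower[of y] 1 2 by (intro abs_leI) linarith+
qed

end

context relaxed_control
begin

definition ode_coeff :: real where "ode_coeff = 2 / \<sigma>\<^sup>2"

definition second_deriv :: "(real \<Rightarrow> real) \<Rightarrow> (real \<Rightarrow> real) \<Rightarrow> (real \<Rightarrow> real) \<Rightarrow> real \<Rightarrow> real" where
  "second_deriv \<kappa> v v1 y = ode_coeff * (c * v y - gibbs_reward lam a (\<kappa> y) - (\<mu> - m (\<kappa> y)) * v1 y)"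

text \<open>The coefficient of the gradient when the policy equation is solved for the second
  derivative; it plays the role of \<open>A\<close> in \<open>gradient_bound\<close> and is the same
  for all policies.\<close>

definition grad_coeff :: real where "grad_coeff = ode_coeff * (\<bar>\<mu>\<bar> + a)"

text \<open>The largest reward rate, from \<open>gibbs_reward_upper\<close>, discounted over an
  infinite horizon.\<close>

definition value_bound :: real where "value_bound = (a + lam * \<bar>ln a\<bar>) / c"

lemma ode_coeff_pos: "ode_coeff > 0"
  using vol_pos by (simp add: ode_coeff_def)

lemma grad_coeff_pos: "grad_coeff > 0"
  using ode_coeff_pos a_pos by (simp add: grad_coeff_def add_nonneg_pos)

lemma value_bound_nonneg: "value_bound \<ge> 0"
  using a_pos lam_pos disc_pos by (simp add: value_bound_def)

lemma drift_coeff_bound: "\<bar>\<mu> - m z\<bar> \<le> \<bar>\<mu>\<bar> + a"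
  using gibbs_mean_bounds[of z] by linarith

lemma second_deriv_eq: "\<sigma>\<^sup>2 / 2 * second_deriv \<kappa> v v1 y = c * v y - gibbs_reward lam a (\<kappa> y) - (\<mu> - m (\<kappa> y)) * v1 y"
  using vol_pos by (simp add: second_deriv_def ode_coeff_def)

lemma second_deriv_bound:
  assumes "\<bar>v y\<bar> \<le> N" "\<bar>gibbs_reward lam a (\<kappa> y)\<bar> \<le> R"
  shows "\<bar>second_deriv \<kappa> v v1 y\<bar> \<le> grad_coeff * \<bar>v1 y\<bar> + ode_coeff * (c * N + R)"
proof -
  have "\<bar>c * v y\<bar> \<le> c * N" using assms disc_pos by (simp add: abs_mult)
  moreover have "\<bar>(\<mu> - m (\<kappa> y)) * v1 y\<bar> \<le> (\<bar>\<mu>\<bar> + a) * \<bar>v1 y\<bar>"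
    unfolding abs_mult using drift_coeff_bound by (intro mult_right_mono) auto
  ultimately have "\<bar>c * v y - gibbs_reward lam a (\<kappa> y) - (\<mu> - m (\<kappa> y)) * v1 y\<bar> \<le> c * N + R + (\<bar>\<mu>\<bar> + a) * \<bar>v1 y\<bar>"
    using assms(2) by linarith
  then have "ode_coeff * \<bar>c * v y - gibbs_reward lam a (\<kappa> y) - (\<mu> - m (\<kappa> y)) * v1 y\<bar> \<le> ode_coeff * (c * N + R + (\<bar>\<mu>\<bar> + a) * \<bar>v1 y\<bar>)"
    using ode_coeff_pos by (intro mult_left_mono) auto
  moreover have "\<bar>second_deriv \<kappa> v v1 y\<bar> = ode_coeff * \<bar>c * v y - gibbs_reward lam a (\<kappa> y) - (\<mu> - m (\<kappa> y)) * v1 y\<bar>"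
    using ode_coeff_pos unfolding second_deriv_def abs_mult by simp
  moreover have "ode_coeff * (c * N + R + (\<bar>\<mu>\<bar> + a) * \<bar>v1 y\<bar>) = grad_coeff * \<bar>v1 y\<bar> + ode_coeff * (c * N + R)"
    by (simp add: grad_coeff_def algebra_simps)
  ultimately show ?thesis by linarith
qed

text \<open>A predicate with the quantifiers over policies and solutions inside: \<open>Lm\<close>
  and \<open>Lh\<close> depend on \<open>Kb\<close> alone, so one choice serves every
  iterate.\<close>

definition second_deriv_modulus :: "real \<Rightarrow> real \<Rightarrow> real \<Rightarrow> bool" where
  "second_deriv_modulus Kb Lm Lh \<longleftrightarrow> (\<forall>\<kappa> v v1 L\<kappa> D S. (\<forall>y\<ge>0. \<bar>\<kappa> y\<bar> \<le> Kb) \<longrightarrow>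
      (\<forall>y\<ge>0. \<forall>z\<ge>0. \<bar>\<kappa> y - \<kappa> z\<bar> \<le> L\<kappa> * \<bar>y - z\<bar>) \<longrightarrow> (\<forall>y\<ge>0. \<bar>v1 y\<bar> \<le> D) \<longrightarrow>
      (\<forall>y\<ge>0. \<forall>z\<ge>0. \<bar>v y - v z\<bar> \<le> D * \<bar>y - z\<bar>) \<longrightarrow> (\<forall>y\<ge>0. \<forall>z\<ge>0. \<bar>v1 y - v1 z\<bar> \<le> S * \<bar>y - z\<bar>) \<longrightarrow>
      (\<forall>y\<ge>0. \<forall>z\<ge>0. \<bar>second_deriv \<kappa> v v1 y - second_deriv \<kappa> v v1 z\<bar>
        \<le> ode_coeff * (c * D + Lh * L\<kappa> + (\<bar>\<mu>\<bar> + a) * S + Lm * L\<kappa> * D) * \<bar>y - z\<bar>))"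

lemma second_deriv_modulusD:
  assumes "second_deriv_modulus Kb Lm Lh" "\<And>y. y \<ge> 0 \<Longrightarrow> \<bar>\<kappa> y\<bar> \<le> Kb"
    "\<And>y z. y \<ge> 0 \<Longrightarrow> z \<ge> 0 \<Longrightarrow> \<bar>\<kappa> y - \<kappa> z\<bar> \<le> L\<kappa> * \<bar>y - z\<bar>"
    "\<And>y. y \<ge> 0 \<Longrightarrow> \<bar>v1 y\<bar> \<le> D"
    "\<And>y z. y \<ge> 0 \<Longrightarrow> z \<ge> 0 \<Longrightarrow> \<bar>v y - v z\<bar> \<le> D * \<bar>y - z\<bar>"
    "\<And>y z. y \<ge> 0 \<Longrightarrow> z \<ge> 0 \<Longrightarrow> \<bar>v1 y - v1 z\<bar> \<le> S * \<bar>y - z\<bar>" "y \<ge> 0" "z \<ge> 0"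
  shows "\<bar>second_deriv \<kappa> v v1 y - second_deriv \<kappa> v v1 z\<bar>
    \<le> ode_coeff * (c * D + Lh * L\<kappa> + (\<bar>\<mu>\<bar> + a) * S + Lm * L\<kappa> * D) * \<bar>y - z\<bar>"
  by (rule assms(1)[unfolded second_deriv_modulus_def, rule_format]) (use assms(2-) in auto)

lemma second_deriv_modulus_exists: "\<exists>Lm Lh. second_deriv_modulus Kb Lm Lh"
proof -
  obtain Lm where Lm: "Lm \<ge> 0" "\<And>y z. \<bar>y\<bar> \<le> Kb \<Longrightarrow> \<bar>z\<bar> \<le> Kb \<Longrightarrow> \<bar>m y - m z\<bar> \<le> Lm * \<bar>y - z\<bar>"
    using gibbs_mean_locally_lipschitz by blast
  obtain Lh where Lh: "Lh \<ge> 0" "\<And>y z. \<bar>y\<bar> \<le> Kb \<Longrightarrow> \<bar>z\<bar> \<le> Kb \<Longrightarrow> \<bar>gibbs_reward lam a y - gibbs_reward lam a z\<bar> \<le> Lh * \<bar>y - z\<bar>"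
    using gibbs_reward_locally_lipschitz by blast
  have "second_deriv_modulus Kb Lm Lh"
    unfolding second_deriv_modulus_def
  proof (intro allI impI)
    fix \<kappa> v v1 :: "real \<Rightarrow> real" and L\<kappa> D S y z :: real
    assume H: "\<forall>y\<ge>0. \<bar>\<kappa> y\<bar> \<le> Kb" "\<forall>y\<ge>0. \<forall>z\<ge>0. \<bar>\<kappa> y - \<kappa> z\<bar> \<le> L\<kappa> * \<bar>y - z\<bar>"
      "\<forall>y\<ge>0. \<bar>v1 y\<bar> \<le> D" "\<forall>y\<ge>0. \<forall>z\<ge>0. \<bar>v y - v z\<bar> \<le> D * \<bar>y - z\<bar>"
      "\<forall>y\<ge>0. \<forall>z\<ge>0. \<bar>v1 y - v1 z\<bar> \<le> S * \<bar>y - z\<bar>" and yz: "y \<ge> 0" "z \<ge> 0"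
    note \<kappa> = H(1,2)[rule_format] and v1b = H(3)[rule_format] and vl = H(4)[rule_format] and v1l = H(5)[rule_format]
    let ?d = "\<bar>y - z\<bar>"
    have 1: "\<bar>c * (v y - v z)\<bar> \<le> c * (D * ?d)"
      using vl[OF yz] disc_pos by (simp add: abs_mult)
    have 2: "\<bar>gibbs_reward lam a (\<kappa> y) - gibbs_reward lam a (\<kappa> z)\<bar> \<le> Lh * (L\<kappa> * ?d)"
      using Lh(2)[OF \<kappa>(1)[OF yz(1)] \<kappa>(1)[OF yz(2)]] mult_left_mono[OF \<kappa>(2)[OF yz] Lh(1)] by linarith
    have 3: "\<bar>(\<mu> - m (\<kappa> y)) * (v1 y - v1 z)\<bar> \<le> (\<bar>\<mu>\<bar> + a) * (S * ?d)"
      unfolding abs_mult using v1l[OF yz] drift_coeff_bound a_pos by (intro mult_mono) auto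
    have "\<bar>m (\<kappa> y) - m (\<kappa> z)\<bar> \<le> Lm * (L\<kappa> * ?d)"
      using Lm(2)[OF \<kappa>(1)[OF yz(1)] \<kappa>(1)[OF yz(2)]] mult_left_mono[OF \<kappa>(2)[OF yz] Lm(1)] by linarith
    then have 4: "\<bar>(m (\<kappa> y) - m (\<kappa> z)) * v1 z\<bar> \<le> Lm * (L\<kappa> * ?d) * D"
      unfolding abs_mult using v1b[OF yz(2)] by (intro mult_mono) auto
    have "second_deriv \<kappa> v v1 y - second_deriv \<kappa> v v1 z = ode_coeff * (c * (v y - v z)
        - (gibbs_reward lam a (\<kappa> y) - gibbs_reward lam a (\<kappa> z)) - (\<mu> - m (\<kappa> y)) * (v1 y - v1 z)
        + (m (\<kappa> y) - m (\<kappa> z)) * v1 z)"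
      by (simp add: second_deriv_def algebra_simps)
    moreover have "\<bar>c * (v y - v z) - (gibbs_reward lam a (\<kappa> y) - gibbs_reward lam a (\<kappa> z))
        - (\<mu> - m (\<kappa> y)) * (v1 y - v1 z) + (m (\<kappa> y) - m (\<kappa> z)) * v1 z\<bar>
        \<le> c * (D * ?d) + Lh * (L\<kappa> * ?d) + (\<bar>\<mu>\<bar> + a) * (S * ?d) + Lm * (L\<kappa> * ?d) * D"
      using 1 2 3 4 by linarith
    ultimately have "\<bar>second_deriv \<kappa> v v1 y - second_deriv \<kappa> v v1 z\<bar>
        \<le> ode_coeff * (c * (D * ?d) + Lh * (L\<kappa> * ?d) + (\<bar>\<mu>\<bar> + a) * (S * ?d) + Lm * (L\<kappa> * ?d) * D)"
      using ode_coeff_pos by (simp add: abs_mult)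
    then show "\<bar>second_deriv \<kappa> v v1 y - second_deriv \<kappa> v v1 z\<bar>
        \<le> ode_coeff * (c * D + Lh * L\<kappa> + (\<bar>\<mu>\<bar> + a) * S + Lm * L\<kappa> * D) * ?d"
      by (simp add: algebra_simps)
  qed
  then show ?thesis by blast
qed

end

context feedback
begin

abbreviation "J' x \<equiv> Jcl_deriv M W \<mu> \<sigma> c a lam pol x"

text \<open>Shooting gives a bounded solution, the equation gives its derivative bounds, and
  comparison in both directions identifies it with the cost. Regularity of the cost is thus read off
  from the equation.\<close>

lemma policy_evaluation:
  shows "C2_half_line J J' (second_deriv \<kappa> J J')" "\<And>y. y \<ge> 0 \<Longrightarrow> J y \<le> value_bound"
proof -
  let ?h = "\<lambda>y. gibbs_reward lam a (\<kappa> y)" and ?B = "\<lambda>y. \<mu> - m (\<kappa> y)"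
  define R where "R = lam * \<bar>ln a\<bar> + a * Kb + (1 + Kb) * a"
  have "\<bar>L\<kappa>\<bar>-lipschitz_on {0..} \<kappa>"
    by (intro lipschitz_onI) (auto simp: dist_real_def intro!: order_trans[OF \<kappa>_lipschitz] mult_right_mono)
  then have \<kappa>_cont: "continuous_on {0..} \<kappa>" by (rule lipschitz_on_continuous_on)
  have h_cont: "continuous_on {0..} ?h"
    unfolding gibbs_reward_def using log_partition_continuous gibbs_mean_continuous
    by (intro continuous_intros \<kappa>_cont continuous_on_compose2[OF _ \<kappa>_cont, of UNIV \<Phi>]
        continuous_on_compose2[OF _ \<kappa>_cont, of UNIV m]) (auto simp: continuous_on_eq_continuous_at)
  have B_cont: "continuous_on {0..} ?B"
    using gibbs_mean_continuous
    by (intro continuous_intros continuous_on_compose2[OF _ \<kappa>_cont, of UNIV m]) (auto simp: continuous_on_eq_continuous_at)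
  interpret linear_ode ode_coeff c ?B "\<bar>\<mu>\<bar> + a"
    by unfold_locales (rule ode_coeff_pos disc_pos B_cont drift_coeff_bound)+
  have R0: "R \<ge> 0" using reward_bound[of 0] unfolding R_def by linarith
  obtain v v1 where v: "solves ?h v v1" "v 0 = 0" "\<And>x. x \<ge> 0 \<Longrightarrow> - (R / c) \<le> v x" "\<And>x. x \<ge> 0 \<Longrightarrow> v x \<le> value_bound"
  \<comment> \<open>The lower barrier depends on the bound \<open>Kb\<close> of this policy, whereas
    the upper barrier is common to all policies. The uniform lower bound for the iterates comes
    later, from monotonicity.\<close>
  proof (rule bounded_solution[OF h_cont, of "R / c" value_bound])
    show "0 \<le> R / c" using R0 disc_pos by simp
    show "- c * (R / c) \<le> ?h x" if "x \<ge> 0" for x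
      using reward_bound[OF that] disc_pos unfolding R_def[symmetric] by simp
    show "?h x \<le> c * value_bound" for x
      using gibbs_reward_upper[of "\<kappa> x"] disc_pos by (simp add: value_bound_def)
  qed (use value_bound_nonneg in auto)
  define v2 where "v2 = second_deriv \<kappa> v v1"
  have dv: "(v has_real_derivative v1 y) (at y within {0..})" "(v1 has_real_derivative v2 y) (at y within {0..})" if "y \<ge> 0" for y
    using solvesD[OF v(1) that] by (simp_all add: v2_def second_deriv_def)
  define N where "N = R / c + value_bound"
  have N: "\<bar>v y\<bar> \<le> N" if "y \<ge> 0" for y
    using v(3,4)[OF that] R0 disc_pos value_bound_nonneg
    by (auto simp: N_def abs_le_iff) (smt (verit) divide_nonneg_pos)+
  have v2b: "\<bar>v2 y\<bar> \<le> grad_coeff * \<bar>v1 y\<bar> + ode_coeff * (c * N + R)" if "y \<ge> 0" for y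
    unfolding v2_def using N[OF that] reward_bound[OF that] by (intro second_deriv_bound) (auto simp: R_def)
  define D where "D = 8 * grad_coeff * N + ode_coeff * (c * N + R) / grad_coeff"
  have D: "\<bar>v1 y\<bar> \<le> D" if "y \<ge> 0" for y
    unfolding D_def by (rule gradient_bound[OF dv N v2b grad_coeff_pos that])
  define S where "S = grad_coeff * D + ode_coeff * (c * N + R)"
  have S: "\<bar>v2 y\<bar> \<le> S" if "y \<ge> 0" for y
    using v2b[OF that] mult_left_mono[OF D[OF that] less_imp_le[OF grad_coeff_pos]] unfolding S_def by linarith
  obtain Lm Lh where lip: "second_deriv_modulus Kb Lm Lh" using second_deriv_modulus_exists by blast
  define L where "L = ode_coeff * (c * D + Lh * L\<kappa> + (\<bar>\<mu>\<bar> + a) * S + Lm * L\<kappa> * D)"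
  have L: "\<bar>v2 y - v2 z\<bar> \<le> L * \<bar>y - z\<bar>" if "y \<ge> 0" "z \<ge> 0" for y z
    unfolding v2_def L_def
    by (rule second_deriv_modulusD[OF lip \<kappa>_bound \<kappa>_lipschitz D lipschitz_of_derivative_bound[OF dv(1) D]
          lipschitz_of_derivative_bound[OF dv(2) S] that])
  define K where "K = max (max N D) (max S L)"
  have LK: "L * \<bar>y - z\<bar> \<le> K * \<bar>y - z\<bar>" for y z by (intro mult_right_mono) (auto simp: K_def)
  have C2: "C2_half_line v v1 v2"
    unfolding C2_half_line_def
    using v(2) dv N D S order_trans[OF L LK] by (intro conjI exI[of _ K]) (auto simp: K_def le_max_iff_disj)
  have "v y = J y" if y: "y \<ge> 0" for y
  proof (rule antisym)
    show "v y \<le> J y" by (rule Jcl_ge[OF C2 y]) (unfold v2_def second_deriv_eq, simp)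
    show "J y \<le> v y" by (rule Jcl_le[OF C2 y]) (unfold v2_def second_deriv_eq, simp)
  qed
  note vJ = this
  have dJ: "(J has_real_derivative v1 y) (at y within {0..})" if "y \<ge> 0" for y
    by (rule has_field_derivative_transform_within[OF dv(1)[OF that], where d = 1]) (use that vJ in auto)
  have v1J: "v1 y = J' y" if y: "y \<ge> 0" for y
    unfolding Jcl_deriv_def
  proof (rule vector_derivative_within[symmetric])
    \<comment> \<open>\<open>Jcl_deriv\<close> is a \<open>vector_derivative\<close>, which is
      determined only for a nontrivial filter; at the endpoint 0 the right-hand filter ensures
      this.\<close>
    show "at y within {0..} \<noteq> bot"
    proof
      assume "at y within {0..} = bot"
      moreover have "at_right y \<le> at y within {0..}" using y by (intro at_le) auto
      ultimately have "at_right y = bot" by (simp only: bot_unique)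
      then show False using trivial_limit_at_right_real[of y] by simp
    qed
    show "(J has_vector_derivative v1 y) (at y within {0..})"
      using dJ[OF y] by (simp add: has_real_derivative_iff_has_vector_derivative)
  qed
  show "J y \<le> value_bound" if "y \<ge> 0" for y using v(4)[OF that] vJ[OF that] by simp
  have v2J: "v2 y = second_deriv \<kappa> J J' y" if "y \<ge> 0" for y
    using vJ[OF that] v1J[OF that] by (simp add: v2_def second_deriv_def)
  have dJ': "(J' has_real_derivative second_deriv \<kappa> J J' y) (at y within {0..})" if "y \<ge> 0" for y
    using v2J[OF that]
    by (subst v2J[OF that, symmetric], intro has_field_derivative_transform_within[OF dv(2)[OF that], where d = 1])
       (use that v1J in auto)
  show "C2_half_line J J' (second_deriv \<kappa> J J')"
    unfolding C2_half_line_def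
  proof (intro conjI exI[of _ K] allI impI)
    show "J 0 = 0" using vJ[of 0] v(2) by simp
    fix y :: real assume y: "0 \<le> y"
    show "(J has_real_derivative J' y) (at y within {0..})" using dJ[OF y] v1J[OF y] by simp
    show "(J' has_real_derivative second_deriv \<kappa> J J' y) (at y within {0..})" by (rule dJ'[OF y])
    show "\<bar>J y\<bar> \<le> K" "\<bar>J' y\<bar> \<le> K" "\<bar>second_deriv \<kappa> J J' y\<bar> \<le> K"
      using N[OF y] D[OF y] S[OF y] vJ[OF y] v1J[OF y] v2J[OF y] by (auto simp: K_def le_max_iff_disj)
    fix z :: real assume z: "0 \<le> z"
    show "\<bar>second_deriv \<kappa> J J' y - second_deriv \<kappa> J J' z\<bar> \<le> K * \<bar>y - z\<bar>"
      using order_trans[OF L[OF y z] LK] v2J[OF y] v2J[OF z] by simp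
  qed
qed

end

section \<open>Policy iteration\<close>

locale policy_iteration = relaxed_control M W lam a \<mu> \<sigma> c
  for M :: "'a measure" and W and lam a \<mu> \<sigma> c :: real +
  fixes \<kappa>0 :: "real \<Rightarrow> real" and pol :: "nat \<Rightarrow> real \<Rightarrow> real \<Rightarrow> real" and K0 L0 :: real
  assumes \<kappa>0_bound: "\<And>y. y \<ge> 0 \<Longrightarrow> \<bar>\<kappa>0 y\<bar> \<le> K0"
    and \<kappa>0_lipschitz: "\<And>y z. y \<ge> 0 \<Longrightarrow> z \<ge> 0 \<Longrightarrow> \<bar>\<kappa>0 y - \<kappa>0 z\<bar> \<le> L0 * \<bar>y - z\<bar>"
    and pol_0: "\<And>w y. y \<ge> 0 \<Longrightarrow> pol 0 w y = Gibbs lam a w (\<kappa>0 y)"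
    and J_0_nonneg: "\<And>y. y \<ge> 0 \<Longrightarrow> Jcl M W \<mu> \<sigma> c a lam y (pol 0) \<ge> 0"
    and pol_Suc: "\<And>n w y. y \<ge> 0 \<Longrightarrow>
      pol (Suc n) w y = Gibbs lam a w (1 - Jcl_deriv M W \<mu> \<sigma> c a lam (pol n) y)"
begin

definition v :: "nat \<Rightarrow> real \<Rightarrow> real" where "v n y = Jcl M W \<mu> \<sigma> c a lam y (pol n)"
definition d :: "nat \<Rightarrow> real \<Rightarrow> real" where "d n y = Jcl_deriv M W \<mu> \<sigma> c a lam (pol n) y"
definition kap :: "nat \<Rightarrow> real \<Rightarrow> real" where
  "kap n y = (case n of 0 \<Rightarrow> \<kappa>0 y | Suc k \<Rightarrow> 1 - d k y)"
definition s :: "nat \<Rightarrow> real \<Rightarrow> real" where "s n = second_deriv (kap n) (v n) (d n)"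

text \<open>Applied to the iterates and again to their limit: bounds on the first and second
  derivative make \<open>1 - u1\<close> an admissible parameter function.\<close>

lemma feedback_of_C2:
  assumes "C2_half_line u u1 u2" "\<And>w y. y \<ge> 0 \<Longrightarrow> p w y = Gibbs lam a w (1 - u1 y)"
  obtains Kb L\<kappa> where "feedback M W lam a \<sigma> c (\<lambda>y. 1 - u1 y) p Kb L\<kappa>"
proof -
  obtain K where K: "\<And>y. y \<ge> 0 \<Longrightarrow> (u1 has_real_derivative u2 y) (at y within {0..})"
    "\<And>y. y \<ge> 0 \<Longrightarrow> \<bar>u1 y\<bar> \<le> K" "\<And>y. y \<ge> 0 \<Longrightarrow> \<bar>u2 y\<bar> \<le> K"
    using assms(1) unfolding C2_half_line_def by blast
  have "feedback M W lam a \<sigma> c (\<lambda>y. 1 - u1 y) p (1 + K) K"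
  proof
    show "p w y = G w (1 - u1 y)" if "y \<ge> 0" for w y using assms(2)[OF that] .
    show "\<bar>1 - u1 y\<bar> \<le> 1 + K" if "y \<ge> 0" for y using K(2)[OF that] by linarith
    show "\<bar>1 - u1 y - (1 - u1 z)\<bar> \<le> K * \<bar>y - z\<bar>" if "y \<ge> 0" "z \<ge> 0" for y z
      using lipschitz_of_derivative_bound[OF K(1,3) that] by (simp add: abs_minus_commute)
  qed
  then show thesis by (rule that)
qed

text \<open>The two claims support each other: regularity of \<open>v n\<close> makes the next
  parameter \<open>1 - d n\<close> bounded and Lipschitz, and a policy with such a parameter has a
  regular cost.\<close>

lemma iterate:
  "(\<exists>Kb L\<kappa>. feedback M W lam a \<sigma> c (kap n) (pol n) Kb L\<kappa>) \<and> C2_half_line (v n) (d n) (s n)"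
proof (induction n)
  case 0
  have "feedback M W lam a \<sigma> c (kap 0) (pol 0) K0 L0"
    by unfold_locales (auto simp: kap_def pol_0 \<kappa>0_bound \<kappa>0_lipschitz)
  moreover from feedback.policy_evaluation(1)[OF this, of \<mu>] have "C2_half_line (v 0) (d 0) (s 0)"
    by (simp add: v_def[abs_def] d_def[abs_def] s_def)
  ultimately show ?case by blast
next
  case (Suc n)
  have eq: "kap (Suc n) = (\<lambda>y. 1 - d n y)" by (simp add: kap_def fun_eq_iff)
  have "C2_half_line (v n) (d n) (s n)" using Suc by blast
  moreover have "pol (Suc n) w y = G w (1 - d n y)" if "y \<ge> 0" for w y
    using pol_Suc[OF that] by (simp add: d_def)
  ultimately obtain Kb L\<kappa> where fb: "feedback M W lam a \<sigma> c (kap (Suc n)) (pol (Suc n)) Kb L\<kappa>"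
    unfolding eq by (rule feedback_of_C2)
  from feedback.policy_evaluation(1)[OF fb, of \<mu>]
  have "C2_half_line (v (Suc n)) (d (Suc n)) (s (Suc n))"
    by (simp add: v_def[abs_def] d_def[abs_def] s_def)
  with fb show ?case by blast
qed

lemma C2_iterate: "C2_half_line (v n) (d n) (s n)" using iterate by blast

lemma derivs:
  assumes "y \<ge> 0"
  shows "(v n has_real_derivative d n y) (at y within {0..})" "(d n has_real_derivative s n y) (at y within {0..})"
  using C2_iterate[of n] assms unfolding C2_half_line_def by blast+

lemma ode: "\<sigma>\<^sup>2 / 2 * s n y = c * v n y - gibbs_reward lam a (kap n y) - (\<mu> - m (kap n y)) * d n y"
  unfolding s_def by (rule second_deriv_eq)


text \<open>The old value is a subsolution of the equation for the new policy, since by convexity the tangent to \<open>\<Phi>\<close> at the old parameter lies below \<open>\<Phi>\<close>.\<close>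

lemma mono_step:
  assumes x: "x \<ge> 0"
  shows "v n x \<le> v (Suc n) x"
proof -
  obtain Kb L\<kappa> where "feedback M W lam a \<sigma> c (kap (Suc n)) (pol (Suc n)) Kb L\<kappa>" using iterate by blast
  then interpret fb: feedback M W lam a \<mu> \<sigma> c "kap (Suc n)" "pol (Suc n)" Kb L\<kappa> .
  show ?thesis unfolding v_def[of "Suc n"]
  proof (rule fb.Jcl_ge[OF C2_iterate x])
    fix y :: real
    have k: "kap (Suc n) y = 1 - d n y" by (simp add: kap_def)
    have "\<Phi> (kap n y) + m (kap n y) * (1 - d n y - kap n y) \<le> \<Phi> (1 - d n y)" by (rule log_partition_convex)
    then show "0 \<le> \<sigma>\<^sup>2 / 2 * s n y + (\<mu> - m (kap (Suc n) y)) * d n y - c * v n y + gibbs_reward lam a (kap (Suc n) y)"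
      unfolding ode k gibbs_reward_def by (simp add: algebra_simps)
  qed
qed

text \<open>The assumption that the initial cost is nonnegative propagates by monotonicity. The
  resulting bounds are independent of \<open>n\<close>, which the uniform gradient estimate relies
  on.\<close>

lemma v_bounds:
  assumes "x \<ge> 0"
  shows "0 \<le> v n x" "v n x \<le> value_bound"
proof -
  show "0 \<le> v n x"
  proof (induction n)
    case 0 then show ?case using J_0_nonneg[OF assms] by (simp add: v_def)
  next
    case (Suc n) then show ?case using mono_step[OF assms, of n] by linarith
  qed
  obtain Kb L\<kappa> where fb: "feedback M W lam a \<sigma> c (kap n) (pol n) Kb L\<kappa>" using iterate by blast
  show "v n x \<le> value_bound"
    unfolding v_def by (rule feedback.policy_evaluation(2)[OF fb assms])
qed

text \<open>The running reward of a Gibbs control grows only logarithmically in its parameter, so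
  the gradient estimate is a contraction in the bound for the previous gradient.\<close>

lemma uniform_gradient_bound: obtains D where "D \<ge> 0" "\<And>n y. y \<ge> 0 \<Longrightarrow> \<bar>d n y\<bar> \<le> D"
proof -
  \<comment> \<open>With this slope the previous gradient bound enters the new estimate with the
    factor \<open>ode_coeff * \<epsilon> / grad_coeff = 1 / 2\<close>.\<close>
  define \<epsilon> where "\<epsilon> = grad_coeff / (2 * ode_coeff)"
  have \<epsilon>: "\<epsilon> > 0" using grad_coeff_pos ode_coeff_pos by (simp add: \<epsilon>_def)
  define Q where "Q = a + lam * \<bar>ln a\<bar> + lam * (\<epsilon> / a + \<bar>ln \<epsilon>\<bar>)"
  define C where "C = 8 * grad_coeff * value_bound + ode_coeff * (c * value_bound + Q) / grad_coeff"
  obtain D0 where D0: "\<And>y. y \<ge> 0 \<Longrightarrow> \<bar>d 0 y\<bar> \<le> D0"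
    using C2_iterate[of 0] unfolding C2_half_line_def by blast
  \<comment> \<open>\<open>2 * C + 1\<close> is the fixed point of
    \<open>D \<mapsto> C + (1 + D) / 2\<close>; the other entries start the induction and keep
    \<open>D\<close> nonnegative.\<close>
  define D where "D = max (max D0 0) (2 * C + 1)"
  have "\<bar>d n y\<bar> \<le> D" if "y \<ge> 0" for n y
    using that
  proof (induction n arbitrary: y)
    case 0
    then show ?case using D0[of y] by (simp add: D_def)
  next
    case (Suc n)
    have rew: "\<bar>gibbs_reward lam a (kap (Suc n) y)\<bar> \<le> Q + \<epsilon> * (1 + D)" if "y \<ge> 0" for y
      unfolding Q_def using Suc.IH[OF that] by (intro gibbs_reward_abs \<epsilon>) (auto simp: kap_def)
    have "\<bar>d (Suc n) y\<bar> \<le> 8 * grad_coeff * value_bound + ode_coeff * (c * value_bound + (Q + \<epsilon> * (1 + D))) / grad_coeff"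
    proof (rule gradient_bound[OF derivs(1) derivs(2) _ _ grad_coeff_pos Suc.prems])
      fix t :: real assume t: "t \<ge> 0"
      show vb: "\<bar>v (Suc n) t\<bar> \<le> value_bound" using v_bounds[OF t, of "Suc n"] by simp
      show "\<bar>s (Suc n) t\<bar> \<le> grad_coeff * \<bar>d (Suc n) t\<bar> + ode_coeff * (c * value_bound + (Q + \<epsilon> * (1 + D)))"
        unfolding s_def using vb rew[OF t] by (rule second_deriv_bound)
    qed
    also have "\<dots> = C + ode_coeff * \<epsilon> / grad_coeff * (1 + D)"
      by (simp add: C_def add_divide_distrib distrib_left)
    also have "ode_coeff * \<epsilon> / grad_coeff = 1 / 2" using grad_coeff_pos ode_coeff_pos by (simp add: \<epsilon>_def)
    also have "C + 1 / 2 * (1 + D) \<le> D"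
    proof -
      have "2 * C + 1 \<le> D" by (simp add: D_def)
      then show ?thesis by (simp add: field_simps)
    qed
    finally show ?case .
  qed
  then show thesis using that[of D] by (simp add: D_def)
qed

text \<open>From the uniform gradient bound the others follow through the equation: parameter and
  reward are bounded, hence the second derivative; then the parameter is uniformly Lipschitz, hence
  the second derivative too.\<close>

lemma uniform_regularity:
  "\<exists>D S L. D \<ge> 0 \<and> S \<ge> 0 \<and> L \<ge> 0 \<and> (\<forall>n. \<forall>y\<ge>0. \<bar>d n y\<bar> \<le> D) \<and> (\<forall>n. \<forall>y\<ge>0. \<bar>s n y\<bar> \<le> S) \<and>
    (\<forall>n. \<forall>y\<ge>0. \<forall>z\<ge>0. \<bar>s n y - s n z\<bar> \<le> L * \<bar>y - z\<bar>)"
proof -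
  obtain D where D: "D \<ge> 0" "\<And>n y. y \<ge> 0 \<Longrightarrow> \<bar>d n y\<bar> \<le> D" using uniform_gradient_bound by blast
  define Kb where "Kb = max K0 (1 + D)"
  have Kb: "\<bar>kap n y\<bar> \<le> Kb" if "y \<ge> 0" for n y
    using \<kappa>0_bound[OF that] D(2)[OF that, of "n - 1"] by (cases n) (auto simp: kap_def Kb_def)
  define R where "R = a + lam * \<bar>ln a\<bar> + lam * (1 / a + \<bar>ln 1\<bar>) + 1 * Kb"
  have R: "\<bar>gibbs_reward lam a (kap n y)\<bar> \<le> R" if "y \<ge> 0" for n y
    unfolding R_def by (rule gibbs_reward_abs[OF _ Kb[OF that]]) simp
  define S where "S = grad_coeff * D + ode_coeff * (c * value_bound + R)"
  have S: "\<bar>s n y\<bar> \<le> S" if y: "y \<ge> 0" for n y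
  proof -
    have "\<bar>v n y\<bar> \<le> value_bound" using v_bounds[OF y, of n] by simp
    then have "\<bar>s n y\<bar> \<le> grad_coeff * \<bar>d n y\<bar> + ode_coeff * (c * value_bound + R)"
      unfolding s_def using R[OF y] by (rule second_deriv_bound)
    then show ?thesis using mult_left_mono[OF D(2)[OF y, of n] less_imp_le[OF grad_coeff_pos]]
      unfolding S_def by linarith
  qed
  define L\<kappa> where "L\<kappa> = max L0 S"
  have d_lip: "\<bar>d n y - d n z\<bar> \<le> S * \<bar>y - z\<bar>" if "y \<ge> 0" "z \<ge> 0" for n y z
    by (rule lipschitz_of_derivative_bound[OF derivs(2) S that])
  have L\<kappa>: "\<bar>kap n y - kap n z\<bar> \<le> L\<kappa> * \<bar>y - z\<bar>" if "y \<ge> 0" "z \<ge> 0" for n y z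
  proof (cases n)
    case 0
    have "\<bar>kap n y - kap n z\<bar> \<le> L0 * \<bar>y - z\<bar>" using \<kappa>0_lipschitz[OF that] 0 by (simp add: kap_def)
    also have "\<dots> \<le> L\<kappa> * \<bar>y - z\<bar>" by (intro mult_right_mono) (auto simp: L\<kappa>_def)
    finally show ?thesis .
  next
    case (Suc k)
    have "\<bar>kap n y - kap n z\<bar> \<le> S * \<bar>y - z\<bar>" using d_lip[OF that, of k] Suc by (simp add: kap_def abs_minus_commute)
    also have "\<dots> \<le> L\<kappa> * \<bar>y - z\<bar>" by (intro mult_right_mono) (auto simp: L\<kappa>_def)
    finally show ?thesis .
  qed
  obtain Lm Lh where lip: "second_deriv_modulus Kb Lm Lh" using second_deriv_modulus_exists by blast
  define L where "L = ode_coeff * (c * D + Lh * L\<kappa> + (\<bar>\<mu>\<bar> + a) * S + Lm * L\<kappa> * D)"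
  have L: "\<bar>s n y - s n z\<bar> \<le> L * \<bar>y - z\<bar>" if "y \<ge> 0" "z \<ge> 0" for n y z
    unfolding s_def L_def
    by (rule second_deriv_modulusD[OF lip Kb L\<kappa> D(2) lipschitz_of_derivative_bound[OF derivs(1) D(2)] d_lip that])
  have S0: "S \<ge> 0" using S[of 0 0] by (rule order_trans[OF abs_ge_zero]) simp
  have L0: "L \<ge> 0" using order_trans[OF abs_ge_zero L[of 0 1 0]] by simp
  show ?thesis using D(1) S0 L0 D(2) S L by blast
qed

section \<open>The limit of the iterates and the HJB equation\<close>

definition V :: "real \<Rightarrow> real" where "V y = lim (\<lambda>n. v n y)"
definition V1 :: "real \<Rightarrow> real" where "V1 y = lim (\<lambda>n. d n y)"
text \<open>The second derivative as dictated by the HJB equation; \<open>s_limit\<close> identifies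
  it with the limit of the \<open>s n\<close>.\<close>

definition V2 :: "real \<Rightarrow> real" where
  "V2 y = ode_coeff * (c * V y - \<mu> * V1 y - \<Phi> (1 - V1 y))"

lemma v_limit: "y \<ge> 0 \<Longrightarrow> (\<lambda>n. v n y) \<longlonglongrightarrow> V y"
proof -
  assume y: "y \<ge> 0"
  have "incseq (\<lambda>n. v n y)" using mono_step[OF y] by (intro incseq_SucI)
  from incseq_convergent[OF this] v_bounds(2)[OF y] obtain L where "(\<lambda>n. v n y) \<longlonglongrightarrow> L" by blast
  then show ?thesis unfolding V_def by (metis limI)
qed

text \<open>The values converge and the second derivatives are uniformly bounded, so interpolation
  over a short step makes the gradients Cauchy.\<close>

lemma d_limit:
  assumes y: "y \<ge> 0" shows "(\<lambda>n. d n y) \<longlonglongrightarrow> V1 y"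
proof -
  from uniform_regularity obtain S where S': "S \<ge> 0" "\<forall>n. \<forall>y\<ge>0. \<bar>s n y\<bar> \<le> S" by blast
  note S = S'(1) S'(2)[rule_format]
  have "Cauchy (\<lambda>n. d n y)"
  proof (rule metric_CauchyI)
    fix e :: real assume e: "e > 0"
    \<comment> \<open>The step makes the curvature term \<open>2 * S * r\<close> at most
      \<open>e / 2\<close>; for this \<open>r\<close> the difference quotient is then at most
      \<open>e / 4\<close> for large indices.\<close>
    define r where "r = e / (4 * (S + 1))"
    have r: "r > 0" using e S by (simp add: r_def)
    have Sr: "2 * S * r \<le> e / 2"
    proof -
      have "2 * S * r \<le> 2 * (S + 1) * r" using r by (intro mult_right_mono) auto
      also have "\<dots> = e / 2" using S by (simp add: r_def field_simps)
      finally show ?thesis .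
    qed
    have yr: "y + r \<ge> 0" using y r by simp
    have "Cauchy (\<lambda>n. v n (y + r) - v n y)"
      by (rule LIMSEQ_imp_Cauchy[OF tendsto_diff[OF v_limit[OF yr] v_limit[OF y]]])
    then obtain N where N: "\<And>i j. i \<ge> N \<Longrightarrow> j \<ge> N \<Longrightarrow>
        dist (v i (y + r) - v i y) (v j (y + r) - v j y) < e / 4 * r"
      using e r unfolding Cauchy_def by (metis divide_pos_pos mult_pos_pos zero_less_numeral)
    show "\<exists>N. \<forall>i\<ge>N. \<forall>j\<ge>N. dist (d i y) (d j y) < e"
    proof (intro exI allI impI)
      fix i j assume ij: "i \<ge> N" "j \<ge> N"
      let ?g = "\<lambda>t. v i t - v j t"
      have "\<bar>d i y - d j y\<bar> \<le> \<bar>?g (y + r) - ?g y\<bar> / r + 2 * S * r"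
      proof (rule derivative_interpolation[where ?v2.0 = "\<lambda>t. s i t - s j t", OF _ _ _ y r])
        show "(?g has_real_derivative d i t - d j t) (at t within {0..})"
          "((\<lambda>t. d i t - d j t) has_real_derivative s i t - s j t) (at t within {0..})" if "t \<ge> 0" for t
          by (intro DERIV_diff derivs that)+
        show "\<bar>s i t - s j t\<bar> \<le> 2 * S" if "t \<ge> 0" for t
          using S(2)[OF that, of i] S(2)[OF that, of j] by linarith
      qed
      also have "\<bar>?g (y + r) - ?g y\<bar> / r \<le> e / 4"
        using N[OF ij] r by (simp add: dist_real_def divide_le_eq algebra_simps less_imp_le)
      finally show "dist (d i y) (d j y) < e" using Sr e unfolding dist_real_def by linarith
    qed
  qed
  then have "convergent (\<lambda>n. d n y)" by (simp add: Cauchy_convergent_iff)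
  then show ?thesis unfolding V1_def by (simp add: convergent_LIMSEQ_iff)
qed

text \<open>In the equation for \<open>v (Suc n)\<close> the policy comes from \<open>d n\<close>,
  the gradient is \<open>d (Suc n)\<close>. Both have the limit \<open>V1\<close>, so the terms with
  \<open>m\<close> cancel and the linear policy equations turn into the nonlinear HJB
  equation.\<close>

lemma s_limit:
  assumes y: "y \<ge> 0" shows "(\<lambda>n. s n y) \<longlonglongrightarrow> V2 y"
proof -
  have k: "(\<lambda>n. kap (Suc n) y) \<longlonglongrightarrow> 1 - V1 y"
    unfolding kap_def by (simp, intro tendsto_intros d_limit y)
  note lims = isCont_tendsto_compose[OF gibbs_mean_continuous k] isCont_tendsto_compose[OF log_partition_continuous k]
    LIMSEQ_Suc[OF v_limit[OF y]] LIMSEQ_Suc[OF d_limit[OF y]] k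
  let ?l = "ode_coeff * (c * V y - (\<Phi> (1 - V1 y) + (1 - (1 - V1 y)) * m (1 - V1 y)) - (\<mu> - m (1 - V1 y)) * V1 y)"
  have "(\<lambda>n. s (Suc n) y) \<longlonglongrightarrow> ?l"
    unfolding s_def second_deriv_def gibbs_reward_def by (intro tendsto_intros lims)
  moreover have "?l = V2 y" by (simp add: V2_def algebra_simps)
  ultimately have "(\<lambda>n. s (Suc n) y) \<longlonglongrightarrow> V2 y" by simp
  then show ?thesis by (rule LIMSEQ_imp_Suc)
qed

lemma C2_V: "C2_half_line V V1 V2"
proof -
  from uniform_regularity obtain D S L where *: "D \<ge> 0" "S \<ge> 0" "L \<ge> 0" and R: "\<forall>n. \<forall>y\<ge>0. \<bar>d n y\<bar> \<le> D"
    "\<forall>n. \<forall>y\<ge>0. \<bar>s n y\<bar> \<le> S" "\<forall>n. \<forall>y\<ge>0. \<forall>z\<ge>0. \<bar>s n y - s n z\<bar> \<le> L * \<bar>y - z\<bar>"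
    by blast
  note D = R(1)[rule_format] and S = R(2)[rule_format] and L = R(3)[rule_format]
  have d_lip: "\<bar>d n y - d n z\<bar> \<le> S * \<bar>y - z\<bar>" if "y \<ge> 0" "z \<ge> 0" for n y z
    by (rule lipschitz_of_derivative_bound[OF derivs(2) S that])
  have dV: "(V has_real_derivative V1 x) (at x within {0..})" if x: "x \<ge> 0" for x
  proof (rule has_real_derivative_of_quadratic_remainder)
    fix y :: real assume y: "y \<ge> 0"
    show "\<bar>V y - V x - V1 x * (y - x)\<bar> \<le> S * (y - x)\<^sup>2"
    proof (rule LIMSEQ_le_const2)
      show "(\<lambda>n. \<bar>v n y - v n x - d n x * (y - x)\<bar>) \<longlonglongrightarrow> \<bar>V y - V x - V1 x * (y - x)\<bar>"
        by (intro tendsto_intros v_limit d_limit x y)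
    qed (use quadratic_remainder[OF derivs(1) d_lip x y] in auto)
  qed
  have dV1: "(V1 has_real_derivative V2 x) (at x within {0..})" if x: "x \<ge> 0" for x
  proof (rule has_real_derivative_of_quadratic_remainder)
    fix y :: real assume y: "y \<ge> 0"
    show "\<bar>V1 y - V1 x - V2 x * (y - x)\<bar> \<le> L * (y - x)\<^sup>2"
    proof (rule LIMSEQ_le_const2)
      show "(\<lambda>n. \<bar>d n y - d n x - s n x * (y - x)\<bar>) \<longlonglongrightarrow> \<bar>V1 y - V1 x - V2 x * (y - x)\<bar>"
        by (intro tendsto_intros s_limit d_limit x y)
    qed (use quadratic_remainder[OF derivs(2) L x y] in auto)
  qed
  have Vb: "\<bar>V y\<bar> \<le> value_bound" if "y \<ge> 0" for y
    by (rule LIMSEQ_le_const2[OF tendsto_rabs[OF v_limit[OF that]]]) (use v_bounds[OF that] in auto)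
  have V1b: "\<bar>V1 y\<bar> \<le> D" if "y \<ge> 0" for y
    by (rule LIMSEQ_le_const2[OF tendsto_rabs[OF d_limit[OF that]]]) (use D[OF that] in auto)
  have V2b: "\<bar>V2 y\<bar> \<le> S" if "y \<ge> 0" for y
    by (rule LIMSEQ_le_const2[OF tendsto_rabs[OF s_limit[OF that]]]) (use S[OF that] in auto)
  have V2l: "\<bar>V2 y - V2 z\<bar> \<le> L * \<bar>y - z\<bar>" if "y \<ge> 0" "z \<ge> 0" for y z
    by (rule LIMSEQ_le_const2[OF tendsto_rabs[OF tendsto_diff[OF s_limit[OF that(1)] s_limit[OF that(2)]]]])
      (use L[OF that] in auto)
  have "v n 0 = 0" for n using C2_iterate[of n] by (simp add: C2_half_line_def)
  then have V0: "V 0 = 0" using LIMSEQ_unique[OF v_limit[of 0], of 0] by simp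
  define K where "K = value_bound + D + S + L"
  have KL: "L * \<bar>y - z\<bar> \<le> K * \<bar>y - z\<bar>" for y z
    using * value_bound_nonneg by (intro mult_right_mono) (auto simp: K_def)
  show ?thesis unfolding C2_half_line_def
  proof (intro conjI exI[of _ K] allI impI)
    show "V 0 = 0" by (rule V0)
    fix y :: real assume y: "0 \<le> y"
    show "(V has_real_derivative V1 y) (at y within {0..})" "(V1 has_real_derivative V2 y) (at y within {0..})"
      by (rule dV dV1, rule y)+
    show "\<bar>V y\<bar> \<le> K" "\<bar>V1 y\<bar> \<le> K" "\<bar>V2 y\<bar> \<le> K"
      using Vb[OF y] V1b[OF y] V2b[OF y] * value_bound_nonneg unfolding K_def by linarith+
    fix z :: real assume z: "0 \<le> z"
    show "\<bar>V2 y - V2 z\<bar> \<le> K * \<bar>y - z\<bar>" using order_trans[OF V2l[OF y z] KL] .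
  qed
qed

lemma hjb: "\<sigma>\<^sup>2 / 2 * V2 y + \<mu> * V1 y - c * V y + \<Phi> (1 - V1 y) = 0"
  using vol_pos by (simp add: V2_def ode_coeff_def field_simps)

text \<open>At the parameter \<open>1 - V1 y\<close> the tangent touches \<open>\<Phi>\<close>, so
  the linear equation of this policy coincides with the HJB equation and comparison gives equality;
  \<open>hjb_upper\<close> bounds all other controls. \<open>p\<close> is prescribed on the
  half-line only, leaving its extension free.\<close>

lemma optimal_feedback:
  assumes p: "\<And>w y. y \<ge> 0 \<Longrightarrow> p w y = Gibbs lam a w (1 - V1 y)" and x: "x \<ge> 0"
  shows "admissible M W \<mu> \<sigma> c a lam x (induced_control W \<mu> \<sigma> a x p)"
    "Jcl M W \<mu> \<sigma> c a lam x p = V x" "value_fn M W \<mu> \<sigma> c a lam x = ereal (V x)"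
proof -
  obtain Kb L\<kappa> where "feedback M W lam a \<sigma> c (\<lambda>y. 1 - V1 y) p Kb L\<kappa>"
    using C2_V p by (rule feedback_of_C2)
  then interpret fb: feedback M W lam a \<mu> \<sigma> c "\<lambda>y. 1 - V1 y" p Kb L\<kappa> .
  have eq: "\<sigma>\<^sup>2 / 2 * V2 y + (\<mu> - m (1 - V1 y)) * V1 y - c * V y + gibbs_reward lam a (1 - V1 y) = 0" for y
    using hjb[of y] by (simp add: gibbs_reward_def algebra_simps)
  show adm: "admissible M W \<mu> \<sigma> c a lam x (induced_control W \<mu> \<sigma> a x p)" by (rule fb.ctl_admissible)
  show J: "Jcl M W \<mu> \<sigma> c a lam x p = V x"
    by (rule antisym) (rule fb.Jcl_le[OF C2_V x] fb.Jcl_ge[OF C2_V x], simp only: eq order_refl)+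
  show "value_fn M W \<mu> \<sigma> c a lam x = ereal (V x)"
    unfolding value_fn_def
  proof (rule antisym)
    show "(SUP \<pi>\<in>{\<pi>. admissible M W \<mu> \<sigma> c a lam x \<pi>}. ereal (Jol M W \<mu> \<sigma> c a lam x \<pi>)) \<le> ereal (V x)"
      using hjb_upper[OF C2_V _ x] hjb by (intro SUP_least) auto
    show "ereal (V x) \<le> (SUP \<pi>\<in>{\<pi>. admissible M W \<mu> \<sigma> c a lam x \<pi>}. ereal (Jol M W \<mu> \<sigma> c a lam x \<pi>))"
      using adm J unfolding Jcl_def by (intro SUP_upper2[of "induced_control W \<mu> \<sigma> a x p"]) auto
  qed
qed

lemma uniform_limits:
  assumes K: "compact K" "K \<subseteq> {0..}"
  shows "uniform_limit K v V sequentially" "uniform_limit K d V1 sequentially"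
    "uniform_limit ({0..a} \<times> K) (\<lambda>n (w, y). pol n w y) (\<lambda>(w, y). Gibbs lam a w (1 - V1 y)) sequentially"
proof -
  from uniform_regularity obtain D S where R: "\<forall>n. \<forall>y\<ge>0. \<bar>d n y\<bar> \<le> D" "\<forall>n. \<forall>y\<ge>0. \<bar>s n y\<bar> \<le> S"
    by blast
  note D = R(1)[rule_format] and S = R(2)[rule_format]
  show "uniform_limit K v V sequentially"
    by (rule equi_lipschitz_uniform_limit[OF lipschitz_of_derivative_bound[OF derivs(1) D] v_limit K])
  show d_unif: "uniform_limit K d V1 sequentially"
    by (rule equi_lipschitz_uniform_limit[OF lipschitz_of_derivative_bound[OF derivs(2) S] d_limit K])
  have V1b: "\<bar>V1 y\<bar> \<le> D" if "y \<ge> 0" for y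
    by (rule LIMSEQ_le_const2[OF tendsto_rabs[OF d_limit[OF that]]]) (use D[OF that] in auto)
  obtain LG where LG: "LG \<ge> 0" "\<And>w y z. w \<in> {0..a} \<Longrightarrow> \<bar>y\<bar> \<le> 1 + D \<Longrightarrow> \<bar>z\<bar> \<le> 1 + D \<Longrightarrow> \<bar>G w y - G w z\<bar> \<le> LG * \<bar>y - z\<bar>"
    using Gibbs_locally_lipschitz by blast
  show "uniform_limit ({0..a} \<times> K) (\<lambda>n (w, y). pol n w y) (\<lambda>(w, y). G w (1 - V1 y)) sequentially"
  proof (rule uniform_limitI)
    fix e :: real assume e: "e > 0"
    define r where "r = e / (LG + 1)"
    have r: "r > 0" "LG * r < e" using e LG(1) by (auto simp: r_def field_simps)
    have "\<forall>\<^sub>F n in sequentially. \<forall>y\<in>K. dist (d n y) (V1 y) < r"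
      using d_unif r(1) by (rule uniform_limitD)
    \<comment> \<open>Policy \<open>Suc n\<close> is built from the gradient \<open>d n\<close>, so
      the estimate is obtained for shifted indices and the shift is undone at the end.\<close>
    then have "\<forall>\<^sub>F n in sequentially. \<forall>q\<in>{0..a} \<times> K.
        dist (case q of (w, y) \<Rightarrow> pol (Suc n) w y) (case q of (w, y) \<Rightarrow> G w (1 - V1 y)) < e"
    proof eventually_elim
      case (elim n)
      have "dist (pol (Suc n) w y) (G w (1 - V1 y)) < e" if w: "w \<in> {0..a}" and y: "y \<in> K" for w y
      proof -
        have y0: "y \<ge> 0" using y K by auto
        have "\<bar>G w (1 - d n y) - G w (1 - V1 y)\<bar> \<le> LG * \<bar>(1 - d n y) - (1 - V1 y)\<bar>"
          using D[OF y0, of n] V1b[OF y0] by (intro LG(2) w) linarith+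
        also have "\<dots> \<le> LG * r"
          using elim y LG(1) by (intro mult_left_mono) (auto simp: dist_real_def abs_minus_commute less_imp_le)
        finally show ?thesis using r(2) pol_Suc[OF y0, of n w] by (simp add: dist_real_def d_def)
      qed
      then show ?case by auto
    qed
    then show "\<forall>\<^sub>F n in sequentially. \<forall>q\<in>{0..a} \<times> K.
        dist (case q of (w, y) \<Rightarrow> pol n w y) (case q of (w, y) \<Rightarrow> G w (1 - V1 y)) < e"
      by (subst (asm) eventually_sequentially_Suc)
  qed
qed

text \<open>Boundedness of \<open>V1\<close> confines the Gibbs parameter to a compact range, where
  the density is bounded away from 0 and Lipschitz; the bound on \<open>V2\<close> carries the
  Lipschitz property over to the state.\<close>

lemma optimal_strongly_admissible:
  "strongly_admissible a (\<lambda>w y. Gibbs lam a w (1 - V1 (max 0 y)))"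
  unfolding strongly_admissible_def closed_loop_control_def
proof (intro conjI)
  obtain K where K: "\<And>y. y \<ge> 0 \<Longrightarrow> (V1 has_real_derivative V2 y) (at y within {0..})"
    "\<And>y. y \<ge> 0 \<Longrightarrow> \<bar>V1 y\<bar> \<le> K" "\<And>y. y \<ge> 0 \<Longrightarrow> \<bar>V2 y\<bar> \<le> K"
    using C2_V unfolding C2_half_line_def by blast
  have kb: "\<bar>1 - V1 y\<bar> \<le> 1 + K" if "y \<ge> 0" for y using K(2)[OF that] by linarith
  have V1l: "\<bar>V1 y - V1 z\<bar> \<le> K * \<bar>y - z\<bar>" if "y \<ge> 0" "z \<ge> 0" for y z
    by (rule lipschitz_of_derivative_bound[OF K(1,3) that])
  have "continuous_on {0..} V1" by (rule DERIV_continuous_on[OF K(1)]) simp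
  then have "continuous_on UNIV (\<lambda>y. V1 (max 0 y))"
    by (rule continuous_on_compose2) (auto intro!: continuous_intros)
  moreover have "continuous_on UNIV \<Phi>"
    using log_partition_continuous by (simp add: continuous_on_eq_continuous_at)
  ultimately have [measurable]: "(\<lambda>y. V1 (max 0 y)) \<in> borel_measurable borel" "\<Phi> \<in> borel_measurable borel"
    by (auto intro: borel_measurable_continuous_onI)
  have "(\<lambda>q. exp ((fst q * (1 - V1 (max 0 (snd q))) - \<Phi> (1 - V1 (max 0 (snd q)))) / lam)) \<in> borel_measurable (borel \<Otimes>\<^sub>M borel)"
    by measurable
  then show "(\<lambda>(w, y). G w (1 - V1 (max 0 y))) \<in> borel_measurable borel"
    by (simp add: split_beta' Gibbs_eq_exp borel_prod)
  show "\<forall>y\<ge>0. (\<forall>w\<in>{0..a}. 0 \<le> G w (1 - V1 (max 0 y))) \<and> set_integrable lborel {0..a} (\<lambda>w. G w (1 - V1 (max 0 y))) \<and>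
      (LINT w:{0..a}|lborel. G w (1 - V1 (max 0 y))) = 1"
    using Gibbs_density integral_Gibbs by blast
  obtain l u where "0 < l" "l \<le> u" "\<And>w y. w \<in> {0..a} \<Longrightarrow> \<bar>y\<bar> \<le> 1 + K \<Longrightarrow> l \<le> G w y \<and> G w y \<le> u"
    using Gibbs_bounds by blast
  then show "\<exists>l u. 0 < l \<and> l \<le> u \<and> (\<forall>w\<in>{0..a}. \<forall>y\<ge>0. l \<le> G w (1 - V1 (max 0 y)) \<and> G w (1 - V1 (max 0 y)) \<le> u)"
    using kb by (intro exI[of _ l] exI[of _ u]) auto
  obtain LG where LG: "LG \<ge> 0" "\<And>w y z. w \<in> {0..a} \<Longrightarrow> \<bar>y\<bar> \<le> 1 + K \<Longrightarrow> \<bar>z\<bar> \<le> 1 + K \<Longrightarrow> \<bar>G w y - G w z\<bar> \<le> LG * \<bar>y - z\<bar>"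
    using Gibbs_locally_lipschitz by blast
  have "\<bar>G w (1 - V1 y) - G w (1 - V1 z)\<bar> \<le> LG * K * \<bar>y - z\<bar>" if "w \<in> {0..a}" "y \<ge> 0" "z \<ge> 0" for w y z
  proof -
    have "\<bar>G w (1 - V1 y) - G w (1 - V1 z)\<bar> \<le> LG * \<bar>(1 - V1 y) - (1 - V1 z)\<bar>"
      by (intro LG(2) that kb)
    also have "\<dots> \<le> LG * (K * \<bar>y - z\<bar>)"
      using V1l[OF that(2,3)] by (intro mult_left_mono LG(1)) (simp add: abs_minus_commute)
    finally show ?thesis by (simp add: mult.assoc)
  qed
  then show "\<exists>L. \<forall>w\<in>{0..a}. \<forall>y\<ge>0. \<forall>z\<ge>0. \<bar>G w (1 - V1 (max 0 y)) - G w (1 - V1 (max 0 z))\<bar> \<le> L * \<bar>y - z\<bar>"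
    by (intro exI[of _ "LG * K"]) auto
qed

end

theorem mainTheorem13:
  fixes M :: "'a measure" and W :: "real \<Rightarrow> 'a \<Rightarrow> real"
    and \<mu> \<sigma> c a lam :: real
    and \<kappa>0 \<kappa>0' :: "real \<Rightarrow> real"
    and pol :: "nat \<Rightarrow> real \<Rightarrow> real \<Rightarrow> real"
  assumes BM: "std_brownian M W"
    and params: "\<sigma> > 0" "c > 0" "a > 0" "lam > 0"
    and A: "a > max 1 (2 * \<mu>)" "\<mu> > max c (\<sigma>\<^sup>2 / 2)"
    and kappa_C1b: "\<forall>x\<ge>0. (\<kappa>0 has_real_derivative \<kappa>0' x) (at x within {0..})"
      "continuous_on {0..} \<kappa>0'" "bounded (\<kappa>0 ` {0..})" "bounded (\<kappa>0' ` {0..})"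
    and pol0: "\<forall>w x. x \<ge> 0 \<longrightarrow> pol 0 w x = Gibbs lam a w (\<kappa>0 x)"
    and J0_nonneg: "\<forall>x\<ge>0. Jcl M W \<mu> \<sigma> c a lam x (pol 0) \<ge> 0"
    and pol_rec: "\<forall>n w x. x \<ge> 0 \<longrightarrow>
        pol (Suc n) w x = Gibbs lam a w (1 - Jcl_deriv M W \<mu> \<sigma> c a lam (pol n) x)"
  shows "\<exists>V V'.
     (\<forall>x\<ge>0. value_fn M W \<mu> \<sigma> c a lam x = ereal (V x)) \<and>
     (\<forall>x\<ge>0. (V has_real_derivative V' x) (at x within {0..})) \<and>
     (\<forall>n. \<forall>x\<ge>0. ((\<lambda>y. Jcl M W \<mu> \<sigma> c a lam y (pol n)) has_real_derivative
                    Jcl_deriv M W \<mu> \<sigma> c a lam (pol n) x) (at x within {0..})) \<and>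
     (\<forall>n. \<forall>x\<ge>0. Jcl M W \<mu> \<sigma> c a lam x (pol n) \<le> Jcl M W \<mu> \<sigma> c a lam x (pol (Suc n))) \<and>
     (\<forall>K. compact K \<and> K \<subseteq> {0..} \<longrightarrow>
        uniform_limit K (\<lambda>n x. Jcl M W \<mu> \<sigma> c a lam x (pol n)) V sequentially \<and>
        uniform_limit K (\<lambda>n x. Jcl_deriv M W \<mu> \<sigma> c a lam (pol n) x) V' sequentially \<and>
        uniform_limit ({0..a} \<times> K) (\<lambda>n (w, x). pol n w x)
           (\<lambda>(w, x). Gibbs lam a w (1 - V' x)) sequentially) \<and>
     strongly_admissible a (\<lambda>w x. Gibbs lam a w (1 - V' x)) \<and>
     (\<forall>x\<ge>0. admissible M W \<mu> \<sigma> c a lam x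
                (induced_control W \<mu> \<sigma> a x (\<lambda>w x. Gibbs lam a w (1 - V' x))) \<and>
             Jcl M W \<mu> \<sigma> c a lam x (\<lambda>w x. Gibbs lam a w (1 - V' x)) = V x)"
proof -
  obtain K0 where K0: "\<And>y. y \<ge> 0 \<Longrightarrow> \<bar>\<kappa>0 y\<bar> \<le> K0"
    using kappa_C1b(3) unfolding bounded_iff by auto
  obtain L0 where L0: "\<And>y. y \<ge> 0 \<Longrightarrow> \<bar>\<kappa>0' y\<bar> \<le> L0"
    using kappa_C1b(4) unfolding bounded_iff by auto
  interpret policy_iteration M W lam a \<mu> \<sigma> c \<kappa>0 pol K0 L0
  proof
    show "\<bar>\<kappa>0 y - \<kappa>0 z\<bar> \<le> L0 * \<bar>y - z\<bar>" if "y \<ge> 0" "z \<ge> 0" for y z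
      by (rule lipschitz_of_derivative_bound[OF _ L0 that]) (use kappa_C1b(1) in blast)
  qed (use BM params K0 pol0 J0_nonneg pol_rec in auto)
  \<comment> \<open>At negative arguments \<open>V1\<close> is an uncontrolled \<open>lim\<close>.
    Clamping changes nothing on the half-line and provides the Borel measurability on the whole
    plane that \<open>closed_loop_control\<close> demands.\<close>
  let ?V' = "\<lambda>x. V1 (max 0 x)"
  have opt: "Gibbs lam a w (1 - ?V' x) = Gibbs lam a w (1 - V1 x)" if "x \<ge> 0" for w x
    using that by simp
  have C2: "(V has_real_derivative V1 x) (at x within {0..})" if "x \<ge> 0" for x
    using C2_V that unfolding C2_half_line_def by blast
  show ?thesis
  proof (rule exI[of _ V], rule exI[of _ ?V'], intro conjI allI impI)
    fix x :: real assume x: "x \<ge> 0"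
    show "value_fn M W \<mu> \<sigma> c a lam x = ereal (V x)"
      "admissible M W \<mu> \<sigma> c a lam x (induced_control W \<mu> \<sigma> a x (\<lambda>w x. Gibbs lam a w (1 - ?V' x)))"
      "Jcl M W \<mu> \<sigma> c a lam x (\<lambda>w x. Gibbs lam a w (1 - ?V' x)) = V x"
      by (rule optimal_feedback[OF opt x]; assumption)+
    show "(V has_real_derivative ?V' x) (at x within {0..})" using C2[OF x] x by simp
    show "((\<lambda>y. Jcl M W \<mu> \<sigma> c a lam y (pol n)) has_real_derivative
        Jcl_deriv M W \<mu> \<sigma> c a lam (pol n) x) (at x within {0..})" for n
      using derivs(1)[OF x, of n] by (simp add: v_def[abs_def] d_def)
    show "Jcl M W \<mu> \<sigma> c a lam x (pol n) \<le> Jcl M W \<mu> \<sigma> c a lam x (pol (Suc n))" for n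
      using mono_step[OF x, of n] by (simp add: v_def)
  next
    fix K :: "real set" assume "compact K \<and> K \<subseteq> {0..}"
    then have K: "compact K" "K \<subseteq> {0..}" by auto
    show "uniform_limit K (\<lambda>n x. Jcl M W \<mu> \<sigma> c a lam x (pol n)) V sequentially"
      using uniform_limits(1)[OF K] by (simp add: v_def[abs_def])
    have V1_max: "V1 (max 0 x) = V1 x" if "x \<in> K" for x using that K by auto
    show "uniform_limit K (\<lambda>n x. Jcl_deriv M W \<mu> \<sigma> c a lam (pol n) x) ?V' sequentially"
      using uniform_limits(2)[OF K] V1_max unfolding d_def[abs_def]
      by (subst uniform_limit_cong'[where g = "\<lambda>n x. Jcl_deriv M W \<mu> \<sigma> c a lam (pol n) x" and i = V1]) auto
    show "uniform_limit ({0..a} \<times> K) (\<lambda>n (w, x). pol n w x) (\<lambda>(w, x). Gibbs lam a w (1 - ?V' x)) sequentially"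
      using uniform_limits(3)[OF K] V1_max
      by (subst uniform_limit_cong'[where g = "\<lambda>n (w, x). pol n w x" and i = "\<lambda>(w, x). Gibbs lam a w (1 - V1 x)"]) auto
  qed (rule optimal_strongly_admissible)
qed

end
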